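(* Let $p\ge 0$ be an integer. Given a $1$-critical bifiltration $(K_{i,j})_{1\le i\le s,\,1\le j\le N}$ of a finite simplicial complex $K$ (as a list of simplices of $K$, each with its critical index pair) such that $H_p(K_{i,N})=0$ for all $i$, the vertices and edges of a graphcode of the bifiltration in homology dimension $p$ (that is, the graphcode with respect to some choice of barcode bases of the horizontal filtrations) can be computed in $O(n^3)$ time, where $n$ is the total number of simplices of $K$ of dimension $p$ or $p+1$.
   Context: All homology is simplicial homology with $\mathbb{Z}_2$ coefficients; $Z_p(\cdot)$, $B_p(\cdot)$, $H_p(\cdot)$ denote $p$-cycles, $p$-boundaries and $p$-th homology. A bifiltration of $K$ is a family of subcomplexes $K_{i,j}\subseteq K$ with $K_{i,j}\subseteq K_{i',j'}$ whenever $i\le i'$, $j\le j'$, and with $K_{s,N}=K$. It is $1$-critical if for every simplex $\sigma\in K$ there is an index pair $(i_0,j_0)$, its critical index pair, such that $\sigma\in K_{i,j}$ if and only if $i_0\le i$ and $j_0\le j$. The $i$-th horizontal filtration (slice) is $K_{i,1}\subseteq K_{i,2}\subseteq\cdots\subseteq K_{i,N}=:K_i$. Let $X_1\subseteq\cdots\subseteq X_N=X$ be a filtration of a finite simplicial complex with $H_p(X)=0$. For $\alpha\in Z_p(X)$, the birth index is the minimal $b$ with $\alpha\in Z_p(X_\ell)$ for all $\ell\ge b$, the death index is the minimal $d$ with $\alpha\in B_p(X_\ell)$ for all $\ell\ge d$, and the bar of $\alpha$ is $[b,d)$ (possibly empty). A barcode basis of $Z_p(X)$ is a basis $A$ of $Z_p(X)$,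 each element carrying its bar, such that for every $\ell$ the elements of $A$ with death index at most $\ell$ form a basis of $B_p(X_\ell)$ and the elements of $A$ with birth index at most $\ell$ form a basis of $Z_p(X_\ell)$. Given a barcode basis $A_i$ of $Z_p(K_i)$ for each horizontal filtration, the graphcode of the bifiltration (with respect to $A_1,\dots,A_s$) is the layered graph with vertex set $A_1\sqcup\cdots\sqcup A_s$, each vertex labelled by its bar and its layer $i$, in which $\alpha\in A_i$ and $\beta\in A_{i+1}$ are joined by an edge if and only if $\beta$ occurs with coefficient $1$ when $\alpha$, regarded as an element of $Z_p(K_{i+1})$ via $K_i\subseteq K_{i+1}$, is written as a linear combination of $A_{i+1}$; there are no other edges.
   Formalization: The number s of slices is assumed to satisfy s·n ≤ c·n³ for a constant c on which the O-constant may depend (for unbounded s the graphcode alone can exceed any bound in n); the input lists only the simplices of dimension p and p+1. *)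

theory Defs
  imports
    Complex_Main
    "HOL-Library.Z2"
    "HOL-Library.Function_Algebras"
    "HOL-Library.Landau_Symbols"
begin

section \<open>Simplicial homology with coefficients in the field with two elements\<close>

text \<open>Abstract simplicial complexes on natural-number vertices, so that simplices can be handed to
  a machine. A simplex of dimension \<open>p\<close> has \<open>p + 1\<close> vertices; the empty set is not a simplex.\<close>

type_synonym simplex = "nat set"
type_synonym chain = "simplex \<Rightarrow> bit"

definition finite_simplicial_complex :: "simplex set \<Rightarrow> bool" where
  "finite_simplicial_complex K \<longleftrightarrow>
     finite K \<and>
     (\<forall>\<sigma>\<in>K. finite \<sigma> \<and> \<sigma> \<noteq> {}) \<and>
     (\<forall>\<sigma>\<in>K. \<forall>\<tau>. \<tau> \<noteq> {} \<and> \<tau> \<subseteq> \<sigma> \<longrightarrow> \<tau> \<in> K)"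

definition simplices :: "nat \<Rightarrow> simplex set \<Rightarrow> simplex set" where
  "simplices p K = {\<sigma> \<in> K. card \<sigma> = p + 1}"

interpretation chain: vector_space "\<lambda>(a::bit) (c::chain) \<sigma>. a * c \<sigma>"
  by unfold_locales (auto simp: fun_eq_iff algebra_simps)

definition chains :: "nat \<Rightarrow> simplex set \<Rightarrow> chain set" where
  "chains p K = {c. \<forall>\<sigma>. c \<sigma> \<noteq> 0 \<longrightarrow> \<sigma> \<in> simplices p K}"

text \<open>The coefficient of \<open>\<tau>\<close> in the boundary is the sum of the coefficients of the simplices that have
  \<open>\<tau>\<close> as a facet. Homology is not reduced: the boundary of a vertex is zero.\<close>

definition boundary :: "chain \<Rightarrow> chain" where
  "boundary c = (\<lambda>\<tau>. if \<tau> = {} then 0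
                     else \<Sum>\<sigma> | c \<sigma> \<noteq> 0 \<and> \<tau> \<subseteq> \<sigma> \<and> card \<sigma> = card \<tau> + 1. c \<sigma>)"

definition cycles :: "nat \<Rightarrow> simplex set \<Rightarrow> chain set" where
  "cycles p K = {c \<in> chains p K. boundary c = 0}"

definition boundaries :: "nat \<Rightarrow> simplex set \<Rightarrow> chain set" where
  "boundaries p K = boundary ` chains (p + 1) K"

definition homology :: "nat \<Rightarrow> simplex set \<Rightarrow> chain set set" where
  "homology p K = cycles p K // {(x, y). x \<in> cycles p K \<and> y \<in> cycles p K \<and> x - y \<in> boundaries p K}"

text \<open>The zero element of the quotient is the class \<open>boundaries p K\<close>.\<close>

definition homology_vanishes :: "nat \<Rightarrow> simplex set \<Rightarrow> bool" where
  "homology_vanishes p K \<longleftrightarrow> homology p K = {boundaries p K}"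


section \<open>Filtrations and barcode bases\<close>

text \<open>A filtration is a map \<open>X\<close> of which only the values at \<open>1, \<dots>, N\<close> matter.\<close>

definition birth :: "nat \<Rightarrow> nat \<Rightarrow> (nat \<Rightarrow> simplex set) \<Rightarrow> chain \<Rightarrow> nat" where
  "birth p N X \<alpha> = (LEAST b. b \<in> {1..N} \<and> (\<forall>l\<in>{b..N}. \<alpha> \<in> cycles p (X l)))"

definition death :: "nat \<Rightarrow> nat \<Rightarrow> (nat \<Rightarrow> simplex set) \<Rightarrow> chain \<Rightarrow> nat" where
  "death p N X \<alpha> = (LEAST d. d \<in> {1..N} \<and> (\<forall>l\<in>{d..N}. \<alpha> \<in> boundaries p (X l)))"

definition basis_of :: "chain set \<Rightarrow> chain set \<Rightarrow> bool" where
  "basis_of A V \<longleftrightarrow> chain.independent A \<and> chain.span A = V"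

definition barcode_basis :: "nat \<Rightarrow> nat \<Rightarrow> (nat \<Rightarrow> simplex set) \<Rightarrow> chain set \<Rightarrow> bool" where
  "barcode_basis p N X A \<longleftrightarrow>
     basis_of A (cycles p (X N)) \<and>
     (\<forall>l\<in>{1..N}. basis_of {\<alpha>\<in>A. death p N X \<alpha> \<le> l} (boundaries p (X l)) \<and>
                  basis_of {\<alpha>\<in>A. birth p N X \<alpha> \<le> l} (cycles p (X l)))"


section \<open>Bifiltrations\<close>

definition bifiltration :: "simplex set \<Rightarrow> nat \<Rightarrow> nat \<Rightarrow> (nat \<Rightarrow> nat \<Rightarrow> simplex set) \<Rightarrow> bool" where
  "bifiltration K s N F \<longleftrightarrow>
     s \<ge> 1 \<and> N \<ge> 1 \<and>
     (\<forall>i\<in>{1..s}. \<forall>j\<in>{1..N}. finite_simplicial_complex (F i j) \<and> F i j \<subseteq> K) \<and>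
     (\<forall>i\<in>{1..s}. \<forall>i'\<in>{1..s}. \<forall>j\<in>{1..N}. \<forall>j'\<in>{1..N}.
        i \<le> i' \<and> j \<le> j' \<longrightarrow> F i j \<subseteq> F i' j') \<and>
     F s N = K"

definition critical_index ::
  "nat \<Rightarrow> nat \<Rightarrow> (nat \<Rightarrow> nat \<Rightarrow> simplex set) \<Rightarrow> simplex \<Rightarrow> nat \<Rightarrow> nat \<Rightarrow> bool" where
  "critical_index s N F \<sigma> i\<^sub>0 j\<^sub>0 \<longleftrightarrow>
     i\<^sub>0 \<in> {1..s} \<and> j\<^sub>0 \<in> {1..N} \<and>
     (\<forall>i\<in>{1..s}. \<forall>j\<in>{1..N}. \<sigma> \<in> F i j \<longleftrightarrow> i\<^sub>0 \<le> i \<and> j\<^sub>0 \<le> j)"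

definition one_critical :: "simplex set \<Rightarrow> nat \<Rightarrow> nat \<Rightarrow> (nat \<Rightarrow> nat \<Rightarrow> simplex set) \<Rightarrow> bool" where
  "one_critical K s N F \<longleftrightarrow> (\<forall>\<sigma>\<in>K. \<exists>i\<^sub>0 j\<^sub>0. critical_index s N F \<sigma> i\<^sub>0 j\<^sub>0)"


section \<open>Graphcodes\<close>

text \<open>\<open>A i\<close> is the chosen barcode basis of the \<open>i\<close>-th slice \<open>F i\<close>, for \<open>i = 1, \<dots>, s\<close>.
  Edges are written as pairs, oriented from layer \<open>i\<close> to layer \<open>i + 1\<close>.\<close>

definition graphcode_vertices :: "nat \<Rightarrow> (nat \<Rightarrow> chain set) \<Rightarrow> (nat \<times> chain) set" where
  "graphcode_vertices s A = (SIGMA i:{1..s}. A i)"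

definition graphcode_edges ::
  "nat \<Rightarrow> (nat \<Rightarrow> chain set) \<Rightarrow> ((nat \<times> chain) \<times> (nat \<times> chain)) set" where
  "graphcode_edges s A =
     {((i, \<alpha>), (i + 1, \<beta>)) | i \<alpha> \<beta>.
        1 \<le> i \<and> i + 1 \<le> s \<and> \<alpha> \<in> A i \<and> \<beta> \<in> A (i + 1) \<and>
        chain.representation (A (i + 1)) \<alpha> \<beta> = 1}"

text \<open>The label \<open>(i, b, d)\<close> of a vertex in layer \<open>i\<close> with bar \<open>[b, d)\<close>.\<close>

definition graphcode_label ::
  "nat \<Rightarrow> nat \<Rightarrow> (nat \<Rightarrow> nat \<Rightarrow> simplex set) \<Rightarrow> nat \<times> chain \<Rightarrow> nat \<times> nat \<times> nat" where
  "graphcode_label p N F = (\<lambda>(i, \<alpha>). (i, birth p N (F i) \<alpha>, death p N (F i) \<alpha>))"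

text \<open>A labelled graph is listed as its vertex labels \<open>vs\<close>, the \<open>k\<close>-th vertex being referred to by the
  number \<open>k\<close> (from 0), and its edges \<open>es\<close>.\<close>

definition lists_graphcode ::
  "nat \<Rightarrow> nat \<Rightarrow> nat \<Rightarrow> (nat \<Rightarrow> nat \<Rightarrow> simplex set) \<Rightarrow> (nat \<Rightarrow> chain set) \<Rightarrow>
   (nat \<times> nat \<times> nat) list \<Rightarrow> (nat \<times> nat) list \<Rightarrow> bool" where
  "lists_graphcode p s N F A vs es \<longleftrightarrow>
     (\<exists>\<phi>. bij_betw \<phi> {..<length vs} (graphcode_vertices s A) \<and>
          (\<forall>k<length vs. vs ! k = graphcode_label p N F (\<phi> k)) \<and>
          distinct es \<and> set es \<subseteq> {..<length vs} \<times> {..<length vs} \<and>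
          (\<forall>k<length vs. \<forall>l<length vs. (k, l) \<in> set es \<longleftrightarrow> (\<phi> k, \<phi> l) \<in> graphcode_edges s A))"


section \<open>Machine model\<close>

text \<open>Random access machine with additions and subtractions, no multiplication, and uniform cost, as a
  structured language. Finitely many registers and arrays of natural numbers (those named in the
  program) are available; array cells are addressed by computed indices. Each assignment and each
  test costs one unit. A fixed program contains only finitely many expressions, so counting the
  operations inside expressions as well would change running times by at most a constant factor.\<close>

datatype expr =
    Const nat
  | Reg string
  | Load string expr
  | Add expr expr
  | Sub expr expr

datatype test =
    Less expr expr
  | Equal expr expr
  | Neg test
  | Conj test test

datatype program =
    Skip
  | Assign string expr
  | Store string expr expr
  | Seq program program
  | Cond test program program
  | While test program

record state =
  regs :: "string \<Rightarrow> nat"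
  arrays :: "string \<Rightarrow> nat \<Rightarrow> nat"

primrec eval_expr :: "expr \<Rightarrow> state \<Rightarrow> nat" where
  "eval_expr (Const k) st = k"
| "eval_expr (Reg x) st = regs st x"
| "eval_expr (Load a e) st = arrays st a (eval_expr e st)"
| "eval_expr (Add e f) st = eval_expr e st + eval_expr f st"
| "eval_expr (Sub e f) st = eval_expr e st - eval_expr f st"

primrec eval_test :: "test \<Rightarrow> state \<Rightarrow> bool" where
  "eval_test (Less e f) st \<longleftrightarrow> eval_expr e st < eval_expr f st"
| "eval_test (Equal e f) st \<longleftrightarrow> eval_expr e st = eval_expr f st"
| "eval_test (Neg b) st \<longleftrightarrow> \<not> eval_test b st"
| "eval_test (Conj b c) st \<longleftrightarrow> eval_test b st \<and> eval_test c st"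

text \<open>\<open>exec P st t st'\<close>: started in \<open>st\<close>, the program halts in \<open>st'\<close> after \<open>t\<close> steps.\<close>

inductive exec :: "program \<Rightarrow> state \<Rightarrow> nat \<Rightarrow> state \<Rightarrow> bool" where
  exec_Skip: "exec Skip st 1 st"
| exec_Assign: "exec (Assign x e) st 1 (st\<lparr>regs := (regs st)(x := eval_expr e st)\<rparr>)"
| exec_Store: "exec (Store a e f) st 1
    (st\<lparr>arrays := (arrays st)(a := (arrays st a)(eval_expr e st := eval_expr f st))\<rparr>)"
| exec_Seq: "exec P st t st' \<Longrightarrow> exec Q st' u st'' \<Longrightarrow> exec (Seq P Q) st (t + u) st''"
| exec_CondTrue: "eval_test b st \<Longrightarrow> exec P st t st' \<Longrightarrow> exec (Cond b P Q) st (t + 1) st'"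
| exec_CondFalse: "\<not> eval_test b st \<Longrightarrow> exec Q st t st' \<Longrightarrow> exec (Cond b P Q) st (t + 1) st'"
| exec_WhileFalse: "\<not> eval_test b st \<Longrightarrow> exec (While b P) st 1 st"
| exec_WhileTrue: "eval_test b st \<Longrightarrow> exec P st t st' \<Longrightarrow> exec (While b P) st' u st'' \<Longrightarrow>
    exec (While b P) st (t + u + 1) st''"

text \<open>The input words are found in the array \<open>''in''\<close>, everything else being zero; the output words are
  the first \<open>''out_length''\<close> cells of the array \<open>''out''\<close>.\<close>

definition initial_state :: "nat list \<Rightarrow> state" where
  "initial_state ws =
     \<lparr>regs = (\<lambda>_. 0),
      arrays = (\<lambda>a k. if a = ''in'' \<and> k < length ws then ws ! k else 0)\<rparr>"

definition output_words :: "state \<Rightarrow> nat list" where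
  "output_words st = map (arrays st ''out'') [0..<regs st ''out_length'']"

definition outputs_in_time :: "program \<Rightarrow> nat list \<Rightarrow> nat list \<Rightarrow> nat \<Rightarrow> bool" where
  "outputs_in_time P input output t \<longleftrightarrow>
     (\<exists>st. exec P (initial_state input) t st \<and> output_words st = output)"


section \<open>Input and output of graphcode computations\<close>

definition num_simplices :: "nat \<Rightarrow> simplex set \<Rightarrow> nat" where
  "num_simplices p K = card (simplices p K) + card (simplices (p + 1) K)"

text \<open>The simplices of dimensions \<open>p\<close> and \<open>p + 1\<close>, each given once by its vertices in some order, with
  their critical index pairs. Simplices of other dimensions are not listed: reading them would not
  be covered by a bound in terms of \<open>num_simplices p K\<close>.\<close>

definition lists_bifiltration ::
  "nat \<Rightarrow> simplex set \<Rightarrow> nat \<Rightarrow> nat \<Rightarrow> (nat \<Rightarrow> nat \<Rightarrow> simplex set) \<Rightarrow>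
   (nat list \<times> nat \<times> nat) list \<Rightarrow> bool" where
  "lists_bifiltration p K s N F L \<longleftrightarrow>
     distinct (map (\<lambda>(v, i\<^sub>0, j\<^sub>0). set v) L) \<and>
     (\<lambda>(v, i\<^sub>0, j\<^sub>0). set v) ` set L = simplices p K \<union> simplices (p + 1) K \<and>
     (\<forall>(v, i\<^sub>0, j\<^sub>0) \<in> set L. distinct v \<and> critical_index s N F (set v) i\<^sub>0 j\<^sub>0)"

definition input_encoding :: "nat \<Rightarrow> nat \<Rightarrow> (nat list \<times> nat \<times> nat) list \<Rightarrow> nat list" where
  "input_encoding s N L =
     [s, N, length L] @ concat (map (\<lambda>(v, i\<^sub>0, j\<^sub>0). length v # v @ [i\<^sub>0, j\<^sub>0]) L)"

definition graph_encoding :: "(nat \<times> nat \<times> nat) list \<Rightarrow> (nat \<times> nat) list \<Rightarrow> nat list" where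
  "graph_encoding vs es =
     [length vs] @ concat (map (\<lambda>(i, b, d). [i, b, d]) vs) @
     [length es] @ concat (map (\<lambda>(k, l). [k, l]) es)"

end

theory Submission
  imports Defs
begin

text \<open>When the \<open>p\<close>-th homology of the slice \<open>F i N\<close> vanishes, its
    \<open>p\<close>-cycles are exactly the boundaries of
its \<open>(p + 1)\<close>-simplices, so that only the boundary matrix between dimensions \<open>p +
    1\<close> and \<open>p\<close> matters.
List the \<open>n\<close> simplices of both dimensions once and for all by their column grade and write
    \<open>D t\<close> for the
boundary of the \<open>t\<close>-th one. Suppose that chains \<open>R t\<close>, one for each simplex
    present in the slice, differ
from \<open>D t\<close> by combinations of earlier \<open>D u\<close>, and that the nonzero ones have
    pairwise different lowest
rows. Then the nonzero \<open>R t\<close> are a barcode basis: those with \<open>t\<close> of grade at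
    most \<open>l\<close> span the
boundaries at \<open>l\<close>, and those whose lowest row has grade at most \<open>l\<close> span the
    cycles at \<open>l\<close>, because the
lowest row of a sum of such chains is the largest of their lowest rows. Hence the bar of \<open>R
    t\<close> runs from
the grade of its lowest row to the grade of \<open>t\<close>. This is the locale
    \<open>reduced_slice\<close>, with the result
\<open>barcode_basis_R\<close>.

One slice is turned into the next by continuing the column reduction. In layer \<open>i\<close> the
    columns present
are scanned in their fixed order; while the lowest row of column \<open>c\<close> is already the lowest
    row of an
earlier column \<open>t\<close>, which has its final value for this layer, column \<open>t\<close> is
    added to column \<open>c\<close>. This
restores different lowest rows also when new columns have appeared in the middle of the order. If
    \<open>U\<close> is
the set of the columns that were added, then the old column \<open>c\<close> equals the new column
    \<open>c\<close> plus the sum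
over \<open>u\<close> in \<open>U\<close> of the final columns \<open>u\<close>, and these are all
    different since the lowest row strictly
decreases. This is the expansion of the old basis element in the new basis, so the graphcode edges are
read off from the additions at no extra cost (\<open>edges_step\<close>, \<open>edge_iff\<close>).

The lowest row of a column never increases, whatever the layer. Over the whole run there are therefore at
most \<open>n\<^sup>2\<close> additions, each of cost \<open>O(n)\<close>; sorting and setting up the matrix
takes \<open>O(n\<^sup>2)\<close>, and everything else costs \<open>O(n)\<close> per layer, which is
    \<open>O(s * n)\<close> in total. In the proof the sum of the lowest rows serves as potential
    (\<open>potential\<close>, \<open>cost\<close>).

The program is verified by a weakest-precondition calculus that carries the elapsed time
(\<open>wp_While\<close>, \<open>wp_count\<close>). The values of all columns in all layers, the sets
    \<open>U\<close>, and the vertices and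
edges found so far, as pairs of a layer and a column, are ghost data related to the machine state by the
predicates \<open>reduced\<close> and \<open>recorded\<close>.\<close>

section \<open>Chains over the field with two elements\<close>

text \<open>The exclusive-or normal form of addition and the conjunction normal form of multiplication would
  be rewritten into the scalar product that the span of a set of chains carries as a parameter.\<close>
declare add_bit_eq_xor [simp del] and mult_bit_eq_and [simp del]

lemma bit_add_self [simp]: "(a::bit) + a = 0"
  by (cases a) auto

lemma bit_cases_one: "(a::bit) = 0 \<or> a = 1" by (cases a) auto

lemma sum_chain_apply: "(\<Sum>a\<in>A. f a) \<sigma> = (\<Sum>a\<in>A. (f a :: chain) \<sigma>)"
  by (induction A rule: infinite_finite_induct) auto

lemma chain_add_self [simp]: "(c::chain) + c = 0"
  by (auto simp: fun_eq_iff)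

text \<open>Over two elements a linear combination is the sum of a finite subset, so spans and representations
  become statements about subsets.\<close>
lemma span_bit:
  "x \<in> chain.span A \<longleftrightarrow> (\<exists>S. finite S \<and> S \<subseteq> A \<and> x =
      (\<Sum>a\<in>S. a))"
proof
  assume "x \<in> chain.span A"
  then obtain t r where t: "finite t" "t \<subseteq> A" and x: "x = (\<Sum>a\<in>t. (\<lambda>\<sigma>.
      r a * a \<sigma>))"
    by (auto simp: chain.span_explicit)
  have "x = (\<Sum>a\<in>t. if r a = 1 then a else 0)"
    unfolding x by (rule sum.cong) (use bit_cases_one in \<open>auto simp: fun_eq_iff\<close>)
  also have "\<dots> = (\<Sum>a\<in>{a\<in>t. r a = 1}. a)"
    using t by (simp add: sum.inter_filter)
  finally show "\<exists>S. finite S \<and> S \<subseteq> A \<and> x = (\<Sum>a\<in>S. a)"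
    using t by (intro exI[of _ "{a\<in>t. r a = 1}"]) auto
next
  assume "\<exists>S. finite S \<and> S \<subseteq> A \<and> x = (\<Sum>a\<in>S. a)"
  then show "x \<in> chain.span A"
    by (auto intro!: chain.span_sum intro: chain.span_base)
qed

lemma span_image_bit:
  "x \<in> chain.span (R ` I) \<longleftrightarrow> (\<exists>U. finite U \<and> U \<subseteq> I \<and>
      x = (\<Sum>u\<in>U. R u))"
proof
  assume "x \<in> chain.span (R ` I)"
  then obtain S where S: "finite S" "S \<subseteq> R ` I" "x = (\<Sum>a\<in>S. a)"
    by (auto simp: span_bit)
  from S(2) obtain U where U: "U \<subseteq> I" "inj_on R U" "S = R ` U"
    by (metis subset_image_inj)
  with S have "finite U" "x = (\<Sum>u\<in>U. R u)"
    by (auto simp: finite_image_iff sum.reindex)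
  with U show "\<exists>U. finite U \<and> U \<subseteq> I \<and> x = (\<Sum>u\<in>U. R u)" by blast
next
  assume "\<exists>U. finite U \<and> U \<subseteq> I \<and> x = (\<Sum>u\<in>U. R u)"
  then show "x \<in> chain.span (R ` I)"
    by (auto intro!: chain.span_sum intro: chain.span_base)
qed

lemma representation_subset_sum:
  assumes "chain.independent A" "finite B" "B \<subseteq> A"
  shows "chain.representation A (\<Sum>a\<in>B. a) \<beta> = (if \<beta> \<in> B then 1 else 0)"
proof -
  have "chain.representation A (\<Sum>a\<in>B. a) \<beta> = (\<Sum>a\<in>B. chain.representation A a \<beta>)"
    using assms by (subst chain.representation_sum) (auto intro: chain.span_base)
  also have "\<dots> = (\<Sum>a\<in>B. if a = \<beta> then 1 else 0)"
    using assms by (intro sum.cong) (auto simp: chain.representation_basis)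
  finally show ?thesis using assms by simp
qed

section \<open>Pivots and boundaries\<close>

text \<open>The lowest nonzero row among the first \<open>k\<close>, counted from 1, so that 0 stands
    for the zero column.
  The recursion mirrors the loops that maintain this number while they scan a column.\<close>
primrec pivot :: "(nat \<Rightarrow> bit) \<Rightarrow> nat \<Rightarrow> nat" where
  "pivot f 0 = 0"
| "pivot f (Suc k) = (if f k \<noteq> 0 then Suc k else pivot f k)"

lemma pivot_le: "pivot f k \<le> k"
  by (induction k) auto

lemma pivot_nonzero: "pivot f k \<noteq> 0 \<Longrightarrow> f (pivot f k - 1) \<noteq> 0"
  by (induction k) (auto split: if_splits)

lemma above_pivot: "pivot f k \<le> r \<Longrightarrow> r < k \<Longrightarrow> f r = 0"
  by (induction k) (auto split: if_splits simp: less_Suc_eq)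

lemma pivot_eqI:
  assumes "m \<noteq> 0" "m \<le> k" "f (m - 1) \<noteq> 0" "\<And>r. m \<le> r \<Longrightarrow> r < k
      \<Longrightarrow> f r = 0"
  shows "pivot f k = m"
proof (rule antisym)
  show "m \<le> pivot f k"
    using above_pivot[of f k "m - 1"] assms by fastforce
  show "pivot f k \<le> m"
    using pivot_nonzero[of f k] pivot_le[of f k] assms(4)[of "pivot f k - 1"] by fastforce
qed

text \<open>The two leading ones cancel; this makes the reduction of a column end.\<close>
lemma pivot_add_less:
  assumes "pivot f k = pivot g k" "pivot f k \<noteq> 0"
  shows "pivot (\<lambda>r. f r + g r) k < pivot f k"
proof (rule ccontr)
  let ?h = "\<lambda>r. f r + g r"
  assume "\<not> ?thesis"
  then have le: "pivot f k \<le> pivot ?h k" by simp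
  with assms have nz: "pivot ?h k \<noteq> 0" by simp
  note p = pivot_nonzero[OF nz]
  show False
  proof (cases "pivot ?h k = pivot f k")
    case True
    then show False using p pivot_nonzero[of f k] pivot_nonzero[of g k] assms by auto
  next
    case False
    then have "f (pivot ?h k - 1) = 0" "g (pivot ?h k - 1) = 0"
      using le assms pivot_le[of ?h k] by (auto intro!: above_pivot[of _ k])
    with p show False by simp
  qed
qed

text \<open>At the largest pivot exactly one summand is nonzero and nothing can cancel.\<close>
lemma pivot_sum:
  assumes U: "finite U" "U \<noteq> {}" and nz: "\<And>u. u \<in> U \<Longrightarrow> pivot (f u) k
      \<noteq> 0"
    and inj: "inj_on (\<lambda>u. pivot (f u) k) U"
  shows "pivot (\<lambda>r. \<Sum>u\<in>U. f u r) k = Max ((\<lambda>u. pivot (f u) k) ` U)"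
proof -
  let ?m = "Max ((\<lambda>u. pivot (f u) k) ` U)"
  have "?m \<in> (\<lambda>u. pivot (f u) k) ` U" using U by (intro Max_in) auto
  then obtain v where v: "v \<in> U" "pivot (f v) k = ?m" by auto
  have le: "pivot (f u) k \<le> ?m" if "u \<in> U" for u using U that by auto
  have less: "pivot (f u) k \<le> ?m - 1" if "u \<in> U - {v}" for u
    using le[of u] that v inj by (force simp: inj_on_def)
  have m: "?m \<noteq> 0" "?m \<le> k" using nz[OF v(1)] v(2) pivot_le[of "f v" k] by simp_all
  show ?thesis
  proof (rule pivot_eqI)
    have "(\<Sum>u\<in>U. f u (?m - 1)) = f v (?m - 1) + (\<Sum>u\<in>U - {v}. f u (?m - 1))"
      using U v by (simp add: sum.remove)
    also have "(\<Sum>u\<in>U - {v}. f u (?m - 1)) = 0"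
      using less m by (intro sum.neutral ballI above_pivot[of _ k]) auto
    finally show "(\<Sum>u\<in>U. f u (?m - 1)) \<noteq> 0"
      using pivot_nonzero[of "f v" k] v m by simp
    show "(\<Sum>u\<in>U. f u r) = 0" if "?m \<le> r" "r < k" for r
      using le that by (intro sum.neutral ballI above_pivot[of _ k]) (auto intro: order_trans)
  qed (use m in auto)
qed

text \<open>The boundary of a single \<open>(p + 1)\<close>-simplex; for any other simplex it is set to
    zero, so that all
  listed simplices, of either dimension, can index both the rows and the columns of one square matrix.\<close>
definition facets :: "nat \<Rightarrow> simplex \<Rightarrow> chain" where
  "facets p \<sigma> = (\<lambda>\<tau>. if card \<sigma> = p + 2 \<and> card \<tau> = p + 1 \<and>
      \<tau> \<subseteq> \<sigma> then 1 else 0)"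

lemma boundary_eq_sum_facets:
  assumes "finite S" "\<And>\<sigma>. \<sigma> \<in> S \<Longrightarrow> card \<sigma> = p + 2"
      "\<And>\<sigma>. c \<sigma> \<noteq> 0 \<longleftrightarrow> \<sigma> \<in> S"
  shows "boundary c = (\<Sum>\<sigma>\<in>S. facets p \<sigma>)"
proof
  fix \<tau> :: simplex
  have S: "{\<sigma>. c \<sigma> \<noteq> 0 \<and> \<tau> \<subseteq> \<sigma> \<and> card \<sigma> =
      card \<tau> + 1} = {\<sigma>\<in>S. \<tau> \<subseteq> \<sigma> \<and> card \<tau> = p + 1}"
    using assms by auto
  have "(\<Sum>\<sigma> | c \<sigma> \<noteq> 0 \<and> \<tau> \<subseteq> \<sigma> \<and> card \<sigma>
      = card \<tau> + 1. c \<sigma>)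
      = (\<Sum>\<sigma>\<in>{\<sigma>\<in>S. \<tau> \<subseteq> \<sigma> \<and> card \<tau> = p + 1}. 1)"
    unfolding S using assms(3) by (intro sum.cong) auto
  also have "\<dots> = (\<Sum>\<sigma>\<in>S. if \<tau> \<subseteq> \<sigma> \<and> card \<tau> = p + 1
      then 1 else 0)"
    by (rule sum.inter_filter[OF assms(1)])
  also have "\<dots> = (\<Sum>\<sigma>\<in>S. facets p \<sigma>) \<tau>"
    unfolding sum_chain_apply facets_def using assms(2) by (intro sum.cong) auto
  finally show "boundary c \<tau> = (\<Sum>\<sigma>\<in>S. facets p \<sigma>) \<tau>"
    by (auto simp: boundary_def sum_chain_apply facets_def intro!: sum.neutral[symmetric])
qed

lemma boundaries_eq_span:
  assumes "finite (simplices (p + 1) Y)"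
  shows "boundaries p Y = chain.span (facets p ` simplices (p + 1) Y)"
proof (intro set_eqI iffI)
  fix x assume "x \<in> boundaries p Y"
  then obtain c where c: "c \<in> chains (p + 1) Y" "x = boundary c" by (auto simp: boundaries_def)
  let ?S = "{\<sigma>. c \<sigma> \<noteq> 0}"
  have S: "?S \<subseteq> simplices (p + 1) Y" using c by (auto simp: chains_def)
  then have "finite ?S" using assms finite_subset by blast
  moreover from this S have "x = (\<Sum>\<sigma>\<in>?S. facets p \<sigma>)"
    unfolding c(2) by (intro boundary_eq_sum_facets) (auto simp: simplices_def)
  ultimately show "x \<in> chain.span (facets p ` simplices (p + 1) Y)"
    using S by (auto simp: span_image_bit)
next
  fix x assume "x \<in> chain.span (facets p ` simplices (p + 1) Y)"
  then obtain S where S: "finite S" "S \<subseteq> simplices (p + 1) Y" "x = (\<Sum>\<sigma>\<in>S.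
      facets p \<sigma>)"
    by (auto simp: span_image_bit)
  let ?c = "\<lambda>\<sigma>. if \<sigma> \<in> S then 1 else 0 :: bit"
  have "boundary ?c = x"
    unfolding S(3) using S by (intro boundary_eq_sum_facets) (auto simp: simplices_def)
  moreover have "?c \<in> chains (p + 1) Y" using S by (auto simp: chains_def)
  ultimately show "x \<in> boundaries p Y" by (auto simp: boundaries_def)
qed

text \<open>A homology class is a set of cycles and the classes cover all cycles; here the boundaries are the
  only class.\<close>
lemma homology_vanishes_cycles:
  assumes "homology_vanishes p Y" and "finite (simplices (p + 1) Y)"
  shows "cycles p Y = boundaries p Y"
proof -
  let ?r = "{(x, y). x \<in> cycles p Y \<and> y \<in> cycles p Y \<and> x - y \<in> boundaries p Y}"
  have H: "cycles p Y // ?r = {boundaries p Y}"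
    using assms(1) by (simp add: homology_vanishes_def homology_def)
  have 0: "0 \<in> boundaries p Y"
    unfolding boundaries_eq_span[OF assms(2)] by (rule chain.span_zero)
  have "boundaries p Y \<subseteq> cycles p Y"
  proof -
    have "boundaries p Y \<in> cycles p Y // ?r" using H by simp
    then show ?thesis by (rule quotientE) auto
  qed
  moreover have "x \<in> boundaries p Y" if "x \<in> cycles p Y" for x
  proof -
    have "?r `` {x} \<in> cycles p Y // ?r" using that by (rule quotientI)
    then have "?r `` {x} = boundaries p Y" using H by simp
    moreover have "x \<in> ?r `` {x}" using that 0 by simp
    ultimately show ?thesis by simp
  qed
  ultimately show ?thesis by blast
qed

section \<open>Reduced columns form a barcode basis\<close>

definition low :: "(nat \<Rightarrow> simplex) \<Rightarrow> nat \<Rightarrow> chain \<Rightarrow> nat" where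
  "low sx n c = pivot (\<lambda>r. c (sx r)) n"

text \<open>One slice \<open>X\<close>: \<open>sx\<close> lists simplices in the order of their grades
    \<open>J\<close>, \<open>act\<close> is the set of those that
  occur in the slice, and \<open>R\<close> are its reduced columns.\<close>
locale reduced_slice =
  fixes p N :: nat and X :: "nat \<Rightarrow> simplex set"
    and n :: nat and sx :: "nat \<Rightarrow> simplex" and J :: "nat \<Rightarrow> nat"
    and act :: "nat set" and R :: "nat \<Rightarrow> chain"
  assumes N: "1 \<le> N"
    and act: "act \<subseteq> {..<n}"
    and sx_inj: "inj_on sx {..<n}"
    and J_mono: "\<And>r r'. r \<le> r' \<Longrightarrow> r' < n \<Longrightarrow> J r \<le> J r'"
    and J_range: "\<And>t. t \<in> act \<Longrightarrow> J t \<in> {1..N}"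
    and mem: "\<And>l q. l \<in> {1..N} \<Longrightarrow> q \<in> {p, p + 1} \<Longrightarrow>
      simplices q (X l) = sx ` {t\<in>act. card (sx t) = q + 1 \<and> J t \<le> l}"
    and vanish: "homology_vanishes p (X N)"
    and R: "\<And>t. t \<in> act \<Longrightarrow> R t - facets p (sx t) \<in> chain.span ((\<lambda>u.
        facets p (sx u)) ` {u\<in>act. u < t})"
    and low_inj: "\<And>t u. t \<in> act \<Longrightarrow> u \<in> act \<Longrightarrow> R t \<noteq> 0
        \<Longrightarrow> low sx n (R t) = low sx n (R u) \<Longrightarrow> t = u"
begin

abbreviation "D t \<equiv> facets p (sx t)"
abbreviation "ind \<equiv> {t\<in>act. R t \<noteq> 0}"
abbreviation "lw t \<equiv> low sx n (R t)"

lemma fin_act: "finite act" using act finite_subset by blast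

lemma fin_simplices: "l \<in> {1..N} \<Longrightarrow> finite (simplices (p + 1) (X l))"
  using mem[of l "p + 1"] fin_act by simp

lemma J_le: "u \<le> t \<Longrightarrow> t \<in> act \<Longrightarrow> J t \<le> l \<Longrightarrow> J
    u \<le> l"
  using J_mono[of u t] act by (auto intro: order_trans)

text \<open>The change from \<open>D\<close> to \<open>R\<close> is unitriangular, hence invertible by
    induction along the order.\<close>
lemma D_span: "t \<in> act \<Longrightarrow> D t \<in> chain.span (R ` {u\<in>act. u \<le> t})"
proof (induction t rule: less_induct)
  case (less t)
  have "D u \<in> chain.span (R ` {u\<in>act. u \<le> t})" if "u \<in> act" "u < t" for u
    using less.IH[of u] that chain.span_mono[of "R ` {v\<in>act. v \<le> u}" "R ` {u\<in>act. u \<le>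
        t}"] by force
  then have "chain.span (D ` {u\<in>act. u < t}) \<subseteq> chain.span (R ` {u\<in>act. u \<le> t})"
    by (intro chain.span_minimal) auto
  with R[OF less.prems] have "R t - D t \<in> chain.span (R ` {u\<in>act. u \<le> t})" by blast
  moreover have "R t \<in> chain.span (R ` {u\<in>act. u \<le> t})"
    using less.prems by (intro chain.span_base) auto
  ultimately have "R t - (R t - D t) \<in> chain.span (R ` {u\<in>act. u \<le> t})" by (rule
      chain.span_diff[rotated])
  then show ?case by simp
qed

lemma boundaries_span:
  assumes l: "l \<in> {1..N}"
  shows "boundaries p (X l) = chain.span (R ` {t\<in>ind. J t \<le> l})"
proof -
  let ?I = "{t\<in>act. J t \<le> l}"
  have "chain.span (facets p ` simplices (p + 1) (X l)) = chain.span (D ` ?I)"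
  proof (intro chain.span_eq[THEN iffD2] conjI subsetI)
    fix x assume "x \<in> facets p ` simplices (p + 1) (X l)"
    then show "x \<in> chain.span (D ` ?I)"
      using mem[OF l, of "p + 1"] by (auto intro: chain.span_base)
  next
    fix x assume "x \<in> D ` ?I"
    then obtain t where t: "t \<in> act" "J t \<le> l" "x = D t" by auto
    show "x \<in> chain.span (facets p ` simplices (p + 1) (X l))"
    proof (cases "card (sx t) = p + 2")
      case True
      then show ?thesis using t mem[OF l, of "p + 1"] by (auto intro: chain.span_base)
    next
      case False
      then have "x = 0" by (auto simp: t facets_def fun_eq_iff)
      then show ?thesis using chain.span_zero by simp
    qed
  qed
  also have "chain.span (D ` ?I) = chain.span (R ` ?I)"
  proof (intro chain.span_eq[THEN iffD2] conjI subsetI)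
    fix x assume "x \<in> D ` ?I"
    then obtain t where t: "t \<in> act" "J t \<le> l" "x = D t" by auto
    have "R ` {u\<in>act. u \<le> t} \<subseteq> R ` ?I" using J_le[of _ t] t by (intro image_mono) auto
    with D_span[OF t(1)] t(3) chain.span_mono show "x \<in> chain.span (R ` ?I)" by blast
  next
    fix x assume "x \<in> R ` ?I"
    then obtain t where t: "t \<in> act" "J t \<le> l" "x = R t" by auto
    have "D ` {u\<in>act. u < t} \<subseteq> D ` ?I" using J_le[of _ t] t by (intro image_mono) auto
    with R[OF t(1)] chain.span_mono have "R t - D t \<in> chain.span (D ` ?I)" by blast
    moreover have "D t \<in> chain.span (D ` ?I)" using t by (auto intro: chain.span_base)
    ultimately have "R t - D t + D t \<in> chain.span (D ` ?I)" by (rule chain.span_add)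
    then show "x \<in> chain.span (D ` ?I)" by (simp add: t)
  qed
  also have "\<dots> = chain.span (R ` ?I - {0})" by simp
  also have "R ` ?I - {0} = R ` {t\<in>ind. J t \<le> l}" by auto
  finally show ?thesis using boundaries_eq_span[OF fin_simplices[OF l]] by simp
qed

lemma cycles_top: "cycles p (X N) = chain.span (R ` ind)"
proof -
  have "{t\<in>ind. J t \<le> N} = ind" using J_range by auto
  then show ?thesis
    using homology_vanishes_cycles[OF vanish fin_simplices] boundaries_span[of N] N by simp
qed

lemma cycle_supp:
  assumes "z \<in> cycles p (X N)" "z \<sigma> \<noteq> 0"
  shows "\<exists>r\<in>act. \<sigma> = sx r \<and> card \<sigma> = p + 1"
proof -
  have "\<sigma> \<in> simplices p (X N)" using assms by (auto simp: cycles_def chains_def)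
  then show ?thesis using mem[of N p] N by auto
qed

lemma R_cycle: "t \<in> act \<Longrightarrow> R t \<in> cycles p (X N)"
  unfolding cycles_top using chain.span_zero
  by (cases "R t = 0") (auto intro: chain.span_base)

lemma low_zero: assumes "z \<in> cycles p (X N)" "low sx n z = 0" shows "z = 0"
proof -
  have "z \<sigma> = 0" for \<sigma>
    using cycle_supp[OF assms(1), of \<sigma>] above_pivot[of "\<lambda>r. z (sx r)" n] assms(2) act
    by (fastforce simp: low_def)
  then show ?thesis by (auto simp: fun_eq_iff)
qed

lemma lw_nonzero: "t \<in> ind \<Longrightarrow> lw t \<noteq> 0"
  using low_zero R_cycle by blast

lemma lw_inj: "inj_on lw ind"
  using low_inj by (auto simp: inj_on_def)

text \<open>The lowest row of a cycle is thus read off from its expansion, which gives both independence and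
  the cycle part of the barcode basis.\<close>
lemma low_sum:
  assumes "U \<subseteq> ind" "U \<noteq> {}"
  shows "low sx n (\<Sum>u\<in>U. R u) = Max (lw ` U)"
proof -
  have "finite U" using assms fin_act by (auto intro: finite_subset)
  moreover have "pivot (\<lambda>r. R u (sx r)) n \<noteq> 0" if "u \<in> U" for u
    using lw_nonzero[of u] assms that by (auto simp: low_def)
  moreover have "inj_on (\<lambda>u. pivot (\<lambda>r. R u (sx r)) n) U"
    using inj_on_subset[OF lw_inj assms(1)] by (simp add: low_def)
  ultimately show ?thesis
    using pivot_sum[of U "\<lambda>u r. R u (sx r)" n] assms(2) by (simp add: low_def sum_chain_apply)
qed

lemma sum_nonzero:
  assumes "U \<subseteq> ind" "U \<noteq> {}"
  shows "(\<Sum>u\<in>U. R u) \<noteq> 0"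
proof
  assume "(\<Sum>u\<in>U. R u) = 0"
  moreover have "low sx n 0 = 0"
  proof -
    have "pivot (\<lambda>r. 0) n = 0" by (induction n) auto
    then show ?thesis by (simp add: low_def)
  qed
  ultimately have "Max (lw ` U) = 0" using low_sum[OF assms] by simp
  moreover have "finite U" using assms fin_act by (auto intro: finite_subset)
  then have "Max (lw ` U) \<in> lw ` U" using assms by (intro Max_in) auto
  ultimately show False using lw_nonzero assms by fastforce
qed

lemma R_inj: "inj_on R ind"
  using lw_inj by (auto simp: inj_on_def)

lemma independent_R: "chain.independent (R ` ind)"
proof
  assume "chain.dependent (R ` ind)"
  then obtain a where a: "a \<in> R ` ind" "a \<in> chain.span (R ` ind - {a})"
    by (auto simp: chain.dependent_def)
  then obtain t where t: "t \<in> ind" "a = R t" by auto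
  have "R ` ind - {a} = R ` (ind - {t})" using t R_inj by (auto simp: inj_on_def)
  with a obtain U where U: "finite U" "U \<subseteq> ind - {t}" "a = (\<Sum>u\<in>U. R u)"
    by (auto simp: span_image_bit)
  then have "(\<Sum>u\<in>insert t U. R u) = a + a" using t by (subst sum.insert) auto
  then have "(\<Sum>u\<in>insert t U. R u) = 0" by simp
  with sum_nonzero[of "insert t U"] U t show False by auto
qed

lemma J_low_range: "t \<in> ind \<Longrightarrow> J (lw t - 1) \<in> {1..N} \<and> lw t - 1 \<in> act"
proof -
  assume t: "t \<in> ind"
  have "R t (sx (lw t - 1)) \<noteq> 0"
    using pivot_nonzero[of "\<lambda>r. R t (sx r)" n] lw_nonzero[OF t] by (simp add: low_def)
  then obtain r where r: "r \<in> act" "sx (lw t - 1) = sx r" using cycle_supp R_cycle t by blast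
  have "lw t - 1 < n" using lw_nonzero[OF t] pivot_le[of "\<lambda>r. R t (sx r)" n] by (simp add: low_def)
  with r sx_inj act have "lw t - 1 = r" by (auto simp: inj_on_def)
  with r J_range show ?thesis by auto
qed

text \<open>A cycle of the whole slice lies in stage \<open>l\<close> as soon as its last simplex does,
    because the simplices
  are sorted by grade.\<close>
lemma cycles_iff: 
  assumes l: "l \<in> {1..N}"
  shows "z \<in> cycles p (X l) \<longleftrightarrow> z \<in> cycles p (X N) \<and> (z = 0 \<or> J (low
      sx n z - 1) \<le> l)"
proof
  assume z: "z \<in> cycles p (X l)"
  have "simplices p (X l) \<subseteq> simplices p (X N)"
    using mem[OF l, of p] mem[of N p] l N by auto
  with z have zN: "z \<in> cycles p (X N)" by (auto simp: cycles_def chains_def)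
  moreover have "J (low sx n z - 1) \<le> l" if "z \<noteq> 0"
  proof -
    have "low sx n z \<noteq> 0" using low_zero zN that by blast
    then have "z (sx (low sx n z - 1)) \<noteq> 0" and lt: "low sx n z - 1 < n"
      using pivot_nonzero[of "\<lambda>r. z (sx r)" n] pivot_le[of "\<lambda>r. z (sx r)" n] by (auto
          simp: low_def)
    then have "sx (low sx n z - 1) \<in> simplices p (X l)" using z by (auto simp: cycles_def chains_def)
    then obtain r where "r \<in> act" "sx (low sx n z - 1) = sx r" "J r \<le> l" using mem[OF l, of p] by auto
    moreover from this have "low sx n z - 1 = r" using sx_inj lt act by (auto simp: inj_on_def)
    ultimately show ?thesis by simp
  qed
  ultimately show "z \<in> cycles p (X N) \<and> (z = 0 \<or> J (low sx n z - 1) \<le> l)" by blast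
next
  assume z: "z \<in> cycles p (X N) \<and> (z = 0 \<or> J (low sx n z - 1) \<le> l)"
  have "\<sigma> \<in> simplices p (X l)" if nz: "z \<sigma> \<noteq> 0" for \<sigma>
  proof -
    obtain r where r: "r \<in> act" "\<sigma> = sx r" "card \<sigma> = p + 1" using cycle_supp z nz by blast
    have "r < low sx n z"
      using above_pivot[of "\<lambda>r. z (sx r)" n r] r nz act by (force simp: low_def)
    then have "J r \<le> J (low sx n z - 1)"
      using pivot_le[of "\<lambda>r. z (sx r)" n] by (intro J_mono) (auto simp: low_def)
    also have "\<dots> \<le> l" using z nz by auto
    finally show ?thesis using r mem[OF l, of p] by auto
  qed
  with z show "z \<in> cycles p (X l)" by (auto simp: cycles_def chains_def)
qed

lemma cycles_span:
  assumes l: "l \<in> {1..N}"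
  shows "cycles p (X l) = chain.span (R ` {t\<in>ind. J (lw t - 1) \<le> l})"
proof (intro set_eqI iffI)
  fix z assume z: "z \<in> cycles p (X l)"
  then have "z \<in> chain.span (R ` ind)" using cycles_iff[OF l] cycles_top by simp
  then obtain U where U: "finite U" "U \<subseteq> ind" and zU: "z = (\<Sum>u\<in>U. R u)"
    unfolding span_image_bit by (elim exE conjE)
  have "J (lw u - 1) \<le> l" if u: "u \<in> U" for u
  proof -
    from u have ne: "U \<noteq> {}" by auto
    have "z \<noteq> 0" unfolding zU by (rule sum_nonzero[OF U(2) ne])
    then have J: "J (low sx n z - 1) \<le> l" using z cycles_iff[OF l] by simp
    have "low sx n z = Max (lw ` U)" unfolding zU by (rule low_sum[OF U(2) ne])
    then have "lw u \<le> low sx n z" using U(1) u by simp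
    moreover have "low sx n z \<le> n" by (simp add: low_def pivot_le)
    moreover have "lw u \<noteq> 0" using lw_nonzero u U by blast
    ultimately have "J (lw u - 1) \<le> J (low sx n z - 1)" by (intro J_mono) auto
    with J show ?thesis by simp
  qed
  with U have "U \<subseteq> {t\<in>ind. J (lw t - 1) \<le> l}" by auto
  with U(1) zU show "z \<in> chain.span (R ` {t\<in>ind. J (lw t - 1) \<le> l})"
    unfolding span_image_bit by blast
next
  fix z assume "z \<in> chain.span (R ` {t\<in>ind. J (lw t - 1) \<le> l})"
  then obtain U where U: "finite U" "U \<subseteq> {t\<in>ind. J (lw t - 1) \<le> l}" and zU: "z =
      (\<Sum>u\<in>U. R u)"
    unfolding span_image_bit by (elim exE conjE)
  have sub: "U \<subseteq> ind" using U by auto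
  have "z \<in> cycles p (X N)" unfolding cycles_top span_image_bit using U(1) sub zU by blast
  moreover have "z = 0 \<or> J (low sx n z - 1) \<le> l"
  proof (cases "U = {}")
    case True
    then show ?thesis by (simp add: zU)
  next
    case False
    have "Max (lw ` U) \<in> lw ` U" using U(1) False by (intro Max_in) auto
    then have "low sx n z \<in> lw ` U" unfolding zU low_sum[OF sub False] .
    then show ?thesis using U(2) by auto
  qed
  ultimately show "z \<in> cycles p (X l)" using cycles_iff[OF l] by blast
qed

lemma birth_R: assumes t: "t \<in> ind" shows "birth p N X (R t) = J (lw t - 1)"
  unfolding birth_def
proof (rule Least_equality)
  have R: "R t \<in> cycles p (X l) \<longleftrightarrow> J (lw t - 1) \<le> l" if "l \<in> {1..N}" for l
    using cycles_iff[OF that] R_cycle t by auto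
  show "J (lw t - 1) \<in> {1..N} \<and> (\<forall>l\<in>{J (lw t - 1)..N}. R t \<in> cycles p (X l))"
    using J_low_range[OF t] R by auto
  fix b assume "b \<in> {1..N} \<and> (\<forall>l\<in>{b..N}. R t \<in> cycles p (X l))"
  then show "J (lw t - 1) \<le> b" using R[of b] by auto
qed

text \<open>Were \<open>R t\<close> a boundary before the grade of \<open>t\<close>, it would be a sum
    of other basis elements.\<close>
lemma death_R: assumes t: "t \<in> ind" shows "death p N X (R t) = J t"
  unfolding death_def
proof (rule Least_equality)
  have R: "R t \<in> boundaries p (X l) \<longleftrightarrow> J t \<le> l" if l: "l \<in> {1..N}" for l
  proof
    assume "R t \<in> boundaries p (X l)"
    then obtain U where U: "finite U" "U \<subseteq> {t\<in>ind. J t \<le> l}" "R t = (\<Sum>u\<in>U. R u)"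
      by (auto simp: boundaries_span[OF l] span_image_bit)
    have "t \<in> U"
    proof (rule ccontr)
      assume "t \<notin> U"
      then have "(\<Sum>u\<in>insert t U. R u) = R t + R t" using U by simp
      then show False using sum_nonzero[of "insert t U"] U t by auto
    qed
    with U show "J t \<le> l" by auto
  qed (use t in \<open>auto simp: boundaries_span[OF l] intro: chain.span_base\<close>)
  show "J t \<in> {1..N} \<and> (\<forall>l\<in>{J t..N}. R t \<in> boundaries p (X l))"
    using J_range[of t] t R by auto
  fix b assume "b \<in> {1..N} \<and> (\<forall>l\<in>{b..N}. R t \<in> boundaries p (X l))"
  then show "J t \<le> b" using R[of b] by auto
qed

theorem barcode_basis_R: "barcode_basis p N X (R ` ind)"
proof -
  have "{\<alpha> \<in> R ` ind. death p N X \<alpha> \<le> l} = R ` {t\<in>ind. J t \<le> l}" for l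
    using death_R by auto
  moreover have "{\<alpha> \<in> R ` ind. birth p N X \<alpha> \<le> l} = R ` {t\<in>ind. J (lw t - 1)
      \<le> l}" for l
    using birth_R by auto
  moreover have "chain.independent (R ` {t\<in>ind. Q t})" for Q
    using independent_R chain.dependent_mono[of "R ` {t\<in>ind. Q t}" "R ` ind"] by auto
  ultimately have "basis_of {\<alpha> \<in> R ` ind. death p N X \<alpha> \<le> l} (boundaries p (X l))"
    "basis_of {\<alpha> \<in> R ` ind. birth p N X \<alpha> \<le> l} (cycles p (X l))" if "l \<in>
        {1..N}" for l
    using boundaries_span[OF that] cycles_span[OF that] unfolding basis_of_def by simp_all
  moreover have "basis_of (R ` ind) (cycles p (X N))"
    unfolding basis_of_def using independent_R cycles_top by simp
  ultimately show ?thesis unfolding barcode_basis_def by blast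
qed

lemma representation_sum_columns:
  assumes "U \<subseteq> ind" "u \<in> ind"
  shows "chain.representation (R ` ind) (\<Sum>v\<in>U. R v) (R u) = 1 \<longleftrightarrow> u \<in> U"
proof -
  have "finite U" using assms fin_act by (auto intro: finite_subset)
  have "(\<Sum>v\<in>U. R v) = (\<Sum>a\<in>R ` U. a)"
    using inj_on_subset[OF R_inj assms(1)] by (simp add: sum.reindex)
  moreover have "chain.representation (R ` ind) (\<Sum>a\<in>R ` U. a) (R u) = (if R u \<in> R ` U then
      1 else 0)"
    using independent_R \<open>finite U\<close> assms(1) by (intro representation_subset_sum) auto
  moreover have "R u \<in> R ` U \<longleftrightarrow> u \<in> U"
    using R_inj assms by (meson inj_on_image_mem_iff)
  ultimately show ?thesis by simp
qed

end

section \<open>Weakest preconditions with running time\<close>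

notation Seq (infixr ";;" 60)

text \<open>The postcondition receives the absolute time, so that invariants can speak of elapsed time and of
  potentials together and sequential composition is plain nesting.\<close>
definition wp :: "program \<Rightarrow> (state \<Rightarrow> nat \<Rightarrow> bool) \<Rightarrow>
    state \<Rightarrow> nat \<Rightarrow> bool" where
  "wp P Q st T \<longleftrightarrow> (\<exists>t st'. exec P st t st' \<and> Q st' (T + t))"

lemma exec_Skip_iff: "exec Skip st t st' \<longleftrightarrow> t = 1 \<and> st' = st"
  using exec_Skip[of st] by (auto elim: exec.cases)

lemma exec_Assign_iff: "exec (Assign x e) st t st' \<longleftrightarrow>
    t = 1 \<and> st' = st\<lparr>regs := (regs st)(x := eval_expr e st)\<rparr>"
  using exec_Assign[of x e st] by (auto elim: exec.cases)

lemma exec_Store_iff: "exec (Store a e f) st t st' \<longleftrightarrow>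
    t = 1 \<and> st' = st\<lparr>arrays := (arrays st)(a := (arrays st a)(eval_expr e st := eval_expr f
        st))\<rparr>"
  using exec_Store[of a e f st] by (auto elim: exec.cases)

lemma exec_Seq_iff: "exec (P ;; Q) st t st' \<longleftrightarrow>
    (\<exists>t1 st1 t2. exec P st t1 st1 \<and> exec Q st1 t2 st' \<and> t = t1 + t2)"
  by (rule iffI, erule exec.cases) (auto intro: exec_Seq)

lemma exec_Cond_iff: "exec (Cond b P Q) st t st' \<longleftrightarrow>
    (\<exists>u. t = u + 1 \<and> (if eval_test b st then exec P st u st' else exec Q st u st'))"
proof
  assume "exec (Cond b P Q) st t st'"
  then show "\<exists>u. t = u + 1 \<and> (if eval_test b st then exec P st u st' else exec Q st u st')"
    by (rule exec.cases) auto
next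
  assume "\<exists>u. t = u + 1 \<and> (if eval_test b st then exec P st u st' else exec Q st u st')"
  then show "exec (Cond b P Q) st t st'"
    by (cases "eval_test b st") (auto simp only: if_True if_False intro: exec_CondTrue exec_CondFalse)
qed

lemma wp_Skip [simp]: "wp Skip Q st T \<longleftrightarrow> Q st (T + 1)"
  by (auto simp: wp_def exec_Skip_iff)

lemma wp_Assign [simp]:
  "wp (Assign x e) Q st T \<longleftrightarrow> Q (st\<lparr>regs := (regs st)(x := eval_expr e
      st)\<rparr>) (T + 1)"
  by (auto simp: wp_def exec_Assign_iff)

lemma wp_Store [simp]:
  "wp (Store a e f) Q st T \<longleftrightarrow>
    Q (st\<lparr>arrays := (arrays st)(a := (arrays st a)(eval_expr e st := eval_expr f st))\<rparr>) (T + 1)"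
  by (auto simp: wp_def exec_Store_iff)

lemma wp_Seq [simp]: "wp (P ;; R) Q st T \<longleftrightarrow> wp P (wp R Q) st T"
  by (auto simp: wp_def[abs_def] exec_Seq_iff add.assoc) metis+

lemma wp_Cond [simp]:
  "wp (Cond b P R) Q st T \<longleftrightarrow> (if eval_test b st then wp P Q st (T + 1) else wp R Q
      st (T + 1))"
proof -
  have "(\<exists>t st'. (\<exists>u. t = u + 1 \<and> exec S st u st') \<and> Q st' (T + t))
      \<longleftrightarrow> wp S Q st (T + 1)" for S
    unfolding wp_def by (metis add.assoc add.commute)
  then show ?thesis by (auto simp: wp_def exec_Cond_iff)
qed

primrec reg_writes :: "program \<Rightarrow> string set" where
  "reg_writes Skip = {}"
| "reg_writes (Assign x e) = {x}"
| "reg_writes (Store a e f) = {}"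
| "reg_writes (Seq P Q) = reg_writes P \<union> reg_writes Q"
| "reg_writes (Cond b P Q) = reg_writes P \<union> reg_writes Q"
| "reg_writes (While b P) = reg_writes P"

primrec array_writes :: "program \<Rightarrow> string set" where
  "array_writes Skip = {}"
| "array_writes (Assign x e) = {}"
| "array_writes (Store a e f) = {a}"
| "array_writes (Seq P Q) = array_writes P \<union> array_writes Q"
| "array_writes (Cond b P Q) = array_writes P \<union> array_writes Q"
| "array_writes (While b P) = array_writes P"

text \<open>Read off from the program text, this spares the invariants all statements about variables that a
  loop does not write.\<close>
definition unchanged :: "program \<Rightarrow> state \<Rightarrow> state \<Rightarrow> bool" where
  "unchanged P st st' \<longleftrightarrow>
     (\<forall>x. x \<notin> reg_writes P \<longrightarrow> regs st' x = regs st x) \<and>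
     (\<forall>a. a \<notin> array_writes P \<longrightarrow> arrays st' a = arrays st a)"

lemma unchanged_refl: "unchanged P st st"
  by (simp add: unchanged_def)

lemma unchanged_trans: "unchanged P st st' \<Longrightarrow> unchanged P st' st'' \<Longrightarrow>
    unchanged P st st''"
  by (auto simp: unchanged_def)

lemma exec_unchanged: "exec P st t st' \<Longrightarrow> unchanged P st st'"
  by (induction rule: exec.induct) (auto simp: unchanged_def)

lemma wp_weaken:
  assumes "wp P Q st T" and "\<And>st' T'. unchanged P st st' \<Longrightarrow> Q st' T'
      \<Longrightarrow> R st' T'"
  shows "wp P R st T"
  using assms exec_unchanged unfolding wp_def by blast

text \<open>The addition of 1 to the time in the invariant pays for the loop test.\<close>
lemma wp_While:
  fixes m :: "state \<Rightarrow> nat"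
  assumes "I st T"
    and step: "\<And>st' T'. I st' T' \<Longrightarrow> unchanged P st st' \<Longrightarrow> eval_test
        b st' \<Longrightarrow>
      wp P (\<lambda>st'' T''. I st'' (T'' + 1) \<and> m st'' < m st') st' T'"
    and stop: "\<And>st' T'. I st' T' \<Longrightarrow> unchanged P st st' \<Longrightarrow> \<not>
        eval_test b st' \<Longrightarrow> Q st' (T' + 1)"
  shows "wp (While b P) Q st T"
proof -
  have "wp (While b P) Q st' T'" if "I st' T'" "unchanged P st st'" for st' T'
    using that
  proof (induction "m st'" arbitrary: st' T' rule: less_induct)
    case less
    show ?case
    proof (cases "eval_test b st'")
      case True
      from step[OF less.prems True] obtain t st'' where
        1: "exec P st' t st''" "I st'' (T' + t + 1)" "m st'' < m st'"
        unfolding wp_def by blast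
      with less.prems have "unchanged P st st''"
        using exec_unchanged unchanged_trans by blast
      from less.hyps[OF 1(3,2) this] obtain u st3 where
        2: "exec (While b P) st'' u st3" "Q st3 (T' + t + 1 + u)"
        unfolding wp_def by blast
      from 2(2) have "Q st3 (T' + (t + u + 1))"
        by (simp add: ac_simps)
      with exec_WhileTrue[OF True 1(1) 2(1)] show ?thesis unfolding wp_def by blast
    next
      case False
      with stop[OF less.prems] show ?thesis
        unfolding wp_def by (blast intro: exec_WhileFalse)
    qed
  qed
  with assms(1) unchanged_refl show ?thesis by blast
qed

lemma wp_count:
  assumes "regs st x = k0" "k0 \<le> bound" "I st T k0"
    and bnd: "\<And>st'. unchanged P st st' \<Longrightarrow> eval_expr e st' = bound"
    and step: "\<And>st' T' k. I st' T' k \<Longrightarrow> unchanged P st st' \<Longrightarrow> regs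
        st' x = k \<Longrightarrow> k0 \<le> k \<Longrightarrow> k < bound \<Longrightarrow>
      wp P (\<lambda>st'' T''. I st'' (T'' + 1) (Suc k) \<and> regs st'' x = Suc k) st' T'"
    and stop: "\<And>st' T'. I st' T' bound \<Longrightarrow> unchanged P st st' \<Longrightarrow> regs
        st' x = bound \<Longrightarrow> Q st' (T' + 1)"
  shows "wp (While (Less (Reg x) e) P) Q st T"
proof (rule wp_While[where I = "\<lambda>st T. I st T (regs st x) \<and> k0 \<le> regs st x \<and> regs
    st x \<le> bound" 
      and m = "\<lambda>st. bound - regs st x"])
  fix st' T'
  assume a: "I st' T' (regs st' x) \<and> k0 \<le> regs st' x \<and> regs st' x \<le> bound" "unchanged
      P st st'"
    "eval_test (Less (Reg x) e) st'"
  then have "regs st' x < bound" using bnd by simp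
  with step[of st' T' "regs st' x"] a
  have "wp P (\<lambda>st'' T''. I st'' (T'' + 1) (Suc (regs st' x)) \<and> regs st'' x = Suc (regs st'
      x)) st' T'"
    by simp
  then show "wp P (\<lambda>st'' T''. (I st'' (T'' + 1) (regs st'' x) \<and> k0 \<le> regs st'' x
      \<and> regs st'' x \<le> bound) \<and>
      bound - regs st'' x < bound - regs st' x) st' T'"
    using \<open>regs st' x < bound\<close> a by (elim wp_weaken) auto
qed (use assms in auto)

section \<open>Reading the input\<close>

abbreviation (input) "Inc x \<equiv> Assign x (Add (Reg x) (Const 1))"
abbreviation (input) "For x e P \<equiv> Assign x (Const 0) ;; While (Less (Reg x) e) (P ;; Inc x)"

text \<open>A record of the input consists of the number of vertices, the vertices and the two critical
  indices. \<open>start\<close> points to the first vertex.\<close>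
definition parse :: program where
  "parse =
     Assign ''s'' (Load ''in'' (Const 0)) ;;
     Assign ''n'' (Load ''in'' (Const 2)) ;;
     Assign ''q'' (Const 3) ;;
     For ''x'' (Reg ''n'')
       (Store ''start'' (Reg ''x'') (Add (Reg ''q'') (Const 1)) ;;
        Store ''size'' (Reg ''x'') (Load ''in'' (Reg ''q'')) ;;
        Assign ''q'' (Add (Reg ''q'') (Add (Load ''in'' (Reg ''q'')) (Const 1))) ;;
        Store ''row'' (Reg ''x'') (Load ''in'' (Reg ''q'')) ;;
        Store ''col'' (Reg ''x'') (Load ''in'' (Add (Reg ''q'') (Const 1))) ;;
        Assign ''q'' (Add (Reg ''q'') (Const 2)))"

text \<open>The rank of a simplex is found by counting its predecessors, which takes quadratic time and makes
  \<open>perm\<close> the inverse of the rank function.\<close>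
definition sort_columns :: program where
  "sort_columns =
     For ''x'' (Reg ''n'')
       (Assign ''rank'' (Const 0) ;;
        For ''y'' (Reg ''n'')
          (Cond (Less (Load ''col'' (Reg ''y'')) (Load ''col'' (Reg ''x'')))
             (Inc ''rank'')
             (Cond (Conj (Equal (Load ''col'' (Reg ''y'')) (Load ''col'' (Reg ''x'')))
                         (Less (Reg ''y'') (Reg ''x'')))
                (Inc ''rank'')
                Skip)) ;;
        Store ''perm'' (Reg ''rank'') (Reg ''x''))"

primrec all_tests :: "test list \<Rightarrow> test" where
  "all_tests [] = Equal (Const 0) (Const 0)"
| "all_tests (b # bs) = Conj b (all_tests bs)"

lemma eval_all_tests [simp]: "eval_test (all_tests bs) st \<longleftrightarrow> (\<forall>b\<in>set bs.
    eval_test b st)"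
  by (induction bs) auto

definition any_test :: "test list \<Rightarrow> test" where
  "any_test bs = Neg (all_tests (map Neg bs))"

lemma eval_any_test [simp]: "eval_test (any_test bs) st \<longleftrightarrow> (\<exists>b\<in>set bs.
    eval_test b st)"
  by (auto simp: any_test_def)

text \<open>As \<open>p\<close> is fixed, the comparison of all vertices of two simplices is one test
    of constant size.\<close>
definition facet_test :: "nat \<Rightarrow> test" where
  "facet_test p =
     Conj (Equal (Load ''size'' (Reg ''x'')) (Const (p + 2)))
    (Conj (Equal (Load ''size'' (Reg ''y'')) (Const (p + 1)))
      (all_tests (map (\<lambda>a. any_test (map (\<lambda>b.
         Equal (Load ''in'' (Add (Load ''start'' (Reg ''y'')) (Const a)))
               (Load ''in'' (Add (Load ''start'' (Reg ''x'')) (Const b)))) [0..<p + 2])) [0..<p + 1])))"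

text \<open>The matrix is stored column by column, column \<open>c\<close> starting at \<open>base c =
    c * n\<close>; the offsets are
  accumulated because the machine cannot multiply. \<open>low c\<close> is the pivot of column
      \<open>c\<close>.\<close>
definition build_matrix :: "nat \<Rightarrow> program" where
  "build_matrix p =
     Assign ''b'' (Const 0) ;;
     For ''c'' (Reg ''n'')
       (Assign ''x'' (Load ''perm'' (Reg ''c'')) ;;
        Store ''base'' (Reg ''c'') (Reg ''b'') ;;
        Store ''I'' (Reg ''c'') (Load ''row'' (Reg ''x'')) ;;
        Store ''J'' (Reg ''c'') (Load ''col'' (Reg ''x'')) ;;
        Store ''low'' (Reg ''c'') (Const 0) ;;
        For ''r'' (Reg ''n'')
          (Assign ''y'' (Load ''perm'' (Reg ''r'')) ;;
           Cond (facet_test p)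
             (Store ''M'' (Add (Reg ''b'') (Reg ''r'')) (Const 1) ;;
              Store ''low'' (Reg ''c'') (Add (Reg ''r'') (Const 1)))
             (Store ''M'' (Add (Reg ''b'') (Reg ''r'')) (Const 0))) ;;
        Assign ''b'' (Add (Reg ''b'') (Reg ''n'')))"

text \<open>With truncated subtraction, \<open>(a - b) + (b - a)\<close> is the sum modulo 2 of two
    entries 0 or 1.\<close>
definition add_column :: program where
  "add_column =
     Assign ''b'' (Load ''base'' (Reg ''c'')) ;;
     Assign ''a'' (Load ''base'' (Reg ''t'')) ;;
     Store ''low'' (Reg ''c'') (Const 0) ;;
     For ''r'' (Reg ''n'')
       (Store ''M'' (Add (Reg ''b'') (Reg ''r''))
          (Add (Sub (Load ''M'' (Add (Reg ''a'') (Reg ''r''))) (Load ''M'' (Add (Reg ''b'') (Reg ''r''))))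
               (Sub (Load ''M'' (Add (Reg ''b'') (Reg ''r''))) (Load ''M'' (Add (Reg ''a'') (Reg ''r''))))) ;;
        Cond (Equal (Load ''M'' (Add (Reg ''b'') (Reg ''r''))) (Const 0))
          Skip
          (Store ''low'' (Reg ''c'') (Add (Reg ''r'') (Const 1))))"

definition record_start :: "(nat list \<times> nat \<times> nat) list \<Rightarrow> nat \<Rightarrow>
    nat" where
  "record_start L x = 3 + (\<Sum>y<x. length (fst (L ! y)) + 3)"

lemma input_encoding_nth:
  assumes x: "x < length L" and q: "q < length (fst (L ! x)) + 3"
  shows "record_start L x + q < length (input_encoding s N L)"
    and "input_encoding s N L ! (record_start L x + q) =
      (length (fst (L ! x)) # fst (L ! x) @ [fst (snd (L ! x)), snd (snd (L ! x))]) ! q"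
proof -
  let ?f = "\<lambda>(v, i, j). length v # v @ [i, j :: nat]"
  have f: "?f (L ! x) = length (fst (L ! x)) # fst (L ! x) @ [fst (snd (L ! x)), snd (snd (L ! x))]"
    by (simp add: case_prod_beta)
  have "concat (map ?f L) = concat (map ?f (take x L)) @ ?f (L ! x) @ concat (map ?f (drop (Suc x) L))"
    by (rule arg_cong[OF id_take_nth_drop[OF x], of "\<lambda>L. concat (map ?f L)",
          unfolded map_append concat_append list.map concat.simps])
  moreover have "length (concat (map ?f (take x L))) + 3 = record_start L x"
    using x
  proof (induction x)
    case (Suc x)
    then show ?case
      by (cases "L ! x") (auto simp: record_start_def take_Suc_conv_app_nth)
  qed (simp add: record_start_def)
  ultimately have e: "input_encoding s N L =
      ([s, N, length L] @ concat (map ?f (take x L))) @ ?f (L ! x) @ concat (map ?f (drop (Suc x) L))"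
    and l: "length ([s, N, length L] @ concat (map ?f (take x L))) = record_start L x"
    by (simp_all add: input_encoding_def)
  show "record_start L x + q < length (input_encoding s N L)"
    unfolding e length_append l[unfolded length_append] f using q by simp
  have "input_encoding s N L ! (record_start L x + q) =
      (?f (L ! x) @ concat (map ?f (drop (Suc x) L))) ! q"
    unfolding e l[symmetric] by (rule nth_append_length_plus)
  also have "\<dots> = ?f (L ! x) ! q"
    unfolding f using q by (intro nth_append_left) simp
  finally show "input_encoding s N L ! (record_start L x + q) =
      (length (fst (L ! x)) # fst (L ! x) @ [fst (snd (L ! x)), snd (snd (L ! x))]) ! q"
    unfolding f .
qed

definition parsed :: "nat \<Rightarrow> (nat list \<times> nat \<times> nat) list \<Rightarrow> state
    \<Rightarrow> bool" where
  "parsed s L st \<longleftrightarrow> regs st ''s'' = s \<and> regs st ''n'' = length L \<and>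
     (\<forall>x<length L. arrays st ''size'' x = length (fst (L ! x)) \<and>
        arrays st ''row'' x = fst (snd (L ! x)) \<and> arrays st ''col'' x = snd (snd (L ! x)) \<and>
        (\<forall>a<length (fst (L ! x)). arrays st ''in'' (arrays st ''start'' x + a) = fst (L ! x) ! a))"

lemma wp_parse:
  assumes Q: "\<And>st' T'. parsed s L st' \<Longrightarrow> T' \<le> T + 8 * length L + 5
      \<Longrightarrow> Q st' T'"
  shows "wp parse Q (initial_state (input_encoding s N L)) T"
proof -
  define st0 where "st0 = initial_state (input_encoding s N L)"
  let ?in = "arrays st0 ''in''"
  have cell: "?in (record_start L x + q) =
      (length (fst (L ! x)) # fst (L ! x) @ [fst (snd (L ! x)), snd (snd (L ! x))]) ! q"
    if "x < length L" "q < length (fst (L ! x)) + 3" for x q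
    using input_encoding_nth[OF that, of s N] by (simp add: st0_def initial_state_def)
  have c0: "?in (record_start L x) = length (fst (L ! x))" if "x < length L" for x
    using cell[OF that, of 0] by simp
  have ca: "?in (Suc (record_start L x + a)) = fst (L ! x) ! a"
    if "x < length L" "a < length (fst (L ! x))" for x a
    using cell[OF that(1), of "Suc a"] that by (simp add: nth_append)
  have ci: "?in (Suc (record_start L x + length (fst (L ! x)))) = fst (snd (L ! x))"
    if "x < length L" for x
    using cell[OF that, of "Suc (length (fst (L ! x)))"] by (simp add: nth_append)
  have cj: "?in (Suc (Suc (record_start L x + length (fst (L ! x))))) = snd (snd (L ! x))"
    if "x < length L" for x
    using cell[OF that, of "Suc (Suc (length (fst (L ! x))))"] by (simp add: nth_append)
  have hd: "?in 0 = s" "?in 2 = length L"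
    by (simp_all add: st0_def initial_state_def input_encoding_def)
  have next_start: "record_start L (Suc x) = record_start L x + length (fst (L ! x)) + 3" for x
    by (simp add: record_start_def)
  show ?thesis
    unfolding st0_def[symmetric] parse_def
    apply (simp add: hd)
    apply (rule wp_count[where ?k0.0 = 0 and bound = "length L" and
          I = "\<lambda>st T' k. T' \<le> T + 4 + 8 * k \<and> arrays st ''in'' = ?in \<and> regs st
              ''q'' = record_start L k \<and>
      (\<forall>x<k. arrays st ''size'' x = length (fst (L ! x)) \<and>
        arrays st ''row'' x = fst (snd (L ! x)) \<and> arrays st ''col'' x = snd (snd (L ! x)) \<and>
        arrays st ''start'' x = Suc (record_start L x))"])
         apply (simp add: record_start_def)
        apply simp
       apply (simp add: record_start_def)
      apply (simp add: unchanged_def hd)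
    subgoal for st' T' k
      by (simp add: c0 ci cj next_start less_Suc_eq)
    subgoal for st' T'
      by (rule Q) (simp_all add: parsed_def unchanged_def hd ca)
    done
qed

section \<open>Sorting the simplices and adding columns\<close>

text \<open>Ties between equal grades are broken by the position in the input.\<close>
definition before :: "(nat \<Rightarrow> nat) \<Rightarrow> nat \<Rightarrow> nat \<Rightarrow> bool" where
  "before J y x \<longleftrightarrow> J y < J x \<or> J y = J x \<and> y < x"

definition rank :: "(nat \<Rightarrow> nat) \<Rightarrow> nat \<Rightarrow> nat \<Rightarrow> nat" where
  "rank J n x = card {y. y < n \<and> before J y x}"

lemma card_Suc_filter:
  "card {y. y < Suc k \<and> P y} = card {y. y < k \<and> P y} + (if P k then 1 else 0)"
proof -
  have "{y. y < Suc k \<and> P y} = (if P k then insert k {y. y < k \<and> P y} else {y. y < k \<and> P y})"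
    by (auto simp: less_Suc_eq)
  then show ?thesis by auto
qed

lemma rank_less_iff:
  assumes "x < n" "y < n"
  shows "rank J n y < rank J n x \<longleftrightarrow> before J y x"
proof -
  have *: "rank J n y < rank J n x" if "before J y x" "y < n" for x y
    unfolding rank_def using that by (intro psubset_card_mono) (auto simp: before_def)
  have "before J y x \<or> x = y \<or> before J x y" by (auto simp: before_def)
  then show ?thesis using *[of y x] *[of x y] assms by auto
qed

lemma rank_inj: "x < n \<Longrightarrow> y < n \<Longrightarrow> rank J n x = rank J n y
    \<Longrightarrow> x = y"
  using rank_less_iff[of x n y J] rank_less_iff[of y n x J] by (auto simp: before_def)

lemma rank_bij: "bij_betw (rank J n) {..<n} {..<n}"
proof -
  have "rank J n x < n" if "x < n" for x
  proof -
    have "{y. y < n \<and> before J y x} \<subset> {..<n}" using that by (auto simp: before_def)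
    then have "rank J n x < card {..<n}" unfolding rank_def by (intro psubset_card_mono) auto
    then show ?thesis by simp
  qed
  then have "rank J n ` {..<n} \<subseteq> {..<n}" by auto
  moreover have "inj_on (rank J n) {..<n}" by (auto intro!: inj_onI dest: rank_inj)
  ultimately show ?thesis by (simp add: bij_betw_def endo_inj_surj)
qed

lemma wp_sort_columns:
  assumes n: "regs st ''n'' = n" and J: "\<And>x. x < n \<Longrightarrow> arrays st ''col'' x = J x"
    and Q: "\<And>st' T'. unchanged sort_columns st st' \<Longrightarrow>
      (\<And>x. x < n \<Longrightarrow> arrays st' ''perm'' (rank J n x) = x) \<Longrightarrow> T'
          \<le> T + n * (5 * n + 6) + 2 \<Longrightarrow> Q st' T'"
  shows "wp sort_columns Q st T"
proof (rule wp_weaken[where Q = "\<lambda>st' T'. (\<forall>x<n. arrays st' ''perm'' (rank J n x) = x) \<and> 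
      T' \<le> T + n * (5 * n + 6) + 2"])
  show "wp sort_columns (\<lambda>st' T'. (\<forall>x<n. arrays st' ''perm'' (rank J n x) = x) \<and> 
      T' \<le> T + n * (5 * n + 6) + 2) st T"
    unfolding sort_columns_def
    apply (simp add: n)
    apply (rule wp_count[where ?k0.0 = 0 and bound = n and
          I = "\<lambda>st T' k. T' \<le> T + 1 + k * (5 * n + 6) \<and> (\<forall>x<k. arrays st
              ''perm'' (rank J n x) = x)"])
         apply simp
        apply simp
       apply simp
      apply (simp add: unchanged_def n)
    subgoal for st1 T1 k
      apply (simp add: n)
      apply (rule wp_count[where ?k0.0 = 0 and bound = n and
          I = "\<lambda>st T' l. T' \<le> T1 + 2 + 5 * l \<and> regs st ''rank'' = card {y. y < l
              \<and> before J y k}"])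
           apply simp
          apply simp
         apply simp
        apply (simp add: unchanged_def n)
      subgoal for st2 T2 l
        by (simp add: unchanged_def n J card_Suc_filter before_def)
      subgoal premises prems for st2 T2
      proof -
        have "rank J n x \<noteq> rank J n k" if "x < k" for x
          using rank_inj[of x n k J] that \<open>k < n\<close> by auto
        with prems show ?thesis
          by (simp add: unchanged_def rank_def[symmetric] less_Suc_eq all_conj_distrib)
      qed
      done
    subgoal for st1 T1 by simp
    done
next
  fix st' T' assume "unchanged sort_columns st st'"
    "(\<forall>x<n. arrays st' ''perm'' (rank J n x) = x) \<and> T' \<le> T + n * (5 * n + 6) + 2"
  then show "Q st' T'" using Q by blast
qed

lemma flat_index_less: "c' < c \<Longrightarrow> r' < n \<Longrightarrow> c' * n + r' < c * n + (r::nat)"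
proof -
  assume "c' < c" "r' < n"
  then have "c' * n + r' < Suc c' * n" by simp
  also have "\<dots> \<le> c * n" using \<open>c' < c\<close> by (intro mult_le_mono1) simp
  finally show ?thesis by simp
qed

lemma flat_index_eq:
  assumes "r < n" "r' < n"
  shows "c * n + r = c' * n + r' \<longleftrightarrow> c = c' \<and> r = (r'::nat)"
  using flat_index_less[of c c' r n r'] flat_index_less[of c' c r' n r] assms
  by (cases c c' rule: linorder_cases) auto

definition holds :: "(nat \<Rightarrow> simplex) \<Rightarrow> nat \<Rightarrow> state \<Rightarrow>
    (nat \<Rightarrow> chain) \<Rightarrow> bool" where
  "holds sx n st R \<longleftrightarrow> (\<forall>c<n. arrays st ''low'' c = low sx n (R c) \<and>
     (\<forall>r<n. arrays st ''M'' (c * n + r) = of_bool (R c (sx r) = 1)))"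

lemma wp_add_column:
  assumes n: "regs st ''n'' = n" and R: "holds sx n st R"
    and base: "\<And>c. c < n \<Longrightarrow> arrays st ''base'' c = c * n"
    and c: "regs st ''c'' = c" "c < n" and t: "regs st ''t'' = t" "t < n" "t \<noteq> c"
    and Q: "\<And>st' T'. unchanged add_column st st' \<Longrightarrow>
      holds sx n st' (R(c := R c + R t)) \<Longrightarrow> T' \<le> T + 5 * n + 5 \<Longrightarrow> Q st' T'"
  shows "wp add_column Q st T"
proof -
  define f where "f r = (R c + R t) (sx r)" for r
  let ?P = "\<lambda>st' T'. T' \<le> T + 5 * n + 5 \<and>
     (\<forall>d<n. d \<noteq> c \<longrightarrow> arrays st' ''low'' d = arrays st ''low'' d \<and>
       (\<forall>r<n. arrays st' ''M'' (d * n + r) = arrays st ''M'' (d * n + r))) \<and>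
     arrays st' ''low'' c = pivot f n \<and> (\<forall>r<n. arrays st' ''M'' (c * n + r) = of_bool (f r = 1))"
  have M: "arrays st ''M'' (d * n + r) = of_bool (R d (sx r) = 1)" if "d < n" "r < n" for d r
    using R that by (simp add: holds_def)
  have "wp add_column ?P st T"
    unfolding add_column_def
    apply (simp add: n base c t)
    apply (rule wp_count[where ?k0.0 = 0 and bound = n and
          I = "\<lambda>st' T' k. T' \<le> T + 4 + 5 * k \<and> 
     (\<forall>d<n. d \<noteq> c \<longrightarrow> arrays st' ''low'' d = arrays st ''low'' d \<and>
       (\<forall>r<n. arrays st' ''M'' (d * n + r) = arrays st ''M'' (d * n + r))) \<and>
     arrays st' ''low'' c = pivot f k \<and> 
       (\<forall>r<n. arrays st' ''M'' (c * n + r) = (if r < k then of_bool (f r = 1) else arrays st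
           ''M'' (c * n + r)))"])
         apply simp
        apply simp
       apply simp
      apply (simp add: unchanged_def n)
    subgoal premises prems for st1 T1 k
    proof -
      note a = prems(1)
      from prems have k: "k < n" "regs st1 ''r'' = k" by simp_all
      from prems(2) have ab: "regs st1 ''a'' = t * n" "regs st1 ''b'' = c * n" "regs st1 ''c'' = c"
        by (simp_all add: unchanged_def c)
      have ac: "arrays st1 ''M'' (t * n + k) = of_bool (R t (sx k) = 1)"
        "arrays st1 ''M'' (c * n + k) = of_bool (R c (sx k) = 1)"
        using a k t c M by simp_all
      have f: "of_bool (R t (sx k) = 1) - of_bool (R c (sx k) = 1) + (of_bool (R c (sx k) = 1) -
          of_bool (R t (sx k) = 1))
         = (of_bool (f k = 1) :: nat)"
        by (cases "R t (sx k)"; cases "R c (sx k)") (simp_all add: f_def)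
      show ?thesis
        using a k(1) by (simp add: k(2) ab ac f flat_index_eq less_Suc_eq)
    qed
    subgoal for st1 T1 by simp
    done
  then show ?thesis
  proof (rule wp_weaken)
    fix st' T' assume u: "unchanged add_column st st'" and P: "?P st' T'"
    have "holds sx n st' (R(c := R c + R t))"
      unfolding holds_def
    proof (intro allI impI)
      fix d assume "d < n"
      with P R show "arrays st' ''low'' d = low sx n ((R(c := R c + R t)) d) \<and>
         (\<forall>r<n. arrays st' ''M'' (d * n + r) = of_bool ((R(c := R c + R t)) d (sx r) = 1))"
        by (cases "d = c") (simp_all add: holds_def low_def f_def[abs_def])
    qed
    with u P show "Q st' T'" using Q by blast
  qed
qed

section \<open>The boundary matrix\<close>

lemma eval_facet_test:
  assumes parsed: "parsed s L st0"
    and arrays: "arrays st ''in'' = arrays st0 ''in''" "arrays st ''size'' = arrays st0 ''size''"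
      "arrays st ''start'' = arrays st0 ''start''"
    and x: "regs st ''x'' < length L" "distinct (fst (L ! regs st ''x''))"
    and y: "regs st ''y'' < length L" "distinct (fst (L ! regs st ''y''))"
  shows "eval_test (facet_test p) st \<longleftrightarrow>
    facets p (set (fst (L ! regs st ''x''))) (set (fst (L ! regs st ''y''))) = 1"
proof -
  define v w where "v = fst (L ! regs st ''x'')" and "w = fst (L ! regs st ''y'')"
  have "eval_test (facet_test p) st \<longleftrightarrow> length v = p + 2 \<and> length w = p + 1 \<and>
    (\<forall>a<p + 1. \<exists>b<p + 2. arrays st ''in'' (arrays st ''start'' (regs st ''y'') + a) =
       arrays st ''in'' (arrays st ''start'' (regs st ''x'') + b))"
    using parsed x(1) y(1)
    by (auto simp: facet_test_def parsed_def arrays v_def w_def atLeast0LessThan simp del: upt_Suc)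
  also have "\<dots> \<longleftrightarrow> length v = p + 2 \<and> length w = p + 1 \<and>
      (\<forall>a<length w. \<exists>b<length v. w ! a = v ! b)"
  proof -
    have "arrays st ''in'' (arrays st ''start'' (regs st ''x'') + b) = v ! b" if "b < length v" for b
      using parsed x(1) that by (simp add: parsed_def arrays v_def)
    moreover have "arrays st ''in'' (arrays st ''start'' (regs st ''y'') + a) = w ! a" if "a < length w" for a
      using parsed y(1) that by (simp add: parsed_def arrays w_def)
    ultimately show ?thesis by (simp cong: conj_cong)
  qed
  also have "(\<forall>a<length w. \<exists>b<length v. w ! a = v ! b) \<longleftrightarrow> set w
      \<subseteq> set v"
    by (auto simp: set_conv_nth subset_iff)
  also have "length v = p + 2 \<and> length w = p + 1 \<and> set w \<subseteq> set v \<longleftrightarrow>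
      facets p (set v) (set w) = 1"
    using x(2) y(2) by (simp add: facets_def distinct_card v_def w_def)
  finally show ?thesis by (simp add: v_def w_def)
qed

lemma wp_build_matrix:
  fixes L :: "(nat list \<times> nat \<times> nat) list" and \<pi> :: "nat \<Rightarrow> nat"
  defines "n \<equiv> length L" and "sx \<equiv> \<lambda>c. set (fst (L ! \<pi> c))"
  assumes parsed: "parsed s L st"
    and perm: "\<And>c. c < n \<Longrightarrow> arrays st ''perm'' c = \<pi> c" "\<And>c. c < n
        \<Longrightarrow> \<pi> c < n"
    and dist: "\<And>x. x < n \<Longrightarrow> distinct (fst (L ! x))"
    and Q: "\<And>st' T'. unchanged (build_matrix p) st st' \<Longrightarrow> holds sx n st'
        (\<lambda>c. facets p (sx c)) \<Longrightarrow>
      (\<And>c. c < n \<Longrightarrow> arrays st' ''base'' c = c * n \<and> arrays st' ''I'' c = fst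
          (snd (L ! \<pi> c)) \<and>
         arrays st' ''J'' c = snd (snd (L ! \<pi> c))) \<Longrightarrow>
      T' \<le> T + n * (6 * n + 10) + 3 \<Longrightarrow> Q st' T'"
  shows "wp (build_matrix p) Q st T"
proof -
  define f where "f c r = facets p (sx c) (sx r)" for c r
  have n: "regs st ''n'' = n" using parsed by (simp add: parsed_def n_def)
  have row: "arrays st ''row'' x = fst (snd (L ! x))" "arrays st ''col'' x = snd (snd (L ! x))" if "x <
      n" for x
    using parsed that by (simp_all add: parsed_def n_def)
  have ft: "eval_test (facet_test p) st1 \<longleftrightarrow> f c r = 1"
    if "arrays st1 ''in'' = arrays st ''in''" "arrays st1 ''size'' = arrays st ''size''"
      "arrays st1 ''start'' = arrays st ''start''" "regs st1 ''x'' = \<pi> c" "regs st1 ''y'' = \<pi>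
          r" "c < n" "r < n"
    for st1 c r
    unfolding f_def sx_def that(4,5)[symmetric]
    using that perm(2) dist by (intro eval_facet_test[OF parsed]) (simp_all add: n_def)
  let ?done = "\<lambda>st' k. (\<forall>c<k. arrays st' ''base'' c = c * n \<and> arrays st' ''I'' c =
      fst (snd (L ! \<pi> c)) \<and>
         arrays st' ''J'' c = snd (snd (L ! \<pi> c)) \<and> arrays st' ''low'' c = pivot (f c) n \<and>
         (\<forall>r<n. arrays st' ''M'' (c * n + r) = of_bool (f c r = 1)))"
  have "wp (build_matrix p) (\<lambda>st' T'. ?done st' n \<and> T' \<le> T + n * (6 * n + 10) + 3) st T"
    unfolding build_matrix_def
    apply (simp add: n)
    apply (rule wp_count[where ?k0.0 = 0 and bound = n and
          I = "\<lambda>st' T' k. T' \<le> T + 2 + k * (6 * n + 10) \<and> regs st' ''b'' = k * n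
              \<and> ?done st' k"])
         apply simp
        apply simp
       apply simp
      apply (simp add: unchanged_def n)
    subgoal premises prems1 for st1 T1 k
    proof -
      note I1 = prems1(1)
      from prems1(2) have u: "regs st1 ''n'' = n" "arrays st1 ''in'' = arrays st ''in''"
        "arrays st1 ''size'' = arrays st ''size''" "arrays st1 ''start'' = arrays st ''start''"
        "arrays st1 ''perm'' = arrays st ''perm''" "arrays st1 ''row'' = arrays st ''row''"
        "arrays st1 ''col'' = arrays st ''col''"
        by (simp_all add: unchanged_def n)
      have k: "regs st1 ''c'' = k" "k < n" using prems1 by simp_all
      have lt: "c * n + r \<noteq> k * n + l" if "c < k" "r < n" for c r l
        using flat_index_less[of c k r n l] that by simp
      show ?thesis
        apply (simp add: u k perm row)
        apply (rule wp_count[where ?k0.0 = 0 and bound = n and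
          I = "\<lambda>st' T' l. T' \<le> T1 + 6 + 6 * l \<and> arrays st' ''low'' k = pivot (f k) l \<and>
            (\<forall>r<l. arrays st' ''M'' (k * n + r) = of_bool (f k r = 1)) \<and>
            (\<forall>c<k. arrays st' ''low'' c = pivot (f c) n \<and>
         (\<forall>r<n. arrays st' ''M'' (c * n + r) = of_bool (f c r = 1)))"])
             apply simp
            apply simp
        using I1 apply simp
          apply (simp add: unchanged_def u)
        subgoal premises prems2 for st2 T2 l
        proof -
          from prems2(2) have v: "regs st2 ''n'' = n" "arrays st2 ''in'' = arrays st ''in''"
            "arrays st2 ''size'' = arrays st ''size''" "arrays st2 ''start'' = arrays st ''start''"
            "arrays st2 ''perm'' = arrays st ''perm''" "regs st2 ''x'' = \<pi> k" "regs st2 ''c'' = k"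
            "regs st2 ''b'' = k * n"
            using I1 by (simp_all add: unchanged_def u k)
          have l: "regs st2 ''r'' = l" "l < n" using prems2 by simp_all
          have t: "eval_test (facet_test p) (st2\<lparr>regs := (regs st2)(''y'' := \<pi> l)\<rparr>)
              \<longleftrightarrow> f k l = 1"
            by (rule ft) (use v l k in simp_all)
          show ?thesis
            using prems2(1) lt by (simp add: v l k perm t less_Suc_eq)
        qed
        subgoal for st2 T2
          using I1 lt by (simp add: unchanged_def u k n less_Suc_eq)
        done
    qed
    subgoal for st1 T1 by simp
    done
  then show ?thesis
  proof (rule wp_weaken)
    fix st' T' assume u: "unchanged (build_matrix p) st st'"
      and P: "?done st' n \<and> T' \<le> T + n * (6 * n + 10) + 3"
    from P have "holds sx n st' (\<lambda>c. facets p (sx c))"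
      by (simp add: holds_def f_def[abs_def] low_def)
    with u P show "Q st' T'" by (intro Q) auto
  qed
qed

section \<open>The history of the column reduction\<close>

text \<open>\<open>I t\<close> and \<open>J t\<close> are the row and column grade of the simplex
    \<open>sx t\<close>.\<close>
locale layers =
  fixes p s n :: nat and sx :: "nat \<Rightarrow> simplex" and I J :: "nat \<Rightarrow> nat"
  assumes faces: "\<And>t \<sigma>. t < n \<Longrightarrow> facets p (sx t) \<sigma> \<noteq> 0
      \<Longrightarrow> \<exists>r<n. \<sigma> = sx r"
begin

abbreviation "D t \<equiv> facets p (sx t)"
abbreviation "lowest \<equiv> low sx n"

definition supported :: "chain \<Rightarrow> bool" where
  "supported z \<longleftrightarrow> (\<forall>\<sigma>. z \<sigma> \<noteq> 0 \<longrightarrow>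
      (\<exists>r<n. \<sigma> = sx r))"

lemma lowest_eq_0_iff: "supported z \<Longrightarrow> lowest z = 0 \<longleftrightarrow> z = 0"
proof
  assume z: "supported z" "lowest z = 0"
  have "z \<sigma> = 0" for \<sigma>
    using z above_pivot[of "\<lambda>r. z (sx r)" n] by (fastforce simp: supported_def low_def)
  then show "z = 0" by (simp add: fun_eq_iff)
next
  have "pivot (\<lambda>r. 0) n = 0" by (induction n) auto
  then show "z = 0 \<Longrightarrow> lowest z = 0" by (simp add: low_def)
qed

lemma supported_if:
  assumes z: "z - D t \<in> chain.span (D ` {u. u < t \<and> I u \<le> j})" and t: "t < n"
  shows "supported z"
proof -
  obtain U where U: "U \<subseteq> {u. u < t \<and> I u \<le> j}" and zU: "z - D t = (\<Sum>u\<in>U. D u)"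
    using z unfolding span_image_bit by blast
  have e: "z = (\<Sum>u\<in>U. D u) + D t" unfolding zU[symmetric] by simp
  show ?thesis
    unfolding supported_def
  proof (intro allI impI)
    fix \<sigma> assume "z \<sigma> \<noteq> 0"
    then have "(\<exists>u\<in>U. D u \<sigma> \<noteq> 0) \<or> D t \<sigma> \<noteq> 0"
      unfolding e by (auto simp: sum_chain_apply simp del: bit_not_zero_iff intro: sum.neutral)
    moreover have "u < n" if "u \<in> U" for u using U t that by auto
    ultimately show "\<exists>r<n. \<sigma> = sx r" using faces t by blast
  qed
qed

text \<open>Column \<open>t\<close> has its final value for layer \<open>j\<close> when the reduction
    has arrived at column \<open>c\<close> of layer
  \<open>i\<close>. Only columns present in layer \<open>j\<close> count.\<close>
definition finished :: "nat \<Rightarrow> nat \<Rightarrow> nat \<Rightarrow> nat \<Rightarrow> bool" where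
  "finished i c j t \<longleftrightarrow> 1 \<le> j \<and> t < n \<and> I t \<le> j \<and> (j < i \<or>
      j = i \<and> t < c)"

text \<open>\<open>H j t\<close> is column \<open>t\<close> after layer \<open>j\<close>, with \<open>H
    i\<close> the current columns and \<open>H 0\<close> the boundary matrix;
  \<open>S j t\<close> is the set of columns added to column \<open>t\<close> in layer
      \<open>j\<close>. The third conjunct is the expansion
  of the old column in the new basis.\<close>
definition reduced :: "nat \<Rightarrow> nat \<Rightarrow> (nat \<Rightarrow> nat \<Rightarrow> chain)
    \<Rightarrow> (nat \<Rightarrow> nat \<Rightarrow> nat set) \<Rightarrow> bool" where
  "reduced i c H S \<longleftrightarrow>
     (\<forall>j\<le>i. \<forall>t<n. H j t - D t \<in> chain.span (D ` {u. u < t \<and> I u \<le> j})) \<and>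
     (\<forall>t<n. c \<le> t \<longrightarrow> H i t = H (i - 1) t) \<and>
     (\<forall>j t. finished i c j t \<longrightarrow> S j t \<subseteq> {u. u < t \<and> finished i c
         j u \<and> H j u \<noteq> 0} \<and>
        H (j - 1) t = H j t + (\<Sum>u\<in>S j t. H j u)) \<and>
     (\<forall>j t u. finished i c j t \<longrightarrow> finished i c j u \<longrightarrow> H j t
         \<noteq> 0 \<longrightarrow>
        lowest (H j t) = lowest (H j u) \<longrightarrow> t = u)"

text \<open>A vertex of the graphcode is identified by its layer and its column, an edge by two such pairs.
  The condition \<open>I t < j\<close> says that column \<open>t\<close> was already present in layer
      \<open>j - 1\<close>.\<close>
definition vertices :: "nat \<Rightarrow> nat \<Rightarrow> (nat \<Rightarrow> nat \<Rightarrow> chain)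
    \<Rightarrow> (nat \<times> nat) set" where
  "vertices i c H = {(j, t). finished i c j t \<and> H j t \<noteq> 0}"

definition edges ::
  "nat \<Rightarrow> nat \<Rightarrow> (nat \<Rightarrow> nat \<Rightarrow> chain) \<Rightarrow> (nat
      \<Rightarrow> nat \<Rightarrow> nat set) \<Rightarrow> ((nat \<times> nat) \<times> (nat \<times>
      nat)) set" where
  "edges i c H S = {((j - 1, t), (j, u)) | j t u.
     finished i c j t \<and> I t < j \<and> H (j - 1) t \<noteq> 0 \<and> (u \<in> S j t \<or> u = t
         \<and> H j t \<noteq> 0)}"

text \<open>With \<open>i = 1\<close> and \<open>c = 0\<close> nothing is finished yet.\<close>
lemma reduced_init: "reduced 1 0 (\<lambda>_. D) S"
  by (auto simp: reduced_def finished_def chain.span_zero)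

text \<open>At the end of a layer the ghost state for the next layer is obtained by copying the
    columns.\<close>
lemma finished_next_layer: "1 \<le> i \<Longrightarrow> finished (Suc i) 0 j t \<longleftrightarrow>
    finished i n j t"
  by (auto simp: finished_def)

lemma
  assumes i: "1 \<le> i" and r: "reduced i n H S"
  defines "H' \<equiv> H(Suc i := H i)"
  shows reduced_next_layer: "reduced (Suc i) 0 H' S"
    and vertices_next_layer: "vertices (Suc i) 0 H' = vertices i n H"
    and edges_next_layer: "edges (Suc i) 0 H' S = edges i n H S"
proof -
  have H': "H' j = H j" "H' (j - 1) = H (j - 1)" if "finished i n j t" for j t
    using that by (auto simp: H'_def finished_def)
  show "vertices (Suc i) 0 H' = vertices i n H"
    using H' by (auto simp: vertices_def finished_next_layer[OF i])
  show "edges (Suc i) 0 H' S = edges i n H S"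
    using H' by (simp add: edges_def finished_next_layer[OF i] cong: conj_cong)
  have "H' j t - D t \<in> chain.span (D ` {u. u < t \<and> I u \<le> j})" if "j \<le> Suc i" "t < n" for j t
  proof (cases "j = Suc i")
    case True
    have "H i t - D t \<in> chain.span (D ` {u. u < t \<and> I u \<le> i})" using r that by (simp add:
        reduced_def)
    moreover have "\<dots> \<subseteq> chain.span (D ` {u. u < t \<and> I u \<le> j})"
      using True by (intro chain.span_mono) auto
    ultimately show ?thesis using True by (auto simp: H'_def)
  next
    case False
    then show ?thesis using that r by (simp add: reduced_def H'_def)
  qed
  moreover have "S j t \<subseteq> {u. u < t \<and> finished i n j u \<and> H' j u \<noteq> 0} \<and>
        H' (j - 1) t = H' j t + (\<Sum>u\<in>S j t. H' j u)" if "finished i n j t" for j t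
    using that r unfolding H'[OF that] reduced_def by blast
  moreover have "t = u" if "finished i n j t" "finished i n j u" "H' j t \<noteq> 0"
    "lowest (H' j t) = lowest (H' j u)" for j t u
    using that r unfolding H'[OF that(1)] reduced_def by blast
  ultimately show "reduced (Suc i) 0 H' S"
    unfolding reduced_def finished_next_layer[OF i] by (simp add: H'_def)
qed

text \<open>Next, column \<open>c\<close> of layer \<open>i\<close> becomes finished with the value
    \<open>x\<close> after the columns in \<open>U\<close> were added.\<close>
lemma finished_Suc:
  "c < n \<Longrightarrow> 1 \<le> i \<Longrightarrow> I c \<le> i \<Longrightarrow> finished i (Suc c)
      j t \<longleftrightarrow> finished i c j t \<or> j = i \<and> t = c"
  by (auto simp: finished_def less_Suc_eq)

lemma finished_Suc_inactive: "i < I c \<Longrightarrow> finished i (Suc c) = finished i c"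
  by (auto simp: finished_def less_Suc_eq fun_eq_iff)

lemma reduced_inactive: "i < I c \<Longrightarrow> reduced i c H S \<Longrightarrow> reduced i (Suc c) H S"
  unfolding reduced_def finished_Suc_inactive by auto

lemma
  assumes r: "reduced i c H S" and c: "c < n" "1 \<le> i" "I c \<le> i"
    and U: "U \<subseteq> {u. u < c \<and> I u \<le> i \<and> H i u \<noteq> 0}"
    and x: "H i c = x + (\<Sum>u\<in>U. H i u)"
    and new: "x \<noteq> 0 \<Longrightarrow> \<forall>u<c. I u \<le> i \<longrightarrow> H i u \<noteq>
        0 \<longrightarrow> lowest (H i u) \<noteq> lowest x"
  defines "H' \<equiv> H(i := (H i)(c := x))" and "S' \<equiv> S(i := (S i)(c := U))"
  shows reduced_step: "reduced i (Suc c) H' S'"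
    and vertices_step: "vertices i (Suc c) H' = vertices i c H \<union> (if x \<noteq> 0 then {(i, c)}
        else {})"
    and edges_step: "edges i (Suc c) H' S' = edges i c H S \<union>
      (if I c < i \<and> H i c \<noteq> 0 then {((i - 1, c), (i, u)) | u. u \<in> U \<or> u = c \<and>
          x \<noteq> 0} else {})"
proof -
  note F = finished_Suc[OF c]
  have cc: "\<not> finished i c i c" by (simp add: finished_def)
  have H': "H' j t = H j t" if "finished i c j t" for j t
    using that by (auto simp: H'_def finished_def)
  have S': "S' j t = S j t" if "finished i c j t" for j t
    using that by (auto simp: S'_def finished_def)
  have Hp: "H' (j - 1) = H (j - 1)" if "finished i (Suc c) j t" for j t
    using that by (auto simp: H'_def finished_def)
  have Hpc: "H (i - 1) c = H i c" using r c by (auto simp: reduced_def)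
  have Hc: "H' i c = x" "S' i c = U" by (auto simp: H'_def S'_def)
  show "vertices i (Suc c) H' = vertices i c H \<union> (if x \<noteq> 0 then {(i, c)} else {})"
    using H' Hc by (auto simp: vertices_def F)
  show "edges i (Suc c) H' S' = edges i c H S \<union>
      (if I c < i \<and> H i c \<noteq> 0 then {((i - 1, c), (i, u)) | u. u \<in> U \<or> u = c \<and>
          x \<noteq> 0} else {})"
    (is "_ = _ \<union> ?N")
  proof -
    have "edges i (Suc c) H' S' = {((j - 1, t), (j, u)) | j t u. finished i c j t \<and> I t < j \<and>
        H' (j - 1) t \<noteq> 0 \<and> (u \<in> S' j t \<or> u = t \<and> H' j t \<noteq> 0)} \<union>
      {((i - 1, c), (i, u)) | u. I c < i \<and> H' (i - 1) c \<noteq> 0 \<and> (u \<in> S' i c \<or> u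
          = c \<and> H' i c \<noteq> 0)}"
      unfolding edges_def F by blast
    also have "{((j - 1, t), (j, u)) | j t u. finished i c j t \<and> I t < j \<and>
        H' (j - 1) t \<noteq> 0 \<and> (u \<in> S' j t \<or> u = t \<and> H' j t \<noteq> 0)} = edges i c H S"
    proof -
      have "H' (j - 1) t = H (j - 1) t" if "finished i c j t" for j t
        using Hp[of j t] that by (simp add: F)
      with H' S' show ?thesis
        unfolding edges_def by (intro Collect_cong ex_cong1 conj_cong refl) auto
    qed
    also have "{((i - 1, c), (i, u)) | u. I c < i \<and> H' (i - 1) c \<noteq> 0 \<and> (u \<in> S' i c
        \<or> u = c \<and> H' i c \<noteq> 0)} = ?N"
      using Hp[of i c] Hpc by (simp add: F Hc)
    finally show ?thesis .
  qed
  have Ui: "u < c \<and> finished i c i u \<and> H i u \<noteq> 0" if "u \<in> U" for u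
    using U c that by (auto simp: finished_def)
  have Hi: "H' i u = H i u" if "u \<in> U" for u using Ui[OF that] by (simp add: H')
  have 1: "H' j t - D t \<in> chain.span (D ` {u. u < t \<and> I u \<le> j})" if "j \<le> i" "t < n" for j t
  proof (cases "j = i \<and> t = c")
    case False
    then have "H' j t = H j t" by (auto simp: H'_def)
    then show ?thesis using r that by (simp add: reduced_def)
  next
    case True
    let ?V = "chain.span (D ` {u. u < c \<and> I u \<le> i})"
    have "H i u \<in> ?V" if u: "u \<in> U" for u
    proof -
      have "H i u - D u \<in> chain.span (D ` {v. v < u \<and> I v \<le> i})"
        using r Ui[OF u] c by (simp add: reduced_def)
      also have "\<dots> \<subseteq> ?V" using Ui[OF u] by (intro chain.span_mono) auto
      finally have "H i u - D u \<in> ?V" .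
      moreover have "D u \<in> ?V" using U u by (intro chain.span_base) auto
      ultimately have "H i u - D u + D u \<in> ?V" by (rule chain.span_add)
      then show ?thesis by simp
    qed
    then have "(\<Sum>u\<in>U. H i u) \<in> ?V" by (rule chain.span_sum)
    moreover have "H i c - D c \<in> ?V" using r c unfolding reduced_def by blast
    ultimately have "H i c - D c - (\<Sum>u\<in>U. H i u) \<in> ?V" by (rule chain.span_diff[rotated])
    then show ?thesis using True x by (simp add: Hc algebra_simps)
  qed
  have 3: "S' j t \<subseteq> {u. u < t \<and> finished i (Suc c) j u \<and> H' j u \<noteq> 0} \<and>
        H' (j - 1) t = H' j t + (\<Sum>u\<in>S' j t. H' j u)" if f: "finished i (Suc c) j t" for j t
  proof (cases "j = i \<and> t = c")
    case True
    then have jt: "j = i" "t = c" by simp_all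
    have "U \<subseteq> {u. u < c \<and> finished i (Suc c) i u \<and> H' i u \<noteq> 0}"
    proof
      fix u assume u: "u \<in> U"
      from Ui[OF u] have "finished i (Suc c) i u" by (simp add: F)
      with Ui[OF u] Hi[OF u] show "u \<in> {u. u < c \<and> finished i (Suc c) i u \<and> H' i u
          \<noteq> 0}" by simp
    qed
    moreover have "(\<Sum>u\<in>U. H' i u) = (\<Sum>u\<in>U. H i u)" using Hi by (rule sum.cong[OF refl])
    ultimately show ?thesis
      using x Hpc unfolding jt Hc Hp[OF f, unfolded jt] by simp
  next
    case False
    with f have f': "finished i c j t" by (simp add: F)
    then have S: "S j t \<subseteq> {u. u < t \<and> finished i c j u \<and> H j u \<noteq> 0}"
      and H: "H (j - 1) t = H j t + (\<Sum>u\<in>S j t. H j u)"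
      using r unfolding reduced_def by blast+
    from S have "(\<Sum>u\<in>S j t. H' j u) = (\<Sum>u\<in>S j t. H j u)"
      by (intro sum.cong) (auto simp: H')
    moreover have "S j t \<subseteq> {u. u < t \<and> finished i (Suc c) j u \<and> H' j u \<noteq> 0}"
    proof
      fix u assume "u \<in> S j t"
      with S have u: "u < t" "finished i c j u" "H j u \<noteq> 0" by blast+
      from u(2) have "finished i (Suc c) j u" by (simp add: F)
      with u H'[OF u(2)] show "u \<in> {u. u < t \<and> finished i (Suc c) j u \<and> H' j u \<noteq>
          0}" by simp
    qed
    ultimately show ?thesis unfolding S'[OF f'] H'[OF f'] Hp[OF f] H by simp
  qed
  have 4: "t = u" if f: "finished i (Suc c) j t" "finished i (Suc c) j u" and nz: "H' j t \<noteq> 0"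
    and l: "lowest (H' j t) = lowest (H' j u)" for j t u
  proof -
    have nonzero_iff: "H' i u \<noteq> 0 \<longleftrightarrow> lowest (H' i u) \<noteq> 0" if "u < n" for u
      using lowest_eq_0_iff[OF supported_if[OF 1[OF order_refl that] that]] by simp
    have A: False if "finished i c i u" "x \<noteq> 0" "lowest x = lowest (H i u)" for u
    proof -
      have u: "u < n" "u < c" "I u \<le> i" using that(1) by (auto simp: finished_def)
      have "H i u \<noteq> 0"
        using nonzero_iff[OF u(1)] nonzero_iff[OF c(1)] that(2,3) unfolding Hc H'[OF that(1)] by simp
      with new[OF that(2)] u have "lowest (H i u) \<noteq> lowest x" by simp
      with that(3) show False by simp
    qed
    show ?thesis
    proof (cases "finished i c j t"; cases "finished i c j u")
      assume a: "finished i c j t" "finished i c j u"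
      then have "H j t \<noteq> 0" "lowest (H j t) = lowest (H j u)" using nz l by (simp_all add: H')
      with a show ?thesis
        by (rule r[unfolded reduced_def, THEN conjunct2, THEN conjunct2, THEN conjunct2, rule_format])
    next
      assume a: "finished i c j t" "\<not> finished i c j u"
      then have ju: "j = i" "u = c" using f by (simp_all add: F)
      from a(1) ju(1) have t: "finished i c i t" by simp
      have l': "lowest (H i t) = lowest x" and "H i t \<noteq> 0"
        using l nz unfolding ju Hc H'[OF t] by simp_all
      moreover have "t < n" using t by (simp add: finished_def)
      ultimately have "x \<noteq> 0"
        using nonzero_iff[of t] nonzero_iff[OF c(1)] unfolding Hc H'[OF t] by (simp del: bit_not_zero_iff)
      from A[OF t this l'[symmetric]] show ?thesis ..
    next
      assume a: "\<not> finished i c j t" "finished i c j u"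
      then have jt: "j = i" "t = c" using f by (simp_all add: F)
      from a(2) jt(1) have u: "finished i c i u" by simp
      have "lowest x = lowest (H i u)" and "x \<noteq> 0"
        using l nz unfolding jt Hc H'[OF u] by simp_all
      from A[OF u this(2,1)] show ?thesis ..
    next
      assume "\<not> finished i c j t" "\<not> finished i c j u"
      then show ?thesis using f by (auto simp: F)
    qed
  qed
  have 2: "H' i t = H' (i - 1) t" if "t < n" "Suc c \<le> t" for t
  proof -
    have "H i t = H (i - 1) t"
      by (rule r[unfolded reduced_def, THEN conjunct2, THEN conjunct1, rule_format, OF that(1)])
        (use that in simp)
    moreover have "H' i t = H i t" "H' (i - 1) = H (i - 1)" using that c(2) by (auto simp: H'_def)
    ultimately show ?thesis by metis
  qed
  show "reduced i (Suc c) H' S'"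
    unfolding reduced_def
  proof (intro conjI)
    show "\<forall>j\<le>i. \<forall>t<n. H' j t - D t \<in> chain.span (D ` {u. u < t \<and> I u \<le> j})"
      by (intro allI impI 1)
    show "\<forall>t<n. Suc c \<le> t \<longrightarrow> H' i t = H' (i - 1) t"
      by (intro allI impI 2)
    show "\<forall>j t. finished i (Suc c) j t \<longrightarrow> S' j t \<subseteq> {u. u < t \<and>
        finished i (Suc c) j u \<and> H' j u \<noteq> 0} \<and>
        H' (j - 1) t = H' j t + (\<Sum>u\<in>S' j t. H' j u)"
      by (intro allI impI 3)
    show "\<forall>j t u. finished i (Suc c) j t \<longrightarrow> finished i (Suc c) j u
        \<longrightarrow> H' j t \<noteq> 0 \<longrightarrow>
        lowest (H' j t) = lowest (H' j u) \<longrightarrow> t = u"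
      by (intro allI impI, rule 4)
  qed
qed

end

section \<open>Reduction of one column\<close>

text \<open>\<open>present\<close> tells whether the column under reduction was a vertex of the
    previous layer, and \<open>old\<close>
  is the number of that vertex.\<close>
definition emit_edge :: "expr \<Rightarrow> program" where
  "emit_edge e =
     Cond (Equal (Reg ''present'') (Const 1))
       (Store ''from'' (Reg ''ne'') (Reg ''old'') ;; Store ''to'' (Reg ''ne'') e ;; Inc ''ne'')
       Skip"

text \<open>\<open>own l\<close> is the column that last claimed the lowest row \<open>l\<close>.
    Entries of former layers are not
  erased: a stale or initial entry \<open>t\<close> is recognized because \<open>t\<close> does not
      come before \<open>c\<close>, has
  another lowest row by now, or is not yet present.\<close>
definition conflict :: test where
  "conflict =
     Conj (Less (Const 0) (Load ''low'' (Reg ''c'')))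
    (Conj (Less (Load ''own'' (Load ''low'' (Reg ''c''))) (Reg ''c''))
    (Conj (Equal (Load ''low'' (Load ''own'' (Load ''low'' (Reg ''c'')))) (Load ''low'' (Reg ''c'')))
          (Less (Load ''I'' (Load ''own'' (Load ''low'' (Reg ''c'')))) (Add (Reg ''i'') (Const 1)))))"

definition resolve :: program where
  "resolve =
     Assign ''t'' (Load ''own'' (Load ''low'' (Reg ''c''))) ;;
     emit_edge (Load ''id'' (Reg ''t'')) ;;
     add_column"

definition record_vertex :: program where
  "record_vertex =
     Store ''own'' (Load ''low'' (Reg ''c'')) (Reg ''c'') ;;
     Store ''id'' (Reg ''c'') (Reg ''nv'') ;;
     emit_edge (Reg ''nv'') ;;
     Store ''layer'' (Reg ''nv'') (Reg ''i'') ;;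
     Store ''birth'' (Reg ''nv'') (Load ''J'' (Sub (Load ''low'' (Reg ''c'')) (Const 1))) ;;
     Store ''death'' (Reg ''nv'') (Load ''J'' (Reg ''c'')) ;;
     Inc ''nv''"

definition reduce_column :: program where
  "reduce_column =
     Assign ''old'' (Load ''id'' (Reg ''c'')) ;;
     Cond (Conj (Less (Load ''I'' (Reg ''c'')) (Reg ''i'')) (Less (Const 0) (Load ''low'' (Reg ''c''))))
       (Assign ''present'' (Const 1))
       (Assign ''present'' (Const 0)) ;;
     While conflict resolve ;;
     Cond (Less (Const 0) (Load ''low'' (Reg ''c''))) record_vertex Skip"

text \<open>Without simplices the number of layers is not bounded by any function of \<open>n\<close>,
    whence the test
  \<open>0 < n\<close>.\<close>
definition reduce_layers :: program where
  "reduce_layers =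
     Assign ''nv'' (Const 0) ;;
     Assign ''ne'' (Const 0) ;;
     Assign ''i'' (Const 1) ;;
     While (Conj (Less (Const 0) (Reg ''n'')) (Less (Reg ''i'') (Add (Reg ''s'') (Const 1))))
       (For ''c'' (Reg ''n'')
          (Cond (Less (Load ''I'' (Reg ''c'')) (Add (Reg ''i'') (Const 1))) reduce_column Skip) ;;
        Inc ''i'')"

definition potential :: "nat \<Rightarrow> state \<Rightarrow> nat" where
  "potential n st = (\<Sum>c<n. arrays st ''low'' c)"

text \<open>An addition takes at most \<open>5 * n + 11\<close> steps, including the loop test and the
    output of an edge, and
  lowers the potential by at least 1. The other 6 units of the coefficient \<open>5 * n + 17\<close>
      are saved with
  the edge: each vertex and each edge keeps 6 units for being copied to the output array.\<close>
definition cost :: "nat \<Rightarrow> state \<Rightarrow> nat \<Rightarrow> nat" where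
  "cost n st T = T + (5 * n + 17) * potential n st + 6 * (regs st ''nv'' + regs st ''ne'')"

context layers
begin

definition static :: "state \<Rightarrow> bool" where
  "static st \<longleftrightarrow> regs st ''n'' = n \<and> regs st ''s'' = s \<and>
     (\<forall>c<n. arrays st ''base'' c = c * n \<and> arrays st ''I'' c = I c \<and> arrays st ''J''
         c = J c)"

definition vertices_stored :: "(nat \<Rightarrow> nat \<Rightarrow> chain) \<Rightarrow> (nat \<times>
    nat) list \<Rightarrow> state \<Rightarrow> bool" where
  "vertices_stored H vl st \<longleftrightarrow> regs st ''nv'' = length vl \<and>
     (\<forall>k<length vl. arrays st ''layer'' k = fst (vl ! k) \<and>
        arrays st ''birth'' k = J (lowest (H (fst (vl ! k)) (snd (vl ! k))) - 1) \<and>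
        arrays st ''death'' k = J (snd (vl ! k)))"

definition edges_stored ::
  "(nat \<times> nat) list \<Rightarrow> ((nat \<times> nat) \<times> (nat \<times> nat)) list
      \<Rightarrow> state \<Rightarrow> bool" where
  "edges_stored vl el st \<longleftrightarrow> regs st ''ne'' = length el \<and>
     (\<forall>k<length el.
        arrays st ''from'' k < length vl \<and> vl ! (arrays st ''from'' k) = fst (el ! k) \<and>
        arrays st ''to'' k < length vl \<and> vl ! (arrays st ''to'' k) = snd (el ! k))"

text \<open>Columns before \<open>c\<close> own their lowest row and \<open>id\<close> holds their
    vertex of the current layer; from \<open>c\<close>
  on, \<open>id\<close> still holds the vertex of the previous layer.\<close>
definition owners :: "nat \<Rightarrow> nat \<Rightarrow> (nat \<Rightarrow> nat \<Rightarrow> chain)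
    \<Rightarrow> (nat \<times> nat) list \<Rightarrow> state \<Rightarrow> bool" where
  "owners i c H vl st \<longleftrightarrow>
     (\<forall>t<n. t < c \<and> I t \<le> i \<and> H i t \<noteq> 0 \<longrightarrow> arrays st
         ''own'' (lowest (H i t)) = t \<and>
        arrays st ''id'' t < length vl \<and> vl ! (arrays st ''id'' t) = (i, t)) \<and>
     (\<forall>t<n. c \<le> t \<and> I t < i \<and> H i t \<noteq> 0 \<longrightarrow>
        arrays st ''id'' t < length vl \<and> vl ! (arrays st ''id'' t) = (i - 1, t))"

definition recorded ::
  "nat \<Rightarrow> nat \<Rightarrow> (nat \<Rightarrow> nat \<Rightarrow> chain) \<Rightarrow> (nat
      \<Rightarrow> nat \<Rightarrow> nat set) \<Rightarrow>
   (nat \<times> nat) list \<Rightarrow> ((nat \<times> nat) \<times> (nat \<times> nat)) list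
       \<Rightarrow> state \<Rightarrow> bool" where
  "recorded i c H S vl el st \<longleftrightarrow> holds sx n st (H i) \<and>
     distinct vl \<and> set vl = vertices i c H \<and> distinct el \<and> set el = edges i c H S \<and>
     vertices_stored H vl st \<and> edges_stored vl el st \<and> owners i c H vl st"

text \<open>The state while column \<open>c\<close> is being reduced: it has the value \<open>x\<close>
    after the columns in \<open>U\<close> were
  added to it. The ghost \<open>H i c\<close> keeps the value from the previous layer until the
      reduction ends.\<close>
definition reducing ::
  "nat \<Rightarrow> nat \<Rightarrow> (nat \<Rightarrow> nat \<Rightarrow> chain) \<Rightarrow> (nat
      \<Rightarrow> nat \<Rightarrow> nat set) \<Rightarrow> (nat \<times> nat) list \<Rightarrow>
   nat set \<Rightarrow> chain \<Rightarrow> ((nat \<times> nat) \<times> (nat \<times> nat)) list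
       \<Rightarrow> state \<Rightarrow> bool" where
  "reducing i c H S vl U x el st \<longleftrightarrow> holds sx n st ((H i)(c := x)) \<and>
     U \<subseteq> {u. u < c \<and> I u \<le> i \<and> H i u \<noteq> 0} \<and> (\<forall>u\<in>U.
         lowest x < lowest (H i u)) \<and>
     H i c = x + (\<Sum>u\<in>U. H i u) \<and>
     distinct el \<and> set el = edges i c H S \<union>
       (if I c < i \<and> H i c \<noteq> 0 then {((i - 1, c), (i, u)) | u. u \<in> U} else {}) \<and>
     edges_stored vl el st"

lemma potential_less:
  assumes "holds sx n st R" "holds sx n st' (R(c := y))" "c < n" "lowest y < lowest (R c)"
  shows "potential n st' < potential n st"
  unfolding potential_def
  using assms by (intro sum_strict_mono_ex1) (auto simp: holds_def)

text \<open>Edges that leave column \<open>c\<close> of the previous layer are only created while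
    column \<open>c\<close> is reduced, so
  none of them is listed twice.\<close>
lemma edges_source: "1 \<le> i \<Longrightarrow> ((i - 1, c), v) \<notin> edges i c H S"
  by (auto simp: edges_def finished_def)

lemma edges_stored_Cons:
  assumes "edges_stored vl el st" "k < length vl" "l < length vl"
  shows "edges_stored vl (el @ [(vl ! k, vl ! l)])
    (st\<lparr>regs := (regs st)(''ne'' := Suc (length el)),
        arrays := (arrays st)(''from'' := (arrays st ''from'')(length el := k),
                              ''to'' := (arrays st ''to'')(length el := l))\<rparr>)"
  using assms by (auto simp: edges_stored_def nth_append less_Suc_eq)

text \<open>The column \<open>t\<close> found in the conflict is a new element of \<open>U\<close>,
    since the lowest rows of the
  elements of \<open>U\<close> lie strictly below the current one.\<close>
lemma wp_resolve:
  assumes static: "static st" and regs: "regs st ''c'' = c" "regs st ''i'' = i" "c < n"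
    and red: "reduced i c H S" "1 \<le> i" "I c \<le> i" and own: "owners i c H vl st"
    and present: "regs st ''present'' = of_bool (I c < i \<and> H i c \<noteq> 0)"
    and old: "I c < i \<Longrightarrow> H i c \<noteq> 0 \<Longrightarrow> regs st ''old'' < length vl
        \<and> vl ! (regs st ''old'') = (i - 1, c)"
    and mid: "reducing i c H S vl U x el st"
    and test: "eval_test conflict st"
  shows "wp resolve (\<lambda>st' T'. (\<exists>U x el. reducing i c H S vl U x el st') \<and>
     cost n st' T' + 1 \<le> cost n st T \<and> arrays st' ''low'' c < arrays st ''low'' c) st T"
proof -
  have h: "holds sx n st ((H i)(c := x))" using mid by (simp add: reducing_def)
  have lowc: "arrays st ''low'' c = lowest x" using h regs by (simp add: holds_def)
  define t where "t = arrays st ''own'' (lowest x)"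
  have t: "t < c" "lowest x \<noteq> 0" "arrays st ''low'' t = lowest x" "arrays st ''I'' t \<le> i"
    using test lowc by (simp_all add: conflict_def regs t_def)
  then have tn: "t < n" "I t \<le> i" using regs static by (simp_all add: static_def)
  have lt: "lowest (H i t) = lowest x" using h t tn by (simp add: holds_def)
  have "supported (H i t)"
    by (rule supported_if[of _ _ i]) (use red tn in \<open>simp_all add: reduced_def\<close>)
  then have nz: "H i t \<noteq> 0" using lowest_eq_0_iff lt t(2) by metis
  have id: "arrays st ''id'' t < length vl" "vl ! (arrays st ''id'' t) = (i, t)"
    using own t tn nz by (simp_all add: owners_def)
  let ?y = "x + H i t"
  have ly: "lowest ?y < lowest x"
    using pivot_add_less[of "\<lambda>r. x (sx r)" n "\<lambda>r. H i t (sx r)"] lt t(2) by (simp add: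
        low_def)
  have tU: "t \<notin> U" using mid lt by (auto simp: reducing_def)
  have finU: "finite U" using mid by (auto simp: reducing_def intro: finite_subset[of _ "{..<c}"])
  define pres where "pres \<longleftrightarrow> I c < i \<and> H i c \<noteq> 0"
  define el' where "el' = (if pres then el @ [((i - 1, c), (i, t))] else el)"
  have el': "distinct el' \<and> set el' = edges i c H S \<union>
       (if I c < i \<and> H i c \<noteq> 0 then {((i - 1, c), (i, u)) | u. u \<in> insert t U} else {})"
    using mid tU edges_source[OF red(2), of c] by (auto simp: reducing_def el'_def pres_def)
  have sum: "H i c = ?y + (\<Sum>u\<in>insert t U. H i u)"
  proof -
    have "?y + (\<Sum>u\<in>insert t U. H i u) = x + (\<Sum>u\<in>U. H i u) + (H i t + H i t)"
      by (simp only: sum.insert[OF finU tU] ac_simps)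
    then show ?thesis using mid by (simp add: reducing_def)
  qed
  (* Whether or not an edge is written before the addition, the addition starts in a state of this
     form. *)
  have fin: "wp add_column (\<lambda>st' T'. (\<exists>U x el. reducing i c H S vl U x el st') \<and>
       cost n st' T' + 1 \<le> cost n st T \<and> arrays st' ''low'' c < arrays st ''low'' c) st1 T1"
    if st1: "regs st1 ''n'' = n" "regs st1 ''c'' = c" "regs st1 ''t'' = t" "arrays st1 ''low'' = arrays
        st ''low''"
      "arrays st1 ''M'' = arrays st ''M''" "arrays st1 ''base'' = arrays st ''base''"
      "edges_stored vl el' st1" "regs st1 ''nv'' = regs st ''nv''" "regs st1 ''ne'' \<le> regs st ''ne'' + 1"
      "T1 \<le> T + 5" for st1 T1
  proof (rule wp_add_column[where R = "(H i)(c := x)" and c = c and t = t and n = n and sx = sx])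
    show "holds sx n st1 ((H i)(c := x))" using h st1 by (simp add: holds_def)
    show "arrays st1 ''base'' c' = c' * n" if "c' < n" for c'
      using static st1 that by (simp add: static_def)
    fix st' T' assume u: "unchanged add_column st1 st'"
      and h': "holds sx n st' (((H i)(c := x))(c := ((H i)(c := x)) c + ((H i)(c := x)) t))"
      and T': "T' \<le> T1 + 5 * n + 5"
    have e: "((H i)(c := x))(c := ((H i)(c := x)) c + ((H i)(c := x)) t) = (H i)(c := ?y)"
      using t(1) by auto
    from u have v: "regs st' ''nv'' = regs st ''nv''" "regs st' ''ne'' = regs st1 ''ne''"
      "arrays st' ''from'' = arrays st1 ''from''" "arrays st' ''to'' = arrays st1 ''to''"
      by (simp_all add: unchanged_def add_column_def st1)
    have "holds sx n st' ((H i)(c := ?y))" using h' unfolding e .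
    then have low': "arrays st' ''low'' c = lowest ?y" and hy: "holds sx n st' ((H i)(c := ?y))"
      using regs by (simp_all add: holds_def)
    have "edges_stored vl el' st'" using st1(7) by (simp add: edges_stored_def v)
    moreover have "\<forall>u\<in>insert t U. lowest ?y < lowest (H i u)"
      using mid ly lt by (auto simp: reducing_def)
    moreover have "insert t U \<subseteq> {u. u < c \<and> I u \<le> i \<and> H i u \<noteq> 0}"
      using mid t tn nz by (auto simp: reducing_def)
    ultimately have "reducing i c H S vl (insert t U) ?y el' st'"
      using hy el' sum unfolding reducing_def by blast
    moreover have "cost n st' T' + 1 \<le> cost n st T"
    proof -
      have "potential n st' < potential n st"
        by (rule potential_less[OF h, where y = ?y and c = c]) (use hy regs ly in simp_all)
      then have "(5 * n + 17) * Suc (potential n st') \<le> (5 * n + 17) * potential n st"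
        by (intro mult_le_mono2) simp
      then show ?thesis using T' st1 v unfolding cost_def by (simp add: algebra_simps)
    qed
    moreover have "arrays st' ''low'' c < arrays st ''low'' c" using low' lowc ly by simp
    ultimately show "(\<exists>U x el. reducing i c H S vl U x el st') \<and>
       cost n st' T' + 1 \<le> cost n st T \<and> arrays st' ''low'' c < arrays st ''low'' c" by blast
  qed (use st1 regs t tn in simp_all)
  have es: "edges_stored vl el st" using mid by (simp add: reducing_def)
  then have ne: "regs st ''ne'' = length el" by (simp add: edges_stored_def)
  have tt: "arrays st ''own'' (arrays st ''low'' c) = t" by (simp add: lowc t_def)
  show ?thesis
  proof (cases pres)
    case True
    then have "regs st ''present'' = 1" "regs st ''old'' < length vl" "vl ! (regs st ''old'') = (i - 1, c)"
      using present old by (simp_all add: pres_def)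
    moreover have "edges_stored vl el' (st\<lparr>regs := (regs st)(''ne'' := Suc (length el)),
        arrays := (arrays st)(''from'' := (arrays st ''from'')(length el := regs st ''old''),
                              ''to'' := (arrays st ''to'')(length el := arrays st ''id'' t))\<rparr>)"
      using edges_stored_Cons[OF es, of "regs st ''old''" "arrays st ''id'' t"] True calculation id
      by (simp add: el'_def)
    ultimately show ?thesis
      unfolding resolve_def emit_edge_def
      using static regs
      by (simp add: tt ne) (rule fin[unfolded Suc_eq_plus1[symmetric]]; simp add: static_def ne
          edges_stored_def)
  next
    case False
    then have "regs st ''present'' = 0" using present by (simp add: pres_def)
    then show ?thesis
      unfolding resolve_def emit_edge_def
      using static regs es False
      by (simp add: tt ne) (rule fin[unfolded Suc_eq_plus1[symmetric]]; simp add: static_def ne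
          edges_stored_def el'_def)
  qed
qed

end

context layers
begin

text \<open>When the loop ends, no earlier column shares the lowest row of column \<open>c\<close>,
    because \<open>own\<close> would
  have pointed to it.\<close>
lemma wp_reduce_column:
  assumes static: "static st" and regs: "regs st ''c'' = c" "regs st ''i'' = i" and c: "c < n" "1 \<le>
      i" "I c \<le> i"
    and red: "reduced i c H S" and rec: "recorded i c H S vl el st"
  shows "wp reduce_column (\<lambda>st' T'. (\<exists>H S vl el. reduced i (Suc c) H S \<and> recorded
      i (Suc c) H S vl el st') \<and>
     cost n st' T' \<le> cost n st T + 27) st T"
    (is "wp _ ?Q st T")
proof -
  define Post where "Post = ?Q"
  define pres where "pres \<longleftrightarrow> I c < i \<and> H i c \<noteq> 0"
  have rec': "holds sx n st (H i)" "distinct vl" "set vl = vertices i c H" "distinct el" "set el =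
      edges i c H S"
    "vertices_stored H vl st" "edges_stored vl el st" "owners i c H vl st"
    using rec by (simp_all add: recorded_def)
  have supp: "supported (H i t)" if "t < n" for t
    by (rule supported_if[of _ _ i]) (use red that in \<open>simp_all add: reduced_def\<close>)
  have "(0 < arrays st ''low'' c) \<longleftrightarrow> H i c \<noteq> 0"
    using rec'(1) c lowest_eq_0_iff[OF supp[OF c(1)]] by (auto simp: holds_def simp del: bit_not_zero_iff)
  then have pres_test: "(I c < i \<and> 0 < arrays st ''low'' c) \<longleftrightarrow> pres" by (simp
      add: pres_def)
  have Ic: "arrays st ''I'' c = I c" using static c by (simp add: static_def)
  (* For a column that is new in this layer, old holds an arbitrary number that is never used. *)
  define st1 where "st1 = st\<lparr>regs := (regs st)(''old'' := arrays st ''id'' c, ''present'' :=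
      of_bool pres)\<rparr>"
  have loop: "wp (While conflict resolve) (wp (Cond (Less (Const 0) (Load ''low'' (Reg ''c'')))
      record_vertex Skip) Post) st1 (T + 3)"
  proof (rule wp_While[where I = "\<lambda>st' T'. (\<exists>U x el. reducing i c H S vl U x el st')
      \<and> cost n st' T' \<le> cost n st T + 3" and
        m = "\<lambda>st'. arrays st' ''low'' c"])
    have "reducing i c H S vl {} (H i c) el st1"
      using rec' by (simp add: reducing_def st1_def holds_def edges_stored_def)
    moreover have "cost n st1 (T + 3) \<le> cost n st T + 3"
      by (simp add: cost_def potential_def st1_def)
    ultimately show "(\<exists>U x el. reducing i c H S vl U x el st1) \<and> cost n st1 (T + 3) \<le>
        cost n st T + 3" by blast
  next
    fix st' T'
    assume inv: "(\<exists>U x el. reducing i c H S vl U x el st') \<and> cost n st' T' \<le> cost n st T + 3"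
      and u: "unchanged resolve st1 st'" and test: "eval_test conflict st'"
    have v: "regs st' ''n'' = regs st ''n''" "regs st' ''s'' = regs st ''s''" "regs st' ''c'' = c"
      "regs st' ''i'' = i" "regs st' ''present'' = of_bool pres" "regs st' ''old'' = arrays st ''id'' c"
      "arrays st' ''base'' = arrays st ''base''" "arrays st' ''I'' = arrays st ''I''"
      "arrays st' ''J'' = arrays st ''J''" "arrays st' ''own'' = arrays st ''own''"
      "arrays st' ''id'' = arrays st ''id''"
      using u by (simp_all add: unchanged_def st1_def resolve_def emit_edge_def add_column_def regs)
    from inv obtain U x el where mid: "reducing i c H S vl U x el st'" by blast
    have "wp resolve (\<lambda>st'' T''. (\<exists>U x el. reducing i c H S vl U x el st'') \<and>
        cost n st'' T'' + 1 \<le> cost n st' T' \<and> arrays st'' ''low'' c < arrays st' ''low'' c) st' T'"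
    proof (rule wp_resolve[OF _ v(3,4) c(1) red c(2,3) _ _ _ mid test])
      show "static st'" using static by (simp add: static_def v)
      show "owners i c H vl st'" using rec'(8) by (simp add: owners_def v)
      show "regs st' ''present'' = of_bool (I c < i \<and> H i c \<noteq> 0)" by (simp add: v pres_def)
      show "regs st' ''old'' < length vl \<and> vl ! (regs st' ''old'') = (i - 1, c)" if "I c < i" "H i
          c \<noteq> 0"
        using rec'(8) that c by (simp add: owners_def v)
    qed
    then show "wp resolve (\<lambda>st'' T''. ((\<exists>U x el. reducing i c H S vl U x el st'') \<and>
        cost n st'' (T'' + 1) \<le> cost n st T + 3) \<and> arrays st'' ''low'' c < arrays st' ''low''
            c) st' T'"
      by (rule wp_weaken) (use inv in \<open>auto simp: cost_def\<close>)
  next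
    fix st' T'
    assume inv: "(\<exists>U x el. reducing i c H S vl U x el st') \<and> cost n st' T' \<le> cost n st T + 3"
      and u: "unchanged resolve st1 st'" and test: "\<not> eval_test conflict st'"
    have v: "regs st' ''c'' = c"
      "regs st' ''i'' = i" "regs st' ''present'' = of_bool pres" "regs st' ''old'' = arrays st ''id'' c"
      "arrays st' ''I'' = arrays st ''I''" "arrays st' ''J'' = arrays st ''J''"
      "arrays st' ''own'' = arrays st ''own''" "arrays st' ''id'' = arrays st ''id''"
      "arrays st' ''layer'' = arrays st ''layer''" "arrays st' ''birth'' = arrays st ''birth''"
      "arrays st' ''death'' = arrays st ''death''"
      using u by (simp_all add: unchanged_def st1_def resolve_def emit_edge_def add_column_def regs)
    have v_nv: "regs st' ''nv'' = regs st ''nv''"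
      using u by (simp add: unchanged_def st1_def resolve_def emit_edge_def add_column_def)
    from inv obtain U x el' where mid: "reducing i c H S vl U x el' st'" by blast
    have cost': "cost n st' T' \<le> cost n st T + 3" using inv by blast
    have h: "holds sx n st' ((H i)(c := x))" and Usub: "U \<subseteq> {u. u < c \<and> I u \<le> i
        \<and> H i u \<noteq> 0}"
      and Hx: "H i c = x + (\<Sum>u\<in>U. H i u)" and de: "distinct el'"
      and se: "set el' = edges i c H S \<union> (if pres then {((i - 1, c), (i, u)) | u. u \<in> U} else {})"
      and es: "edges_stored vl el' st'"
      using mid by (simp_all add: reducing_def pres_def)
    have lowx: "arrays st' ''low'' c = lowest x" using h c by (simp add: holds_def)
    have new: "\<forall>u<c. I u \<le> i \<longrightarrow> H i u \<noteq> 0 \<longrightarrow> lowest (H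
        i u) \<noteq> lowest x"
    proof (intro allI impI)
      fix t assume t: "t < c" "I t \<le> i" "H i t \<noteq> 0"
      have tn: "t < n" using t c by simp
      have "lowest (H i t) \<noteq> 0" using lowest_eq_0_iff[OF supp[OF tn]] t(3) by blast
      moreover have "arrays st ''own'' (lowest (H i t)) = t" using rec'(8) t tn by (simp add: owners_def)
      moreover have "arrays st' ''low'' t = lowest (H i t)" using h t tn by (simp add: holds_def)
      moreover have "arrays st' ''I'' t = I t" using static tn by (simp add: static_def v)
      ultimately show "lowest (H i t) \<noteq> lowest x"
        using test t by (auto simp: conflict_def v lowx)
    qed
    define H' where "H' = H(i := (H i)(c := x))"
    define S' where "S' = S(i := (S i)(c := U))"
    have red': "reduced i (Suc c) H' S'"
      unfolding H'_def S'_def by (rule reduced_step[OF red c Usub Hx]) (use new in blast)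
    have vert: "vertices i (Suc c) H' = vertices i c H \<union> (if x \<noteq> 0 then {(i, c)} else {})"
      unfolding H'_def by (rule vertices_step[OF red c Usub Hx]) (use new in blast)
    have edg: "edges i (Suc c) H' S' = edges i c H S \<union>
      (if pres then {((i - 1, c), (i, u)) | u. u \<in> U \<or> u = c \<and> x \<noteq> 0} else {})"
      unfolding H'_def S'_def pres_def by (rule edges_step[OF red c Usub Hx]) (use new in blast)
    have suppx: "supported x"
    proof -
      have "H' i c - D c \<in> chain.span (D ` {u. u < c \<and> I u \<le> i})"
        using red' c unfolding reduced_def by blast
      from supported_if[OF this c(1)] show ?thesis by (simp add: H'_def)
    qed
    have Hi: "H' i = (H i)(c := x)" by (simp add: H'_def)
    have ic: "(i, c) \<notin> vertices i c H" by (simp add: vertices_def finished_def)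
    have Hold: "H' j t = H j t" if "(j, t) \<in> set vl" for j t
      using that rec'(3) by (auto simp: H'_def vertices_def finished_def)
    have Hvl: "H' (fst (vl ! k)) (snd (vl ! k)) = H (fst (vl ! k)) (snd (vl ! k))" if "k < length vl" for k
      using Hold[of "fst (vl ! k)" "snd (vl ! k)"] that by simp
    have vs: "vertices_stored H vl st'" using rec'(6) by (simp add: vertices_stored_def v v_nv)
    have vs': "vertices_stored H' vl st'" using vs Hvl by (simp add: vertices_stored_def)
    have ow: "owners i c H vl st'" using rec'(8) by (simp add: owners_def v)
    have nv: "regs st' ''nv'' = length vl" and ne: "regs st' ''ne'' = length el'"
      using vs es by (simp_all add: vertices_stored_def edges_stored_def)
    have Jc: "arrays st ''J'' t = J t" if "t < n" for t using static that by (simp add: static_def v)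
    show "wp (Cond (Less (Const 0) (Load ''low'' (Reg ''c''))) record_vertex Skip) Post st' (T' + 1)"
    proof (cases "lowest x = 0")
      case True
      then have x0: "x = 0" using lowest_eq_0_iff[OF suppx] by simp
      have "owners i (Suc c) H' vl st'"
        using ow x0 by (auto simp: owners_def Hi less_Suc_eq)
      then have "recorded i (Suc c) H' S' vl el' st'"
        unfolding recorded_def Hi vert edg using h rec'(2,3) de se vs' es x0 by simp
      with red' have "\<exists>H S vl el. reduced i (Suc c) H S \<and> recorded i (Suc c) H S vl el
          st'" by blast
      moreover have "cost n st' (T' + 3) \<le> cost n st T + 27" using cost' by (simp add: cost_def)
      ultimately have "Post st' (T' + 3)" unfolding Post_def by blast
      then show ?thesis using True by (simp add: v lowx numeral_3_eq_3)
    next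
      case False
      then have x0: "x \<noteq> 0" using lowest_eq_0_iff[OF suppx] by simp
      have lx: "lowest x - 1 < n" using False pivot_le[of "\<lambda>r. x (sx r)" n] by (simp add: low_def)
      define vl' where "vl' = vl @ [(i, c)]"
      define el'' where "el'' = (if pres then el' @ [((i - 1, c), (i, c))] else el')"
      (* emit_edge may or may not write an edge; both branches are concluded by the same argument about
         the final state. *)
      have fin: "Post st'' T''"
        if a: "arrays st'' = (arrays st')(''own'' := (arrays st' ''own'')(lowest x := c),
            ''id'' := (arrays st' ''id'')(c := length vl),
            ''from'' := arrays st'' ''from'', ''to'' := arrays st'' ''to'',
            ''layer'' := (arrays st' ''layer'')(length vl := i),
            ''birth'' := (arrays st' ''birth'')(length vl := J (lowest x - 1)),
            ''death'' := (arrays st' ''death'')(length vl := J c))"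
          and r: "regs st'' ''nv'' = Suc (length vl)" "regs st'' ''ne'' \<le> Suc (length el')"
          and e: "edges_stored vl' el'' st''" and T'': "T'' \<le> T' + 12"
        for st'' T''
      proof -
        have a': "arrays st'' ''own'' = (arrays st' ''own'')(lowest x := c)"
            "arrays st'' ''id'' = (arrays st' ''id'')(c := length vl)"
            "arrays st'' ''layer'' = (arrays st' ''layer'')(length vl := i)"
            "arrays st'' ''birth'' = (arrays st' ''birth'')(length vl := J (lowest x - 1))"
            "arrays st'' ''death'' = (arrays st' ''death'')(length vl := J c)"
            "arrays st'' ''low'' = arrays st' ''low''" "arrays st'' ''M'' = arrays st' ''M''"
          by (subst a, simp)+
        have "owners i (Suc c) H' vl' st''"
          unfolding owners_def
        proof (intro conjI allI impI)
          fix t assume tn: "t < n" and t: "t < Suc c \<and> I t \<le> i \<and> H' i t \<noteq> 0"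
          show "arrays st'' ''own'' (lowest (H' i t)) = t"
            using ow t tn new by (cases "t = c") (simp_all add: a' Hi owners_def)
          show "arrays st'' ''id'' t < length vl'" "vl' ! (arrays st'' ''id'' t) = (i, t)"
            using ow t tn by (cases "t = c", simp_all add: a' Hi owners_def vl'_def nth_append less_Suc_eq)+
        next
          fix t assume tn: "t < n" and "Suc c \<le> t \<and> I t < i \<and> H' i t \<noteq> 0"
          then have t: "c \<le> t" "t \<noteq> c" "I t < i" "H i t \<noteq> 0" by (auto simp: Hi)
          show "arrays st'' ''id'' t < length vl'" "vl' ! (arrays st'' ''id'' t) = (i - 1, t)"
            using ow t tn by (simp_all add: a' Hi owners_def vl'_def nth_append less_Suc_eq)
        qed
        moreover have "vertices_stored H' vl' st''"
          using vs' by (auto simp: vertices_stored_def a' r vl'_def nth_append less_Suc_eq Hi)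
        moreover have "holds sx n st'' (H' i)" using h by (simp add: holds_def a' Hi)
        moreover have "distinct vl'" "set vl' = vertices i (Suc c) H'"
          using rec'(2,3) ic x0 unfolding vert vl'_def by auto
        moreover have "distinct el''" "set el'' = edges i (Suc c) H' S'"
          using de se edges_source[OF c(2), of c] Usub x0 unfolding edg el''_def by auto
        ultimately have "recorded i (Suc c) H' S' vl' el'' st''"
          using e unfolding recorded_def by blast
        with red' have "\<exists>H S vl el. reduced i (Suc c) H S \<and> recorded i (Suc c) H S vl el
            st''" by blast
        moreover have "cost n st'' T'' \<le> cost n st T + 27"
          using cost' T'' r by (simp add: cost_def potential_def a' nv ne)
        ultimately show ?thesis unfolding Post_def by blast
      qed
      show ?thesis
      proof (cases pres)
        case True
        have old: "arrays st ''id'' c < length vl" "vl ! (arrays st ''id'' c) = (i - 1, c)"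
          using ow True c by (simp_all add: owners_def v pres_def)
        show ?thesis
          unfolding record_vertex_def emit_edge_def using True False
          apply (simp add: v lowx nv ne Jc c lx)
          apply (rule fin)
              apply (simp add: fun_eq_iff v Jc c lx[simplified])
          subgoal by (simp)
          subgoal by (simp)
          subgoal using es old by (auto simp: edges_stored_def el''_def vl'_def nth_append less_Suc_eq)
          subgoal by simp
          done
      next
        case False2: False
        show ?thesis
          unfolding record_vertex_def emit_edge_def using False2 False
          apply (simp add: v lowx nv ne Jc c lx)
          apply (rule fin)
              apply (simp add: fun_eq_iff v Jc c lx[simplified])
          subgoal by (simp)
          subgoal by (simp add: ne)
          subgoal using es by (auto simp: edges_stored_def el''_def vl'_def nth_append less_Suc_eq)
          subgoal by simp
          done
      qed
    qed
  qed
  then show ?thesis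
    unfolding reduce_column_def Post_def[symmetric] using pres_test Ic regs
    by (auto simp: st1_def eval_nat_numeral)
qed

end

section \<open>Reduction of all layers\<close>

context layers
begin

lemma recorded_next_layer:
  assumes "1 \<le> i" "reduced i n H S" "recorded i n H S vl el st"
  shows "recorded (Suc i) 0 (H(Suc i := H i)) S vl el st"
proof -
  let ?H = "H(Suc i := H i)"
  have rec: "holds sx n st (H i)" "distinct vl" "set vl = vertices i n H" "distinct el" "set el = edges
      i n H S"
    "vertices_stored H vl st" "edges_stored vl el st" "owners i n H vl st"
    using assms(3) by (simp_all add: recorded_def)
  have "?H (fst (vl ! k)) (snd (vl ! k)) = H (fst (vl ! k)) (snd (vl ! k))" if "k < length vl" for k
  proof -
    have "vl ! k \<in> vertices i n H" using rec(3) that nth_mem by blast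
    then show ?thesis by (auto simp: vertices_def finished_def)
  qed
  then have "vertices_stored ?H vl st" using rec(6) by (simp add: vertices_stored_def)
  moreover have "owners (Suc i) 0 ?H vl st" using rec(8) by (simp add: owners_def)
  ultimately show ?thesis
    unfolding recorded_def vertices_next_layer[OF assms(1,2)] edges_next_layer[OF assms(1,2)]
    using rec by simp
qed

lemma wp_reduce_layer:
  assumes static: "static st" and i: "regs st ''i'' = i" "1 \<le> i"
    and red: "reduced i 0 H S" and rec: "recorded i 0 H S vl el st"
  shows "wp (For ''c'' (Reg ''n'')
          (Cond (Less (Load ''I'' (Reg ''c'')) (Add (Reg ''i'') (Const 1))) reduce_column Skip))
     (\<lambda>st' T'. (\<exists>H S vl el. reduced i n H S \<and> recorded i n H S vl el st') \<and>
        cost n st' T' \<le> cost n st T + 30 * n + 2) st T"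
proof -
  have n: "regs st ''n'' = n" using static by (simp add: static_def)
  show ?thesis
    apply simp
    apply (rule wp_count[where ?k0.0 = 0 and bound = n and
          I = "\<lambda>st' T' k. (\<exists>H S vl el. reduced i k H S \<and> recorded i k H S vl el
              st') \<and>
        cost n st' T' \<le> cost n st T + 30 * k + 1"])
         apply simp
        apply simp
    subgoal
    proof -
      have "recorded i 0 H S vl el (st\<lparr>regs := (regs st)(''c'' := 0)\<rparr>)"
        using rec by (simp add: recorded_def holds_def vertices_stored_def edges_stored_def owners_def)
      moreover have "cost n (st\<lparr>regs := (regs st)(''c'' := 0)\<rparr>) (Suc T) \<le> cost n st T + 1"
        by (simp add: cost_def potential_def)
      ultimately show ?thesis using red by auto
    qed
      apply (simp add: unchanged_def n reduce_column_def resolve_def emit_edge_def add_column_def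
          record_vertex_def)
    subgoal premises prems for st1 T1 k
    proof -
      from prems(1) obtain H S vl el where r: "reduced i k H S" "recorded i k H S vl el st1"
        and cost: "cost n st1 T1 \<le> cost n st T + 30 * k + 1" by blast
      have k: "regs st1 ''c'' = k" "k < n" using prems by simp_all
      have v: "regs st1 ''n'' = n" "regs st1 ''i'' = i" "regs st1 ''s'' = regs st ''s''"
        "arrays st1 ''I'' = arrays st ''I''" "arrays st1 ''J'' = arrays st ''J''"
        "arrays st1 ''base'' = arrays st ''base''"
        using prems(2)
        by (simp_all add: unchanged_def n i reduce_column_def resolve_def emit_edge_def add_column_def
            record_vertex_def)
      have st1: "static st1" using static by (simp add: static_def v n)
      have Ik: "arrays st ''I'' k = I k" using static k by (simp add: static_def)
      show ?thesis
      proof (cases "I k \<le> i")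
        case True
        have "wp reduce_column (\<lambda>st' T'. (\<exists>H S vl el. reduced i (Suc k) H S \<and>
            recorded i (Suc k) H S vl el st') \<and>
           cost n st' T' \<le> cost n st1 (T1 + 1) + 27) st1 (T1 + 1)"
          by (rule wp_reduce_column[OF st1 k(1) v(2) k(2) i(2) True r])
        then have "wp reduce_column (wp (Inc ''c'') (\<lambda>st'' T''.
             ((\<exists>H S vl el. reduced i (Suc k) H S \<and> recorded i (Suc k) H S vl el st'') \<and>
              cost n st'' (T'' + 1) \<le> cost n st T + 30 * Suc k + 1) \<and> regs st'' ''c'' = Suc
                  k)) st1 (T1 + 1)"
        proof (rule wp_weaken)
          fix st' T'
          assume u: "unchanged reduce_column st1 st'"
            and a: "(\<exists>H S vl el. reduced i (Suc k) H S \<and> recorded i (Suc k) H S vl el st') \<and>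
             cost n st' T' \<le> cost n st1 (T1 + 1) + 27"
          let ?st = "st'\<lparr>regs := (regs st')(''c'' := Suc (regs st' ''c''))\<rparr>"
          have c': "regs st' ''c'' = k"
            using u k by (simp add: unchanged_def reduce_column_def resolve_def emit_edge_def
                add_column_def record_vertex_def)
          from a obtain H S vl el where r': "reduced i (Suc k) H S" "recorded i (Suc k) H S vl el st'"
              by blast
          have "recorded i (Suc k) H S vl el ?st"
            using r'(2) by (simp add: recorded_def holds_def vertices_stored_def edges_stored_def owners_def)
          moreover have "cost n ?st (Suc (Suc T')) \<le> cost n st T + 30 * Suc k + 1"
            using a cost by (simp add: cost_def potential_def)
          ultimately show "wp (Inc ''c'') (\<lambda>st'' T''.
             ((\<exists>H S vl el. reduced i (Suc k) H S \<and> recorded i (Suc k) H S vl el st'') \<and>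
              cost n st'' (T'' + 1) \<le> cost n st T + 30 * Suc k + 1) \<and> regs st'' ''c'' = Suc k)
                  st' T'"
            using r'(1) c' by auto
        qed
        then show ?thesis using True by (simp only: wp_Seq wp_Cond) (simp add: k v Ik)
      next
        case False
        let ?st = "st1\<lparr>regs := (regs st1)(''c'' := Suc k)\<rparr>"
        have "recorded i (Suc k) H S vl el ?st"
          using r(2) False
          by (auto simp: recorded_def holds_def vertices_stored_def edges_stored_def owners_def
              vertices_def edges_def finished_Suc_inactive less_Suc_eq)
        moreover have "reduced i (Suc k) H S" using reduced_inactive r(1) False by simp
        (* An absent column costs two tests, the empty branch and the increment. *)
        moreover have "cost n ?st (T1 + 4) \<le> cost n st T + 30 * Suc k + 1"
          using cost by (simp add: cost_def potential_def)
        ultimately show ?thesis using False by (auto simp add: k v Ik eval_nat_numeral)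
      qed
    qed
    subgoal for st' T' by (auto simp: cost_def)
    done
qed

text \<open>The potential starts with at most \<open>n\<^sup>2\<close>, since no pivot exceeds
    \<open>n\<close>. At the end it is dropped from
  the cost, and only the credit for copying is kept.\<close>
lemma wp_reduce_layers:
  assumes static: "static st" and D: "holds sx n st D" and I: "\<And>t. t < n \<Longrightarrow> 1 \<le> I t"
  shows "wp reduce_layers (\<lambda>st' T'. \<exists>H S vl el. reduced (Suc s) 0 H S \<and>
     distinct vl \<and> set vl = vertices (Suc s) 0 H \<and> distinct el \<and> set el = edges (Suc s)
         0 H S \<and>
     vertices_stored H vl st' \<and> edges_stored vl el st' \<and>
     T' + 6 * (length vl + length el) \<le> T + 4 + (5 * n + 17) * (n * n) + (if n = 0 then 0 else s *
         (30 * n + 5))) st T"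
    (is "wp _ ?Q st T")
proof -
  have n: "regs st ''n'' = n" "regs st ''s'' = s" using static by (simp_all add: static_def)
  define st0 where "st0 = st\<lparr>regs := (regs st)(''nv'' := 0, ''ne'' := 0, ''i'' := 1)\<rparr>"
  have I': "0 < I t" if "t < n" for t using I[OF that] by simp
  let ?B = "\<lambda>i. T + 3 + (5 * n + 17) * (n * n) + (i - 1) * (30 * n + 5)"
  let ?I = "\<lambda>st' T'. 1 \<le> regs st' ''i'' \<and> (0 < n \<longrightarrow> regs st' ''i''
      \<le> Suc s) \<and> (n = 0 \<longrightarrow> regs st' ''i'' = 1) \<and>
    (\<exists>H S vl el. reduced (regs st' ''i'') 0 H S \<and> recorded (regs st' ''i'') 0 H S vl el
        st') \<and>
    cost n st' T' \<le> ?B (regs st' ''i'')"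
  let ?body = "For ''c'' (Reg ''n'')
          (Cond (Less (Load ''I'' (Reg ''c'')) (Add (Reg ''i'') (Const 1))) reduce_column Skip)"
  have "wp (While (Conj (Less (Const 0) (Reg ''n'')) (Less (Reg ''i'') (Add (Reg ''s'') (Const 1))))
      (?body ;; Inc ''i''))
     ?Q st0 (T + 3)"
  proof (rule wp_While[where I = ?I and m = "\<lambda>st'. Suc s - regs st' ''i''"])
    have "recorded 1 0 (\<lambda>_. D) (\<lambda>_ _. {}) [] [] st0"
      using D I' by (auto simp: recorded_def st0_def holds_def vertices_stored_def edges_stored_def owners_def
          vertices_def edges_def finished_def)
    moreover have "cost n st0 (T + 3) \<le> ?B 1"
    proof -
      have "potential n st0 \<le> (\<Sum>c<n. n)"
        unfolding potential_def using D pivot_le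
        by (intro sum_mono) (simp add: holds_def st0_def low_def)
      then show ?thesis by (simp add: cost_def st0_def)
    qed
    ultimately show "?I st0 (T + 3)"
      using reduced_init by (auto simp: st0_def)
  next
    fix st' T' assume inv: "?I st' T'" and u: "unchanged (?body ;; Inc ''i'') st0 st'"
      and test: "eval_test (Conj (Less (Const 0) (Reg ''n'')) (Less (Reg ''i'') (Add (Reg ''s'') (Const
          1)))) st'"
    have v: "regs st' ''n'' = n" "regs st' ''s'' = s"
      "arrays st' ''I'' = arrays st ''I''" "arrays st' ''J'' = arrays st ''J''"
      "arrays st' ''base'' = arrays st ''base''"
      using u by (simp_all add: unchanged_def n st0_def reduce_column_def resolve_def emit_edge_def
          add_column_def record_vertex_def)
    have st': "static st'" using static by (simp add: static_def v n)
    define i where "i = regs st' ''i''"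
    from test have i: "regs st' ''i'' = i" "1 \<le> i" "i \<le> s" "0 < n" using inv by (simp_all add:
        i_def v)
    from inv obtain H S vl el where r: "reduced i 0 H S" "recorded i 0 H S vl el st'" unfolding i_def by blast
    have "wp ?body (\<lambda>st'' T''. (\<exists>H S vl el. reduced i n H S \<and> recorded i n H S vl
        el st'') \<and>
        cost n st'' T'' \<le> cost n st' T' + 30 * n + 2) st' T'"
      by (rule wp_reduce_layer[OF st' i(1,2) r])
    then have "wp ?body (wp (Inc ''i'') (\<lambda>st'' T''. ?I st'' (T'' + 1) \<and>
        Suc s - regs st'' ''i'' < Suc s - regs st' ''i'')) st' T'"
    proof (rule wp_weaken)
      fix st2 T2 assume u2: "unchanged ?body st' st2"
        and a: "(\<exists>H S vl el. reduced i n H S \<and> recorded i n H S vl el st2) \<and>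
          cost n st2 T2 \<le> cost n st' T' + 30 * n + 2"
      have i2: "regs st2 ''i'' = i"
        using u2 by (simp add: unchanged_def i reduce_column_def resolve_def emit_edge_def
            add_column_def record_vertex_def)
      from a obtain H S vl el where r: "reduced i n H S" "recorded i n H S vl el st2" by blast
      let ?st = "st2\<lparr>regs := (regs st2)(''i'' := Suc i)\<rparr>"
      let ?H = "H(Suc i := H i)"
      have "reduced (Suc i) 0 ?H S" by (rule reduced_next_layer[OF i(2) r(1)])
      moreover have "recorded (Suc i) 0 ?H S vl el st2" by (rule recorded_next_layer[OF i(2) r])
      then have "recorded (Suc i) 0 ?H S vl el ?st"
        by (simp add: recorded_def holds_def vertices_stored_def edges_stored_def owners_def)
      moreover have "cost n ?st (T2 + 2) \<le> ?B (Suc i)"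
      proof -
        have "cost n st' T' \<le> ?B i" using inv by (simp add: i_def)
        moreover obtain i' where "i = Suc i'" using i(2) by (cases i) auto
        moreover have "cost n ?st (T2 + 2) = cost n st2 T2 + 2" by (simp add: cost_def potential_def)
        ultimately show ?thesis using a by simp
      qed
      ultimately have "?I ?st (T2 + 2) \<and> Suc s - regs ?st ''i'' < Suc s - i"
        using i by (auto simp del: One_nat_def)
      then show "wp (Inc ''i'') (\<lambda>st'' T''. ?I st'' (T'' + 1) \<and>
        Suc s - regs st'' ''i'' < Suc s - regs st' ''i'') st2 T2"
        unfolding wp_Assign using i by (simp add: i2)
    qed
    then show "wp (?body ;; Inc ''i'') (\<lambda>st'' T''. ?I st'' (T'' + 1) \<and>
        Suc s - regs st'' ''i'' < Suc s - regs st' ''i'') st' T'"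
      by (simp only: wp_Seq)
  next
    fix st' T' assume inv: "?I st' T'" and u: "unchanged (?body ;; Inc ''i'') st0 st'"
      and test: "\<not> eval_test (Conj (Less (Const 0) (Reg ''n'')) (Less (Reg ''i'') (Add (Reg ''s'')
          (Const 1)))) st'"
    have v: "regs st' ''n'' = n" "regs st' ''s'' = s"
      using u by (simp_all add: unchanged_def n st0_def reduce_column_def resolve_def emit_edge_def
          add_column_def record_vertex_def)
    from inv obtain H S vl el where r: "reduced (regs st' ''i'') 0 H S" "recorded (regs st' ''i'') 0 H
        S vl el st'"
      by blast
    have cost: "T' + 6 * (length vl + length el) \<le> ?B (regs st' ''i'')"
      using inv r by (simp add: cost_def recorded_def vertices_stored_def edges_stored_def)
    show "?Q st' (T' + 1)"
    proof (cases "n = 0")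
      case True
      have empty: "vertices j 0 H = {}" "edges j 0 H S = {}" for j
        using True unfolding vertices_def edges_def finished_def by auto
      have "reduced (Suc s) 0 H S" using True unfolding reduced_def finished_def by simp
      moreover have "distinct vl" "set vl = vertices (Suc s) 0 H" "distinct el" "set el = edges (Suc s) 0 H S"
        "vertices_stored H vl st'" "edges_stored vl el st'"
        using r(2) unfolding recorded_def empty by blast+
      moreover have "regs st' ''i'' = 1" using inv True by blast
      with cost have "T' + 1 + 6 * (length vl + length el) \<le>
          T + 4 + (5 * n + 17) * (n * n) + (if n = 0 then 0 else s * (30 * n + 5))" by simp
      ultimately show ?thesis by blast
    next
      case False
      with test inv have i: "regs st' ''i'' = Suc s" by (auto simp: v)
      show ?thesis
        using r cost False unfolding i
        by (intro exI[of _ H] exI[of _ S] exI[of _ vl] exI[of _ el]) (simp add: recorded_def)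
    qed
  qed
  then show ?thesis
    unfolding reduce_layers_def by (simp add: st0_def eval_nat_numeral del: wp_Cond)
qed

end

section \<open>The complete program\<close>

definition write_output :: program where
  "write_output =
     Store ''out'' (Const 0) (Reg ''nv'') ;;
     Assign ''q'' (Const 1) ;;
     (For ''x'' (Reg ''nv'')
       (Store ''out'' (Reg ''q'') (Load ''layer'' (Reg ''x'')) ;;
        Store ''out'' (Add (Reg ''q'') (Const 1)) (Load ''birth'' (Reg ''x'')) ;;
        Store ''out'' (Add (Reg ''q'') (Const 2)) (Load ''death'' (Reg ''x'')) ;;
        Assign ''q'' (Add (Reg ''q'') (Const 3)))) ;;
     Store ''out'' (Reg ''q'') (Reg ''ne'') ;;
     Inc ''q'' ;;
     (For ''x'' (Reg ''ne'')
       (Store ''out'' (Reg ''q'') (Load ''from'' (Reg ''x'')) ;;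
        Store ''out'' (Add (Reg ''q'') (Const 1)) (Load ''to'' (Reg ''x'')) ;;
        Assign ''q'' (Add (Reg ''q'') (Const 2)))) ;;
     Assign ''out_length'' (Reg ''q'')"

lemma map_fun_upd_upt: "q \<le> q' \<Longrightarrow> map (f(q' := a)) [0..<q] = map f [0..<q]"
  by (intro map_cong) auto

lemma wp_write_output:
  fixes st T
  defines "vs \<equiv> map (\<lambda>k. (arrays st ''layer'' k, arrays st ''birth'' k, arrays st
      ''death'' k)) [0..<regs st ''nv'']"
    and "es \<equiv> map (\<lambda>k. (arrays st ''from'' k, arrays st ''to'' k)) [0..<regs st ''ne'']"
  shows "wp write_output (\<lambda>st' T'. output_words st' = graph_encoding vs es \<and>
    T' \<le> T + 6 * (regs st ''nv'' + regs st ''ne'') + 9) st T"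
proof -
  let ?nv = "regs st ''nv''" and ?ne = "regs st ''ne''"
  let ?out = "\<lambda>st'. map (arrays st' ''out'') [0..<regs st' ''q'']"
  let ?V = "\<lambda>k. ?nv # concat (map (\<lambda>k. [arrays st ''layer'' k, arrays st ''birth'' k,
      arrays st ''death'' k]) [0..<k])"
  let ?E = "\<lambda>k. ?ne # concat (map (\<lambda>k. [arrays st ''from'' k, arrays st ''to'' k]) [0..<k])"
  have enc: "graph_encoding vs es = ?V ?nv @ ?E ?ne"
    by (simp add: graph_encoding_def vs_def es_def comp_def)
  show ?thesis
    unfolding write_output_def enc
    apply simp
    apply (rule wp_count[where ?k0.0 = 0 and bound = ?nv and
          I = "\<lambda>st' T' k. ?out st' = ?V k \<and> T' \<le> T + 3 + 6 * k"])
         apply simp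
        apply simp
       apply simp
      apply (simp add: unchanged_def)
    subgoal for st1 T1 k
      by (simp add: unchanged_def map_fun_upd_upt eval_nat_numeral)
    subgoal premises prems for st1 T1
    proof -
      from prems(2) have v: "regs st1 ''ne'' = ?ne" "arrays st1 ''from'' = arrays st ''from''"
        "arrays st1 ''to'' = arrays st ''to''"
        by (simp_all add: unchanged_def)
      show ?thesis
        apply (simp add: v)
        apply (rule wp_count[where ?k0.0 = 0 and bound = ?ne and
          I = "\<lambda>st' T' k. ?out st' = ?V ?nv @ ?E k \<and> T' \<le> T1 + 4 + 5 * k"])
             apply simp
            apply simp
        using prems(1) apply (simp add: map_fun_upd_upt)
          apply (simp add: unchanged_def v)
        subgoal for st2 T2 k
          by (simp add: unchanged_def v map_fun_upd_upt eval_nat_numeral)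
        subgoal for st2 T2
          using prems(1) by (simp add: output_words_def)
        done
    qed
    done
qed

definition graphcode_program :: "nat \<Rightarrow> program" where
  "graphcode_program p = parse ;; sort_columns ;; build_matrix p ;; reduce_layers ;; write_output"

text \<open>The summands come from reading, sorting, building the matrix, the additions and the scans of
  the \<open>s\<close> layers.\<close>
definition time_bound :: "nat \<Rightarrow> nat \<Rightarrow> nat" where
  "time_bound s n = 23 + 8 * n + n * (5 * n + 6) + n * (6 * n + 10) + (5 * n + 17) * (n * n) +
     (if n = 0 then 0 else s * (30 * n + 5))"

text \<open>Everything that the run of the program provides, before any homology enters.\<close>
lemma graphcode_program_correct:
  fixes L :: "(nat list \<times> nat \<times> nat) list"
  defines "n \<equiv> length L"
  assumes dist: "\<And>x. x < n \<Longrightarrow> distinct (fst (L ! x))"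
    and row: "\<And>x. x < n \<Longrightarrow> 1 \<le> fst (snd (L ! x))"
    and faces: "\<And>x \<sigma>. x < n \<Longrightarrow> facets p (set (fst (L ! x))) \<sigma>
        \<noteq> 0 \<Longrightarrow> \<exists>y<n. \<sigma> = set (fst (L ! y))"
  obtains \<pi> H S vl el t vs es where
    "bij_betw \<pi> {..<n} {..<n}"
    and "\<And>c c'. c \<le> c' \<Longrightarrow> c' < n \<Longrightarrow> snd (snd (L ! \<pi> c))
        \<le> snd (snd (L ! \<pi> c'))"
    and "layers.reduced p n (\<lambda>c. set (fst (L ! \<pi> c))) (\<lambda>c. fst (snd (L ! \<pi> c)))
        (Suc s) 0 H S"
    and "distinct vl" "set vl = layers.vertices n (\<lambda>c. fst (snd (L ! \<pi> c))) (Suc s) 0 H"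
    and "distinct el" "set el = layers.edges n (\<lambda>c. fst (snd (L ! \<pi> c))) (Suc s) 0 H S"
    and "vs = map (\<lambda>(j, c). (j, snd (snd (L ! \<pi> (low (\<lambda>c. set (fst (L ! \<pi> c)))
        n (H j c) - 1))), snd (snd (L ! \<pi> c)))) vl"
    and "length es = length el"
    and "\<And>k. k < length es \<Longrightarrow> fst (es ! k) < length vl \<and> snd (es ! k) < length
        vl \<and>
           el ! k = (vl ! fst (es ! k), vl ! snd (es ! k))"
    and "outputs_in_time (graphcode_program p) (input_encoding s N L) (graph_encoding vs es) t"
    and "t \<le> time_bound s n"
proof -
  let ?J = "\<lambda>x. snd (snd (L ! x))"
  define \<pi> where "\<pi> = the_inv_into {..<n} (rank ?J n)"
  have rank: "bij_betw (rank ?J n) {..<n} {..<n}" by (rule rank_bij)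
  have \<pi>: "bij_betw \<pi> {..<n} {..<n}" unfolding \<pi>_def by (rule bij_betw_the_inv_into[OF rank])
  then have \<pi>_less: "\<pi> c < n" if "c < n" for c using that by (auto simp: bij_betw_def)
  have rank_\<pi>: "rank ?J n (\<pi> c) = c" if "c < n" for c
    unfolding \<pi>_def using rank that by (intro f_the_inv_into_f_bij_betw) auto
  have mono: "?J (\<pi> c) \<le> ?J (\<pi> c')" if "c \<le> c'" "c' < n" for c c'
  proof (cases "c = c'")
    case False
    then have "rank ?J n (\<pi> c) < rank ?J n (\<pi> c')" using rank_\<pi> that by simp
    then have "before ?J (\<pi> c) (\<pi> c')" using rank_less_iff[of "\<pi> c'" n "\<pi> c"]
        \<pi>_less that by simp
    then show ?thesis by (auto simp: before_def)
  qed simp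
  define sx where "sx = (\<lambda>c. set (fst (L ! \<pi> c)))"
  define I where "I = (\<lambda>c. fst (snd (L ! \<pi> c)))"
  define J where "J = (\<lambda>c. ?J (\<pi> c))"
  interpret layers p s n sx I J
  proof
    fix t \<sigma> assume "t < n" "facets p (sx t) \<sigma> \<noteq> 0"
    then obtain y where y: "y < n" "\<sigma> = set (fst (L ! y))" using faces[of "\<pi> t" \<sigma>]
        \<pi>_less by (auto simp: sx_def)
    then have "y \<in> \<pi> ` {..<n}" using \<pi> by (simp add: bij_betw_def)
    with y show "\<exists>r<n. \<sigma> = sx r" by (auto simp: sx_def)
  qed
  let ?Post = "\<lambda>st' T'. \<exists>H S vl el vs es. reduced (Suc s) 0 H S \<and>
     distinct vl \<and> set vl = vertices (Suc s) 0 H \<and> distinct el \<and> set el = edges (Suc s)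
         0 H S \<and>
     vs = map (\<lambda>(j, c). (j, J (lowest (H j c) - 1), J c)) vl \<and> length es = length el \<and>
     (\<forall>k<length es. fst (es ! k) < length vl \<and> snd (es ! k) < length vl \<and>
           el ! k = (vl ! fst (es ! k), vl ! snd (es ! k))) \<and>
     output_words st' = graph_encoding vs es \<and> T' \<le> time_bound s n"
  have "wp (graphcode_program p) ?Post (initial_state (input_encoding s N L)) 0"
    unfolding graphcode_program_def wp_Seq
  proof (rule wp_parse)
    fix st1 T1 assume p1: "parsed s L st1" and T1: "T1 \<le> 0 + 8 * length L + 5"
    show "wp sort_columns (wp (build_matrix p) (wp reduce_layers (wp write_output ?Post))) st1 T1"
    proof (rule wp_sort_columns[where n = n and J = ?J])
      show "regs st1 ''n'' = n" using p1 by (simp add: parsed_def n_def)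
      show "arrays st1 ''col'' x = ?J x" if "x < n" for x using p1 that by (simp add: parsed_def n_def)
      fix st2 T2 assume u2: "unchanged sort_columns st1 st2"
        and perm: "\<And>x. x < n \<Longrightarrow> arrays st2 ''perm'' (rank ?J n x) = x" and T2: "T2
            \<le> T1 + n * (5 * n + 6) + 2"
      have p2: "parsed s L st2" using p1 u2 by (simp add: parsed_def unchanged_def sort_columns_def)
      show "wp (build_matrix p) (wp reduce_layers (wp write_output ?Post)) st2 T2"
      proof (rule wp_build_matrix[OF p2, where \<pi> = \<pi>])
        show "arrays st2 ''perm'' c = \<pi> c" if "c < length L" for c
          using perm[of "\<pi> c"] rank_\<pi>[of c] \<pi>_less[of c] that by (simp add: n_def)
        show "\<pi> c < length L" if "c < length L" for c using \<pi>_less that by (simp add: n_def)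
        show "distinct (fst (L ! x))" if "x < length L" for x using dist that by (simp add: n_def)
        fix st3 T3 assume u3: "unchanged (build_matrix p) st2 st3"
          and h: "holds (\<lambda>c. set (fst (L ! \<pi> c))) (length L) st3 (\<lambda>c. facets p (set
              (fst (L ! \<pi> c))))"
          and arr: "\<And>c. c < length L \<Longrightarrow> arrays st3 ''base'' c = c * length L \<and>
            arrays st3 ''I'' c = fst (snd (L ! \<pi> c)) \<and> arrays st3 ''J'' c = snd (snd (L ! \<pi> c))"
          and T3: "T3 \<le> T2 + length L * (6 * length L + 10) + 3"
        have "static st3" unfolding static_def using arr u3 p2
          by (simp add: parsed_def unchanged_def build_matrix_def n_def I_def J_def)
        moreover have "holds sx n st3 D" using h by (simp add: sx_def n_def)
        moreover have "1 \<le> I t" if "t < n" for t using row[of "\<pi> t"] \<pi>_less that by (simp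
            add: I_def)
        ultimately have "wp reduce_layers (\<lambda>st' T'. \<exists>H S vl el. reduced (Suc s) 0 H S \<and>
     distinct vl \<and> set vl = vertices (Suc s) 0 H \<and> distinct el \<and> set el = edges (Suc s)
         0 H S \<and>
     vertices_stored H vl st' \<and> edges_stored vl el st' \<and>
     T' + 6 * (length vl + length el) \<le> T3 + 4 + (5 * n + 17) * (n * n) + (if n = 0 then 0 else s *
         (30 * n + 5))) st3 T3"
          by (rule wp_reduce_layers)
        then show "wp reduce_layers (wp write_output ?Post) st3 T3"
        proof (rule wp_weaken)
          fix st4 T4
          assume "\<exists>H S vl el. reduced (Suc s) 0 H S \<and>
     distinct vl \<and> set vl = vertices (Suc s) 0 H \<and> distinct el \<and> set el = edges (Suc s)
         0 H S \<and>
     vertices_stored H vl st4 \<and> edges_stored vl el st4 \<and>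
     T4 + 6 * (length vl + length el) \<le> T3 + 4 + (5 * n + 17) * (n * n) + (if n = 0 then 0 else s *
         (30 * n + 5))"
          then obtain H S vl el where r: "reduced (Suc s) 0 H S" "distinct vl" "set vl = vertices (Suc s) 0 H"
            "distinct el" "set el = edges (Suc s) 0 H S" and vst: "vertices_stored H vl st4" and est:
                "edges_stored vl el st4"
            and T4: "T4 + 6 * (length vl + length el) \<le> T3 + 4 + (5 * n + 17) * (n * n) + (if n = 0
                then 0 else s * (30 * n + 5))"
            by (elim exE conjE)
          have len: "regs st4 ''nv'' = length vl" "regs st4 ''ne'' = length el"
            using vst est by (simp_all add: vertices_stored_def edges_stored_def)
          define vs where "vs = map (\<lambda>k. (arrays st4 ''layer'' k, arrays st4 ''birth'' k,
              arrays st4 ''death'' k)) [0..<regs st4 ''nv'']"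
          define es where "es = map (\<lambda>k. (arrays st4 ''from'' k, arrays st4 ''to'' k))
              [0..<regs st4 ''ne'']"
          have vs: "vs = map (\<lambda>(j, c). (j, J (lowest (H j c) - 1), J c)) vl"
            unfolding vs_def len using vst
            by (intro nth_equalityI) (simp_all add: vertices_stored_def case_prod_beta)
          have es: "length es = length el" "\<forall>k<length es. fst (es ! k) < length vl \<and> snd
              (es ! k) < length vl \<and>
           el ! k = (vl ! fst (es ! k), vl ! snd (es ! k))"
            unfolding es_def len using est by (simp_all add: edges_stored_def)
          have "wp write_output (\<lambda>st' T'. output_words st' = graph_encoding vs es \<and>
            T' \<le> T4 + 6 * (regs st4 ''nv'' + regs st4 ''ne'') + 9) st4 T4"
            unfolding vs_def es_def by (rule wp_write_output)
          then show "wp write_output ?Post st4 T4"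
          proof (rule wp_weaken)
            fix st5 T5 assume a: "output_words st5 = graph_encoding vs es \<and>
              T5 \<le> T4 + 6 * (regs st4 ''nv'' + regs st4 ''ne'') + 9"
            have "T5 \<le> time_bound s n"
              using a T1 T2 T3 T4 unfolding len time_bound_def n_def by linarith
            with a r vs es show "?Post st5 T5" by blast
          qed
        qed
      qed
    qed
  qed
  then obtain t st' where ex: "exec (graphcode_program p) (initial_state (input_encoding s N L)) t st'"
    and "?Post st' (0 + t)"
    unfolding wp_def by blast
  from this(2) obtain H S vl el vs es where post: "reduced (Suc s) 0 H S" "distinct vl" "set vl =
      vertices (Suc s) 0 H"
    "distinct el" "set el = edges (Suc s) 0 H S"
    "vs = map (\<lambda>(j, c). (j, J (lowest (H j c) - 1), J c)) vl" "length es = length el"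
    "\<forall>k<length es. fst (es ! k) < length vl \<and> snd (es ! k) < length vl \<and>
           el ! k = (vl ! fst (es ! k), vl ! snd (es ! k))"
    "output_words st' = graph_encoding vs es" "t \<le> time_bound s n"
    by (elim exE conjE) simp
  show thesis
  proof (rule that[of \<pi> H S vl el vs es t])
    show "outputs_in_time (graphcode_program p) (input_encoding s N L) (graph_encoding vs es) t"
      using ex post(9) unfolding outputs_in_time_def by blast
  qed (use \<pi> mono post in \<open>simp_all add: sx_def I_def J_def\<close>)
qed

section \<open>The output is a graphcode\<close>

locale layers_in_bifiltration = layers p s n sx I J
  for p s n :: nat and sx I J +
  fixes K :: "simplex set" and N :: nat and F :: "nat \<Rightarrow> nat \<Rightarrow> simplex set"
    and H :: "nat \<Rightarrow> nat \<Rightarrow> chain" and S :: "nat \<Rightarrow> nat \<Rightarrow>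
        nat set"
  assumes N: "1 \<le> N"
    and sub: "\<And>i l. i \<in> {1..s} \<Longrightarrow> l \<in> {1..N} \<Longrightarrow> F i l
        \<subseteq> K"
    and sx_inj: "inj_on sx {..<n}"
    and sx_range: "sx ` {..<n} = simplices p K \<union> simplices (p + 1) K"
    and critical: "\<And>t. t < n \<Longrightarrow> critical_index s N F (sx t) (I t) (J t)"
    and J_mono: "\<And>t t'. t \<le> t' \<Longrightarrow> t' < n \<Longrightarrow> J t \<le> J t'"
    and vanish: "\<And>i. i \<in> {1..s} \<Longrightarrow> homology_vanishes p (F i N)"
    and red: "reduced (Suc s) 0 H S"
begin

lemma finished_iff: "j \<in> {1..s} \<Longrightarrow> finished (Suc s) 0 j t \<longleftrightarrow> t <
    n \<and> I t \<le> j"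
  by (auto simp: finished_def)

text \<open>The ghost history restricted to layer \<open>i\<close>; \<open>1\<close>-criticality says
    which simplices each stage contains.\<close>
lemma slice: 
  assumes i: "i \<in> {1..s}"
  shows "reduced_slice p N (F i) n sx J {t. t < n \<and> I t \<le> i} (H i)"
proof
  show "1 \<le> N" by (rule N)
  show "{t. t < n \<and> I t \<le> i} \<subseteq> {..<n}" by auto
  show "inj_on sx {..<n}" by (rule sx_inj)
  show "J r \<le> J r'" if "r \<le> r'" "r' < n" for r r' using that by (rule J_mono)
  show "J t \<in> {1..N}" if "t \<in> {t. t < n \<and> I t \<le> i}" for t
    using critical[of t] that by (simp add: critical_index_def)
  show "homology_vanishes p (F i N)" by (rule vanish[OF i])
  show "simplices q (F i l) = sx ` {t \<in> {t. t < n \<and> I t \<le> i}. card (sx t) = q + 1 \<and> J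
      t \<le> l}"
    if l: "l \<in> {1..N}" and q: "q \<in> {p, p + 1}" for l q
  proof -
    have iff: "sx t \<in> F i l \<longleftrightarrow> I t \<le> i \<and> J t \<le> l" if "t < n" for t
      using critical[OF that] i l unfolding critical_index_def by blast
    have sub': "simplices q (F i l) \<subseteq> sx ` {..<n}"
      unfolding sx_range using sub[OF i l] q by (auto simp: simplices_def)
    show ?thesis
    proof (intro equalityI subsetI)
      fix \<sigma> assume \<sigma>: "\<sigma> \<in> simplices q (F i l)"
      then obtain t where t: "t < n" "\<sigma> = sx t" using sub' by blast
      with \<sigma> iff show "\<sigma> \<in> sx ` {t \<in> {t. t < n \<and> I t \<le> i}. card (sx t) =
          q + 1 \<and> J t \<le> l}"
        by (simp add: simplices_def)
    next
      fix \<sigma> assume "\<sigma> \<in> sx ` {t \<in> {t. t < n \<and> I t \<le> i}. card (sx t) = q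
          + 1 \<and> J t \<le> l}"
      with iff show "\<sigma> \<in> simplices q (F i l)" by (auto simp: simplices_def)
    qed
  qed
  show "H i t - D t \<in> chain.span (D ` {u \<in> {t. t < n \<and> I t \<le> i}. u < t})"
    if "t \<in> {t. t < n \<and> I t \<le> i}" for t
  proof -
    have "{u \<in> {t. t < n \<and> I t \<le> i}. u < t} = {u. u < t \<and> I u \<le> i}" using that by auto
    then show ?thesis using red i that unfolding reduced_def by auto
  qed
  show "t = u" if "t \<in> {t. t < n \<and> I t \<le> i}" "u \<in> {t. t < n \<and> I t \<le> i}" "H i
      t \<noteq> 0"
    "lowest (H i t) = lowest (H i u)" for t u
    using red[unfolded reduced_def, THEN conjunct2, THEN conjunct2, THEN conjunct2, rule_format, of i t u]
      that finished_iff[OF i] by blast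
qed

definition ind :: "nat \<Rightarrow> nat set" where
  "ind i = {t \<in> {t. t < n \<and> I t \<le> i}. H i t \<noteq> 0}"

definition A :: "nat \<Rightarrow> chain set" where
  "A i = H i ` ind i"

lemma vertices_iff: "(j, t) \<in> vertices (Suc s) 0 H \<longleftrightarrow> j \<in> {1..s} \<and> t
    \<in> ind j"
  by (auto simp: vertices_def finished_def ind_def)

lemma barcode_basis_A: "i \<in> {1..s} \<Longrightarrow> barcode_basis p N (F i) (A i)"
  unfolding A_def ind_def by (rule reduced_slice.barcode_basis_R[OF slice])

lemma H_inj: "i \<in> {1..s} \<Longrightarrow> inj_on (H i) (ind i)"
  unfolding ind_def by (rule reduced_slice.R_inj[OF slice])

lemma label:
  assumes "i \<in> {1..s}" "t \<in> ind i"
  shows "graphcode_label p N F (i, H i t) = (i, J (lowest (H i t) - 1), J t)"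
  using reduced_slice.birth_R[OF slice[OF assms(1)], of t] reduced_slice.death_R[OF slice[OF assms(1)], of t]
    assms(2)
  by (simp add: graphcode_label_def ind_def)

text \<open>By the history, \<open>H i t\<close> is the sum of the basis elements in \<open>S (i + 1)
    t\<close> and, unless it became zero,
  of column \<open>t\<close> itself.\<close>
lemma edge_iff:
  assumes v: "(i, t) \<in> vertices (Suc s) 0 H" "(j, u) \<in> vertices (Suc s) 0 H"
  shows "((i, t), (j, u)) \<in> edges (Suc s) 0 H S \<longleftrightarrow> ((i, H i t), (j, H j u))
      \<in> graphcode_edges s A"
proof -
  from v have i: "i \<in> {1..s}" "t \<in> ind i" and j: "j \<in> {1..s}" "u \<in> ind j"
    by (simp_all add: vertices_iff)
  have "((i, t), (j, u)) \<in> edges (Suc s) 0 H S \<longleftrightarrow> j = i + 1 \<and> (u \<in> S j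
      t \<or> u = t \<and> H j t \<noteq> 0)"
    using i j by (auto simp: edges_def finished_def ind_def)
  also have "\<dots> \<longleftrightarrow> j = i + 1 \<and> chain.representation (A j) (H i t) (H j u) = 1"
  proof (rule conj_cong[OF refl])
    assume ji: "j = i + 1"
    have f: "finished (Suc s) 0 j t" using i ji j by (auto simp: finished_iff ind_def)
    have St: "S j t \<subseteq> {u. u < t \<and> finished (Suc s) 0 j u \<and> H j u \<noteq> 0}"
      and "H (j - 1) t = H j t + (\<Sum>u\<in>S j t. H j u)"
      using red f unfolding reduced_def by blast+
    then have Ht: "H i t = H j t + (\<Sum>u\<in>S j t. H j u)" by (simp add: ji)
    let ?U = "if H j t \<noteq> 0 then insert t (S j t) else S j t"
    have "finite (S j t)" using St by (rule finite_subset) (auto intro: finite_subset[of _ "{..<t}"])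
    moreover have "t \<notin> S j t" using St by auto
    ultimately have "H i t = (\<Sum>u\<in>?U. H j u)" using Ht by simp
    moreover have "?U \<subseteq> ind j" using St f j(1) by (auto simp: finished_iff ind_def)
    moreover have "u \<in> ?U \<longleftrightarrow> u \<in> S j t \<or> u = t \<and> H j t \<noteq> 0" by auto
    ultimately show "(u \<in> S j t \<or> u = t \<and> H j t \<noteq> 0) \<longleftrightarrow>
        chain.representation (A j) (H i t) (H j u) = 1"
      using reduced_slice.representation_sum_columns[OF slice[OF j(1)], of ?U u] j(2)
      unfolding A_def ind_def by simp
  qed
  also have "\<dots> \<longleftrightarrow> ((i, H i t), (j, H j u)) \<in> graphcode_edges s A"
    using i j by (auto simp: graphcode_edges_def A_def)
  finally show ?thesis .
qed

lemma lists_graphcode_A: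
  assumes vl: "distinct vl" "set vl = vertices (Suc s) 0 H"
    and el: "distinct el" "set el = edges (Suc s) 0 H S"
    and vs: "vs = map (\<lambda>(j, c). (j, J (lowest (H j c) - 1), J c)) vl"
    and es: "length es = length el" "\<And>k. k < length es \<Longrightarrow> fst (es ! k) < length vl
        \<and> snd (es ! k) < length vl \<and>
           el ! k = (vl ! fst (es ! k), vl ! snd (es ! k))"
  shows "lists_graphcode p s N F A vs es"
proof -
  let ?\<psi> = "\<lambda>(j, t). (j, H j t)"
  define \<phi> where "\<phi> k = ?\<psi> (vl ! k)" for k
  have len: "length vs = length vl" by (simp add: vs)
  have "inj_on ?\<psi> (set vl)"
  proof (rule inj_onI)
    fix a b assume ab: "a \<in> set vl" "b \<in> set vl" "?\<psi> a = ?\<psi> b"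
    obtain i t j u where e: "a = (i, t)" "b = (j, u)" by (metis surj_pair)
    from ab(3) e have ij: "i = j" and eq: "H j t = H j u" by auto
    from ab(1,2) have "j \<in> {1..s}" "t \<in> ind j" "u \<in> ind j"
      unfolding vl e ij vertices_iff by blast+
    then have "t = u" using inj_onD[OF H_inj eq] by blast
    then show "a = b" by (simp add: e ij)
  qed
  then have "bij_betw ?\<psi> (set vl) (?\<psi> ` set vl)" by (simp add: bij_betw_def)
  moreover have "?\<psi> ` set vl = graphcode_vertices s A"
    unfolding vl graphcode_vertices_def by (force simp: vertices_iff A_def)
  moreover have "bij_betw ((!) vl) {..<length vl} (set vl)"
    using vl(1) by (rule bij_betw_nth) simp_all
  ultimately have "bij_betw (?\<psi> \<circ> (!) vl) {..<length vl} (graphcode_vertices s A)"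
    by (simp add: bij_betw_trans)
  then have bij: "bij_betw \<phi> {..<length vs} (graphcode_vertices s A)"
    by (simp add: \<phi>_def[abs_def] comp_def len)
  have labels: "vs ! k = graphcode_label p N F (\<phi> k)" if k: "k < length vs" for k
  proof -
    obtain j t where jt: "vl ! k = (j, t)" by (metis surj_pair)
    moreover have "vl ! k \<in> set vl" using k len by simp
    ultimately have "j \<in> {1..s}" "t \<in> ind j" unfolding vl by (simp_all add: vertices_iff)
    then show ?thesis using k jt by (simp add: vs \<phi>_def label)
  qed
  have "el = map (\<lambda>(k, l). (vl ! k, vl ! l)) es"
    using es by (intro nth_equalityI) (simp_all add: case_prod_beta)
  then have des: "distinct es" and sel: "set el = (\<lambda>(k, l). (vl ! k, vl ! l)) ` set es"
    using el(1) by (auto simp: distinct_map)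
  have range: "set es \<subseteq> {..<length vs} \<times> {..<length vs}"
  proof
    fix e assume "e \<in> set es"
    then obtain k where "k < length es" "e = es ! k" by (auto simp: in_set_conv_nth)
    with es(2)[of k] show "e \<in> {..<length vs} \<times> {..<length vs}" by (simp add: len mem_Times_iff)
  qed
  have "(k, l) \<in> set es \<longleftrightarrow> (\<phi> k, \<phi> l) \<in> graphcode_edges s A" if
      kl: "k < length vs" "l < length vs" for k l
  proof -
    have "(k, l) \<in> set es \<longleftrightarrow> (vl ! k, vl ! l) \<in> set el"
    proof
      assume "(vl ! k, vl ! l) \<in> set el"
      then obtain k' l' where "(k', l') \<in> set es" "vl ! k = vl ! k'" "vl ! l = vl ! l'"
        by (auto simp: sel)
      moreover from this range have "k' < length vl" "l' < length vl" by (auto simp: len)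
      ultimately show "(k, l) \<in> set es" using vl(1) kl len by (simp add: nth_eq_iff_index_eq)
    qed (auto simp: sel)
    also have "\<dots> \<longleftrightarrow> (\<phi> k, \<phi> l) \<in> graphcode_edges s A"
    proof -
      have "vl ! k \<in> set vl" "vl ! l \<in> set vl" using kl len by simp_all
      then show ?thesis unfolding vl el \<phi>_def by (cases "vl ! k"; cases "vl ! l") (simp add: edge_iff)
    qed
    finally show ?thesis .
  qed
  with bij labels des range show ?thesis unfolding lists_graphcode_def by blast
qed

end

lemma length_bifiltration_list:
  assumes "lists_bifiltration p K s N F L"
  shows "length L = num_simplices p K"
proof -
  let ?f = "\<lambda>(v, i\<^sub>0, j\<^sub>0). set v :: simplex"
  have d: "distinct (map ?f L)" and im: "set (map ?f L) = simplices p K \<union> simplices (p + 1) K"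
    using assms by (simp_all add: lists_bifiltration_def)
  have "length L = card (simplices p K \<union> simplices (p + 1) K)"
    using distinct_card[OF d] im by simp
  also have "\<dots> = card (simplices p K) + card (simplices (p + 1) K)"
  proof (rule card_Un_disjoint)
    have "finite (simplices p K \<union> simplices (p + 1) K)" unfolding im[symmetric] by simp
    then show "finite (simplices p K)" "finite (simplices (p + 1) K)" by simp_all
  qed (auto simp: simplices_def)
  finally show ?thesis by (simp add: num_simplices_def)
qed

lemma graphcode_program_outputs_graphcode:
  assumes bif: "bifiltration K s N F" and vanish: "\<And>i. i \<in> {1..s} \<Longrightarrow>
      homology_vanishes p (F i N)"
    and L: "lists_bifiltration p K s N F L"
  shows "\<exists>A vs es t. (\<forall>i\<in>{1..s}. barcode_basis p N (F i) (A i)) \<and>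
      lists_graphcode p s N F A vs es \<and>
    outputs_in_time (graphcode_program p) (input_encoding s N L) (graph_encoding vs es) t \<and>
    t \<le> time_bound s (num_simplices p K)"
proof -
  define n where "n = length L"
  have n: "n = num_simplices p K" unfolding n_def by (rule length_bifiltration_list[OF L])
  let ?f = "\<lambda>x. set (fst (L ! x))"
  have dmap: "distinct (map (\<lambda>(v, i\<^sub>0, j\<^sub>0). set v) L)" using L by (simp add:
      lists_bifiltration_def)
  have f_inj: "inj_on ?f {..<n}"
  proof (rule inj_onI)
    fix x y assume "x \<in> {..<n}" "y \<in> {..<n}" "?f x = ?f y"
    then show "x = y" using nth_eq_iff_index_eq[OF dmap, of x y] by (simp add: n_def case_prod_beta)
  qed
  have f_range: "?f ` {..<n} = simplices p K \<union> simplices (p + 1) K"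
  proof -
    have "?f ` {..<n} = (\<lambda>(v, i\<^sub>0, j\<^sub>0). set v) ` set L"
      by (force simp: n_def set_conv_nth case_prod_beta image_iff)
    then show ?thesis using L by (simp add: lists_bifiltration_def)
  qed
  have rec: "distinct (fst (L ! x))" "critical_index s N F (?f x) (fst (snd (L ! x))) (snd (snd (L ! x)))"
    if "x < n" for x
  proof -
    have "L ! x \<in> set L" using that by (simp add: n_def)
    then show "distinct (fst (L ! x))" "critical_index s N F (?f x) (fst (snd (L ! x))) (snd (snd (L ! x)))"
      using L by (auto simp: lists_bifiltration_def case_prod_beta)
  qed
  have N: "1 \<le> N" and s: "1 \<le> s" using bif by (simp_all add: bifiltration_def)
  have "finite_simplicial_complex (F s N)" and FK: "F s N = K"
    using bif N s unfolding bifiltration_def by auto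
  then have face_in: "\<tau> \<in> K" if "\<sigma> \<in> K" "\<tau> \<noteq> {}" "\<tau> \<subseteq>
      \<sigma>" for \<sigma> \<tau>
    using that unfolding finite_simplicial_complex_def by blast
  have faces: "\<exists>y<n. \<sigma> = ?f y" if x: "x < n" and nz: "facets p (?f x) \<sigma> \<noteq>
      0" for x \<sigma>
  proof -
    have \<sigma>: "card \<sigma> = p + 1" "\<sigma> \<subseteq> ?f x" using nz by (simp_all add:
        facets_def split: if_splits)
    have "?f x \<in> K" using f_range x by (auto simp: simplices_def)
    moreover have "\<sigma> \<noteq> {}" using \<sigma>(1) by auto
    ultimately have "\<sigma> \<in> simplices p K" using face_in \<sigma> by (auto simp: simplices_def)
    then have "\<sigma> \<in> ?f ` {..<n}" using f_range by blast
    then show ?thesis by auto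
  qed
  obtain \<pi> H S vl el t vs es where \<pi>: "bij_betw \<pi> {..<n} {..<n}"
    and mono: "\<And>c c'. c \<le> c' \<Longrightarrow> c' < n \<Longrightarrow> snd (snd (L ! \<pi>
        c)) \<le> snd (snd (L ! \<pi> c'))"
    and red: "layers.reduced p n (\<lambda>c. ?f (\<pi> c)) (\<lambda>c. fst (snd (L ! \<pi> c))) (Suc
        s) 0 H S"
    and vl: "distinct vl" "set vl = layers.vertices n (\<lambda>c. fst (snd (L ! \<pi> c))) (Suc s) 0 H"
    and el: "distinct el" "set el = layers.edges n (\<lambda>c. fst (snd (L ! \<pi> c))) (Suc s) 0 H S"
    and vs: "vs = map (\<lambda>(j, c). (j, snd (snd (L ! \<pi> (low (\<lambda>c. ?f (\<pi> c)) n (H j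
        c) - 1))), snd (snd (L ! \<pi> c)))) vl"
    and es: "length es = length el" "\<And>k. k < length es \<Longrightarrow> fst (es ! k) < length vl
        \<and> snd (es ! k) < length vl \<and>
           el ! k = (vl ! fst (es ! k), vl ! snd (es ! k))"
    and out: "outputs_in_time (graphcode_program p) (input_encoding s N L) (graph_encoding vs es) t"
      "t \<le> time_bound s n"
  proof (rule graphcode_program_correct[of L p s N, folded n_def])
    show "distinct (fst (L ! x))" if "x < n" for x using rec(1)[OF that] .
    show "1 \<le> fst (snd (L ! x))" if "x < n" for x using rec(2)[OF that] by (simp add: critical_index_def)
    show "\<exists>y<n. \<sigma> = ?f y" if "x < n" "facets p (?f x) \<sigma> \<noteq> 0" for x
        \<sigma> using that by (rule faces)
  qed (rule that)
  have \<pi>_less: "\<pi> c < n" if "c < n" for c using \<pi> that by (auto simp: bij_betw_def)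
  have \<pi>_surj: "\<exists>c<n. y = \<pi> c" if "y < n" for y
  proof -
    have "y \<in> \<pi> ` {..<n}" using \<pi> that by (simp add: bij_betw_def)
    then show ?thesis by auto
  qed
  interpret layers_in_bifiltration p s n "\<lambda>c. ?f (\<pi> c)" "\<lambda>c. fst (snd (L ! \<pi>
      c))" "\<lambda>c. snd (snd (L ! \<pi> c))"
    K N F H S
  proof unfold_locales
    fix t \<sigma> assume "t < n" "facets p (?f (\<pi> t)) \<sigma> \<noteq> 0"
    then obtain y where "y < n" "\<sigma> = ?f y" using faces[OF \<pi>_less] by blast
    with \<pi>_surj show "\<exists>r<n. \<sigma> = ?f (\<pi> r)" by blast
  next
    show "F i l \<subseteq> K" if "i \<in> {1..s}" "l \<in> {1..N}" for i l
      using bif that by (simp add: bifiltration_def)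
    have "inj_on (?f \<circ> \<pi>) {..<n}" using \<pi> f_inj by (intro comp_inj_on) (auto simp: bij_betw_def)
    then show "inj_on (\<lambda>c. ?f (\<pi> c)) {..<n}" by (simp add: comp_def)
    have "(\<lambda>c. ?f (\<pi> c)) ` {..<n} = ?f ` \<pi> ` {..<n}" by (simp add: image_image)
    then show "(\<lambda>c. ?f (\<pi> c)) ` {..<n} = simplices p K \<union> simplices (p + 1) K"
      using \<pi> f_range by (simp add: bij_betw_def)
    show "critical_index s N F (?f (\<pi> t)) (fst (snd (L ! \<pi> t))) (snd (snd (L ! \<pi> t)))" if
        "t < n" for t
      using rec(2) \<pi>_less that by blast
    show "layers.reduced p n (\<lambda>c. ?f (\<pi> c)) (\<lambda>c. fst (snd (L ! \<pi> c))) (Suc s) 0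
        H S" by (rule red)
  qed (use N mono vanish in auto)
  have "lists_graphcode p s N F A vs es"
    using vl el vs es by (rule lists_graphcode_A)
  with barcode_basis_A out show ?thesis unfolding n by blast
qed

text \<open>Without simplices only the constant remains; otherwise \<open>s * (30 * n + 5)\<close> is
    at most \<open>35 * s * n\<close>.\<close>
lemma time_bound_le:
  assumes "s * n \<le> c * n ^ 3"
  shows "time_bound s n \<le> 23 + (57 + 35 * c) * n ^ 3"
proof (cases "n = 0")
  case False
  then have n: "1 \<le> n" by simp
  have "time_bound s n = 23 + 24 * n + 28 * n ^ 2 + 5 * n ^ 3 + s * (30 * n + 5)"
    using False by (simp add: time_bound_def power2_eq_square power3_eq_cube algebra_simps)
  moreover have "n \<le> n ^ 3" "n ^ 2 \<le> n ^ 3"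
    using n power_increasing[of 1 3 n] power_increasing[of 2 3 n] by simp_all
  moreover have "s * (30 * n + 5) \<le> 35 * (c * n ^ 3)"
  proof -
    have "s * (30 * n + 5) \<le> s * (35 * n)" using n by (intro mult_le_mono2) simp
    also have "\<dots> = 35 * (s * n)" by simp
    also have "\<dots> \<le> 35 * (c * n ^ 3)" using assms by (rule mult_le_mono2)
    finally show ?thesis .
  qed
  moreover have "(57 + 35 * c) * n ^ 3 = 57 * n ^ 3 + 35 * (c * n ^ 3)" by (simp add: algebra_simps)
  ultimately show ?thesis by linarith
qed (simp add: time_bound_def)

(* A graphcode has up to s * n vertices, so it cannot be written down in O(n^3) time when the number
   s of slices is arbitrarily large compared with n (e.g. when slices are repeated). Hence the
   proviso s * n = O(n^3), with an arbitrary constant c; it holds in particular for fixed s and for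
   s <= n. *)
theorem mainTheorem2:
  fixes p :: nat
  shows "\<exists>P :: program. \<forall>c :: nat. \<exists>T :: nat \<Rightarrow> nat.
    (\<lambda>n. real (T n)) \<in> O(\<lambda>n. real n ^ 3) \<and>
    (\<forall>K s N F L.
       bifiltration K s N F \<and> one_critical K s N F \<and>
       (\<forall>i\<in>{1..s}. homology_vanishes p (F i N)) \<and>
       lists_bifiltration p K s N F L \<and>
       s * num_simplices p K \<le> c * num_simplices p K ^ 3 \<longrightarrow>
       (\<exists>A vs es t.
          (\<forall>i\<in>{1..s}. barcode_basis p N (F i) (A i)) \<and>
          lists_graphcode p s N F A vs es \<and>
          outputs_in_time P (input_encoding s N L) (graph_encoding vs es) t \<and>
          t \<le> T (num_simplices p K)))"
proof (rule exI[of _ "graphcode_program p"], intro allI)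
  fix c :: nat
  let ?T = "\<lambda>n::nat. 23 + (57 + 35 * c) * n ^ 3"
  have "(\<lambda>n. real (?T n)) \<in> O(\<lambda>n. real n ^ 3)"
  proof (rule bigoI[of _ "real (80 + 35 * c)"])
    show "eventually (\<lambda>n. norm (real (?T n)) \<le> real (80 + 35 * c) * norm (real n ^ 3)) at_top"
      using eventually_ge_at_top[of 1]
    proof eventually_elim
      case (elim n)
      then have "?T n \<le> (80 + 35 * c) * n ^ 3" by (simp add: algebra_simps)
      then have "real (?T n) \<le> real ((80 + 35 * c) * n ^ 3)" by (rule of_nat_mono)
      then show ?case by simp
    qed
  qed
  moreover have "\<exists>A vs es t. (\<forall>i\<in>{1..s}. barcode_basis p N (F i) (A i)) \<and>
      lists_graphcode p s N F A vs es \<and>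
      outputs_in_time (graphcode_program p) (input_encoding s N L) (graph_encoding vs es) t \<and>
      t \<le> ?T (num_simplices p K)"
    if "bifiltration K s N F \<and> one_critical K s N F \<and> (\<forall>i\<in>{1..s}.
        homology_vanishes p (F i N)) \<and>
       lists_bifiltration p K s N F L \<and> s * num_simplices p K \<le> c * num_simplices p K ^ 3" for
           K s N F L
  proof -
    have "\<exists>A vs es t. (\<forall>i\<in>{1..s}. barcode_basis p N (F i) (A i)) \<and>
        lists_graphcode p s N F A vs es \<and>
      outputs_in_time (graphcode_program p) (input_encoding s N L) (graph_encoding vs es) t \<and>
      t \<le> time_bound s (num_simplices p K)"
      by (rule graphcode_program_outputs_graphcode) (use that in blast)+
    then obtain A vs es t where out: "\<forall>i\<in>{1..s}. barcode_basis p N (F i) (A i)"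
      "lists_graphcode p s N F A vs es"
      "outputs_in_time (graphcode_program p) (input_encoding s N L) (graph_encoding vs es) t"
      and t: "t \<le> time_bound s (num_simplices p K)"
      by (elim exE conjE)
    have "time_bound s (num_simplices p K) \<le> ?T (num_simplices p K)"
      by (rule time_bound_le) (use that in blast)
    with t have "t \<le> ?T (num_simplices p K)" by (rule order_trans)
    with out show ?thesis by blast
  qed
  ultimately show "\<exists>T :: nat \<Rightarrow> nat.
    (\<lambda>n. real (T n)) \<in> O(\<lambda>n. real n ^ 3) \<and>
    (\<forall>K s N F L.
       bifiltration K s N F \<and> one_critical K s N F \<and>
       (\<forall>i\<in>{1..s}. homology_vanishes p (F i N)) \<and>
       lists_bifiltration p K s N F L \<and>
       s * num_simplices p K \<le> c * num_simplices p K ^ 3 \<longrightarrow>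
       (\<exists>A vs es t.
          (\<forall>i\<in>{1..s}. barcode_basis p N (F i) (A i)) \<and>
          lists_graphcode p s N F A vs es \<and>
          outputs_in_time (graphcode_program p) (input_encoding s N L) (graph_encoding vs es) t \<and>
          t \<le> T (num_simplices p K)))"
    by (intro exI[of _ ?T] conjI allI impI)
qed

end
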